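(* Let $k$ be a positive integer, let $a\in M_k$ be a Hermitian operator, and let $L^-,L^+\in\mathbb{R}$ be such that $L^-\le a\le L^+$. Let $\sigma(a)\ge 0$ be given by $\sigma(a)^2=\tau(a^2)-\tau(a)^2$, and let $t\in(0,1]$. Assume that every atom $\xi_0$ of $\mu_a$ satisfies $\mu_a(\{\xi_0\})\le 1-\frac1k$. Then: (1) If $0<t\le \frac1k$, the measure $\mu_a^{\boxplus 1/t}$ has no atoms, and $$\|a\|_{(t)}\le \max\Big\{\big|tL^+ +2\sigma(a)\sqrt{t(1-t)}+(1-t)\tau(a)\big|,\ \big|tL^- -2\sigma(a)\sqrt{t(1-t)}+(1-t)\tau(a)\big|\Big\}.$$ (2) If $\frac1k<t\le 1$, then $$\|a\|_{(t)}\le \max\Big\{L^+,\ L^-,\ \big|tL^+ +2\sigma(a)\sqrt{t(1-t)}+(1-t)\tau(a)\big|,\ \big|tL^- -2\sigma(a)\sqrt{t(1-t)}+(1-t)\tau(a)\big|\Big\}.$$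
   Context: Let $\mathcal{A}$ be a $II_1$ factor with faithful normal tracial state $\tau$ ($\tau(1)=1$). $M_k\subset\mathcal{A}$ denotes a $k$-dimensional abelian subalgebra spanned by $k$ mutually orthogonal self-adjoint projections, each of trace $1/k$ (and summing to $1$); Hermitian elements of $M_k$ are identified with vectors $(a_1,\dots,a_k)\in\mathbb{R}^k$, so $\tau(a)=\frac1k\sum_i a_i$. For $a=a^*$, $\mu_a$ is the spectral distribution of $a$ with respect to $\tau$; for $a\in M_k$, $\mu_a=\frac1k\sum_{i=1}^k\delta_{a_i}$. For $t\in(0,1]$ let $p_t\in\mathcal{A}$ be a projection with $\tau(p_t)=t$ that is free (in Voiculescu's sense, with respect to $\tau$) from $M_k$. The $(t)$-norm of $a$ is $\|a\|_{(t)}:=\|p_tap_t\|_\infty$ (operator norm). For a probability measure $\mu$ on $\mathbb{R}$ and $T\ge1$, $\mu^{\boxplus T}$ denotes the free additive convolution power: the unique probability measure on $\mathbb{R}$ whose Voiculescu transform is $\varphi_{\mu^{\boxplus T}}=T\varphi_\mu$, where $\varphi_\mu(z)=F_\mu^{-1}(z)-z$, $F_\mu=1/G_\mu$, $G_\mu(z)=\int_{\mathbb{R}}\frac{d\mu(s)}{z-s}$ (the equality holding on a truncated cone $\{x+iy: y>M,\ |x|<\eta y\}$ where both sides are defined). Equivalently (Nica–Speicher), $\mu_a^{\boxplus 1/t}$ is the distribution of $t^{-1}p_tap_t$ in the compressed space $(p_t\mathcal{A}p_t,\,t^{-1}\tau)$. *)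

theory Defs
  imports "HOL-Probability.Probability" "HOL-Library.Nonpos_Ints"
begin

section \<open>Complex Hilbert spaces and their bounded operators\<close>

class complex_vector = real_vector +
  fixes scaleC :: "complex \<Rightarrow> 'a \<Rightarrow> 'a"  (infixr \<open>*\<^sub>C\<close> 75)
  assumes scaleC_add_right: "c *\<^sub>C (x + y) = c *\<^sub>C x + c *\<^sub>C y"
    and scaleC_add_left: "(c + d) *\<^sub>C x = c *\<^sub>C x + d *\<^sub>C x"
    and scaleC_scaleC: "c *\<^sub>C (d *\<^sub>C x) = (c * d) *\<^sub>C x"
    and scaleC_of_real: "complex_of_real r *\<^sub>C x = r *\<^sub>R x"

text \<open>The complex inner product is linear in its first argument; its real part is the
  real inner product that induces the norm and topology.\<close>

class complex_hilbert = complex_vector + real_inner + complete_space +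
  fixes cinner :: "'a \<Rightarrow> 'a \<Rightarrow> complex"
  assumes cinner_commute: "cinner x y = cnj (cinner y x)"
    and cinner_add_left: "cinner (x + y) z = cinner x z + cinner y z"
    and cinner_scaleC_left: "cinner (c *\<^sub>C x) y = c * cinner x y"
    and Re_cinner: "Re (cinner x y) = inner x y"

lemma cinner_scaleC_right: "cinner x (c *\<^sub>C y) = cnj c * cinner x y"
  for x y :: "'a::complex_hilbert"
  by (metis cinner_commute cinner_scaleC_left complex_cnj_mult)

lemma norm_scaleC: "norm (c *\<^sub>C x) = cmod c * norm x" for x :: "'a::complex_hilbert"
proof -
  have im: "Im (cinner x x) = 0"
    by (metis cinner_commute cnj.simps(2) equal_neg_zero)
  have "inner (c *\<^sub>C x) (c *\<^sub>C x) = Re ((c * cnj c) * cinner x x)"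
    by (simp flip: Re_cinner add: cinner_scaleC_left cinner_scaleC_right mult_ac)
  also have "\<dots> = (cmod c)\<^sup>2 * inner x x"
    by (simp add: im Re_cinner complex_mult_cnj cmod_power2)
  finally show ?thesis
    by (simp add: norm_eq_sqrt_inner real_sqrt_mult)
qed

definition bounded_clinear :: "('h::complex_hilbert \<Rightarrow> 'h) \<Rightarrow> bool" where
  "bounded_clinear f \<longleftrightarrow> bounded_linear f \<and> (\<forall>c x. f (c *\<^sub>C x) = c *\<^sub>C f x)"

lemma bounded_linear_scaleC: "bounded_linear (\<lambda>x::'h::complex_hilbert. c *\<^sub>C x)"
proof (rule bounded_linear_intro[where K = "cmod c"])
  fix r :: real and x :: 'h
  show "c *\<^sub>C (r *\<^sub>R x) = r *\<^sub>R (c *\<^sub>C x)"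
    by (simp add: scaleC_scaleC mult.commute flip: scaleC_of_real)
qed (simp_all add: scaleC_add_right norm_scaleC)

lemma scaleC_0_right: "c *\<^sub>C (0::'a::complex_vector) = 0"
  by (metis add_cancel_right_right scaleC_add_right)

lemma scaleC_minus_right: "c *\<^sub>C (- x) = - (c *\<^sub>C x)" for x :: "'a::complex_vector"
  by (metis add_eq_0_iff add.right_inverse scaleC_0_right scaleC_add_right)

lemma scaleC_diff_right: "c *\<^sub>C (x - y) = c *\<^sub>C x - c *\<^sub>C y" for x y :: "'a::complex_vector"
  by (metis scaleC_add_right scaleC_minus_right diff_conv_add_uminus)

lemma scaleC_scaleR: "c *\<^sub>C (r *\<^sub>R x) = r *\<^sub>R (c *\<^sub>C x)" for x :: "'a::complex_vector"
  by (simp add: scaleC_scaleC mult.commute flip: scaleC_of_real)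

text \<open>\<open>'h bop\<close> is $B(H)$; multiplication is composition and the norm is the operator norm.\<close>

typedef (overloaded) 'h bop = "{f :: 'h::complex_hilbert \<Rightarrow> 'h. bounded_clinear f}"
  morphisms bop_apply Abs_bop
  by (rule exI[of _ "\<lambda>_. 0"]) (simp add: bounded_clinear_def scaleC_0_right)

setup_lifting type_definition_bop

instantiation bop :: (complex_hilbert) real_normed_algebra
begin

lift_definition norm_bop :: "'a bop \<Rightarrow> real" is onorm .

lift_definition zero_bop :: "'a bop" is "\<lambda>_. 0"
  by (simp add: bounded_clinear_def scaleC_0_right)

lift_definition plus_bop :: "'a bop \<Rightarrow> 'a bop \<Rightarrow> 'a bop" is "\<lambda>f g h. f h + g h"
  by (simp add: bounded_clinear_def bounded_linear_add scaleC_add_right)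

lift_definition minus_bop :: "'a bop \<Rightarrow> 'a bop \<Rightarrow> 'a bop" is "\<lambda>f g h. f h - g h"
  by (simp add: bounded_clinear_def bounded_linear_sub scaleC_diff_right)

lift_definition uminus_bop :: "'a bop \<Rightarrow> 'a bop" is "\<lambda>f h. - f h"
  by (simp add: bounded_clinear_def bounded_linear_minus scaleC_minus_right)

lift_definition times_bop :: "'a bop \<Rightarrow> 'a bop \<Rightarrow> 'a bop" is "\<lambda>f g h. f (g h)"
  by (simp add: bounded_clinear_def bounded_linear_compose)

lift_definition scaleR_bop :: "real \<Rightarrow> 'a bop \<Rightarrow> 'a bop" is "\<lambda>r f h. r *\<^sub>R f h"
  by (simp add: bounded_clinear_def bounded_linear_const_scaleR scaleC_scaleR)

definition sgn_bop :: "'a bop \<Rightarrow> 'a bop" where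
  "sgn_bop x = scaleR (inverse (norm x)) x"

definition dist_bop :: "'a bop \<Rightarrow> 'a bop \<Rightarrow> real" where
  "dist_bop x y = norm (x - y)"

definition uniformity_bop :: "('a bop \<times> 'a bop) filter" where
  "uniformity_bop = (INF e\<in>{0 <..}. principal {(x, y). dist x y < e})"

definition open_bop :: "'a bop set \<Rightarrow> bool" where
  "open_bop S = (\<forall>x\<in>S. \<forall>\<^sub>F (x', y) in uniformity. x' = x \<longrightarrow> y \<in> S)"

instance
proof
  fix x y z :: "'a bop" and r s :: real
  show "dist x y = norm (x - y)" by (rule dist_bop_def)
  show "sgn x = scaleR (inverse (norm x)) x" by (rule sgn_bop_def)
  show "uniformity = (INF e\<in>{0 <..}. principal {(x::'a bop, y). dist x y < e})"
    by (rule uniformity_bop_def)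
  show "open S = (\<forall>x\<in>S. \<forall>\<^sub>F (x', y) in uniformity. x' = x \<longrightarrow> y \<in> S)" for S :: "'a bop set"
    by (rule open_bop_def)
  show "x + y + z = x + (y + z)" by transfer (simp add: algebra_simps)
  show "x + y = y + x" by transfer (simp add: algebra_simps)
  show "0 + x = x" by transfer simp
  show "- x + x = 0" by transfer simp
  show "x - y = x + - y" by transfer simp
  show "r *\<^sub>R (x + y) = r *\<^sub>R x + r *\<^sub>R y" by transfer (simp add: algebra_simps)
  show "(r + s) *\<^sub>R x = r *\<^sub>R x + s *\<^sub>R x" by transfer (simp add: algebra_simps)
  show "r *\<^sub>R s *\<^sub>R x = (r * s) *\<^sub>R x" by transfer simp
  show "1 *\<^sub>R x = x" by transfer simp
  show "x * y * z = x * (y * z)" by transfer simp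
  show "(x + y) * z = x * z + y * z" by transfer simp
  show "x * (y + z) = x * y + x * z"
    by transfer (simp add: bounded_clinear_def linear_simps)
  show "(r *\<^sub>R x) * y = r *\<^sub>R (x * y)" by transfer simp
  show "x * (r *\<^sub>R y) = r *\<^sub>R (x * y)"
    by transfer (simp add: bounded_clinear_def linear_simps)
  show "(norm x = 0) = (x = 0)"
    by transfer (auto simp: bounded_clinear_def onorm_eq_0)
  show "norm (x + y) \<le> norm x + norm y"
    by transfer (simp add: bounded_clinear_def onorm_triangle)
  show "norm (r *\<^sub>R x) = \<bar>r\<bar> * norm x"
    by transfer (simp add: bounded_clinear_def onorm_scaleR)
  show "norm (x * y) \<le> norm x * norm y"
    by transfer (use onorm_compose in \<open>auto simp: bounded_clinear_def comp_def\<close>)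
qed

end

instantiation bop :: (complex_hilbert) monoid_mult
begin

lift_definition one_bop :: "'a bop" is "\<lambda>h. h"
  by (simp add: bounded_clinear_def)

instance
  by standard (transfer; simp)+

end

instantiation bop :: (complex_hilbert) complex_vector
begin

lift_definition scaleC_bop :: "complex \<Rightarrow> 'a bop \<Rightarrow> 'a bop" is "\<lambda>c f h. c *\<^sub>C f h"
  by (auto simp: bounded_clinear_def scaleC_scaleC mult.commute
      intro: bounded_linear_compose[OF bounded_linear_scaleC])

instance
  by standard (transfer; simp add: scaleC_add_right scaleC_add_left scaleC_scaleC scaleC_of_real)+

end

definition adj :: "'h::complex_hilbert bop \<Rightarrow> 'h bop" where
  "adj x = (THE y. \<forall>u v. cinner (bop_apply x u) v = cinner u (bop_apply y v))"

definition hermitian :: "'h::complex_hilbert bop \<Rightarrow> bool" where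
  "hermitian x \<longleftrightarrow> adj x = x"

definition is_projection :: "'h::complex_hilbert bop \<Rightarrow> bool" where
  "is_projection p \<longleftrightarrow> hermitian p \<and> p * p = p"

definition op_le :: "'h::complex_hilbert bop \<Rightarrow> 'h bop \<Rightarrow> bool"  (infix \<open>\<preceq>\<close> 50) where
  "x \<preceq> y \<longleftrightarrow> (\<forall>h. cinner (bop_apply (y - x) h) h \<in> \<real>\<^sub>\<ge>\<^sub>0)"


section \<open>II$_1$ factors and their trace\<close>

definition commutant :: "'h::complex_hilbert bop set \<Rightarrow> 'h bop set" where
  "commutant S = {y. \<forall>x\<in>S. x * y = y * x}"

definition von_neumann_algebra :: "'h::complex_hilbert bop set \<Rightarrow> bool" where
  "von_neumann_algebra A \<longleftrightarrow> (\<forall>x\<in>A. adj x \<in> A) \<and> commutant (commutant A) = A"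

definition is_factor :: "'h::complex_hilbert bop set \<Rightarrow> bool" where
  "is_factor A \<longleftrightarrow> von_neumann_algebra A \<and> A \<inter> commutant A = range (\<lambda>c. c *\<^sub>C 1)"

text \<open>Type II$_1$: a finite factor (every isometry is unitary) of infinite dimension.
  Real and complex spans give the same notion of finite-dimensionality.\<close>

definition II1_factor :: "'h::complex_hilbert bop set \<Rightarrow> bool" where
  "II1_factor A \<longleftrightarrow> is_factor A
     \<and> (\<forall>v\<in>A. adj v * v = 1 \<longrightarrow> v * adj v = 1)
     \<and> \<not> (\<exists>B. finite B \<and> A \<subseteq> span B)"

text \<open>Normality: the functional preserves least upper bounds (taken among the Hermitian elements
  of \<open>A\<close>) of upward directed sets, i.e. of bounded increasing nets.\<close>

definition normal_on :: "'h::complex_hilbert bop set \<Rightarrow> ('h bop \<Rightarrow> complex) \<Rightarrow> bool" where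
  "normal_on A \<tau> \<longleftrightarrow> (\<forall>D s.
     D \<noteq> {} \<and> D \<subseteq> {x\<in>A. hermitian x} \<and> (\<forall>x\<in>D. \<forall>y\<in>D. \<exists>z\<in>D. x \<preceq> z \<and> y \<preceq> z)
     \<and> s \<in> A \<and> hermitian s \<and> (\<forall>x\<in>D. x \<preceq> s)
     \<and> (\<forall>u\<in>A. hermitian u \<and> (\<forall>x\<in>D. x \<preceq> u) \<longrightarrow> s \<preceq> u)
     \<longrightarrow> \<tau> s = complex_of_real (SUP x\<in>D. Re (\<tau> x)))"

text \<open>Only the values of \<open>\<tau>\<close> on \<open>A\<close> are constrained.\<close>

definition faithful_normal_tracial_state ::
    "'h::complex_hilbert bop set \<Rightarrow> ('h bop \<Rightarrow> complex) \<Rightarrow> bool" where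
  "faithful_normal_tracial_state A \<tau> \<longleftrightarrow>
     (\<forall>x\<in>A. \<forall>y\<in>A. \<tau> (x + y) = \<tau> x + \<tau> y)
     \<and> (\<forall>x\<in>A. \<forall>c. \<tau> (c *\<^sub>C x) = c * \<tau> x)
     \<and> \<tau> 1 = 1
     \<and> (\<forall>x\<in>A. \<tau> (adj x * x) \<in> \<real>\<^sub>\<ge>\<^sub>0)
     \<and> (\<forall>x\<in>A. \<tau> (adj x * x) = 0 \<longrightarrow> x = 0)
     \<and> (\<forall>x\<in>A. \<forall>y\<in>A. \<tau> (x * y) = \<tau> (y * x))
     \<and> normal_on A \<tau>"

definition is_Mk :: "'h::complex_hilbert bop set \<Rightarrow> ('h bop \<Rightarrow> complex) \<Rightarrow> nat \<Rightarrow> 'h bop set \<Rightarrow> bool"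
  where
  "is_Mk A \<tau> k M \<longleftrightarrow> (\<exists>e :: nat \<Rightarrow> 'h bop.
     (\<forall>i<k. e i \<in> A \<and> is_projection (e i) \<and> \<tau> (e i) = 1 / of_nat k)
     \<and> (\<forall>i<k. \<forall>j<k. i \<noteq> j \<longrightarrow> e i * e j = 0)
     \<and> (\<Sum>i<k. e i) = 1
     \<and> M = {(\<Sum>i<k. c i *\<^sub>C e i) | c :: nat \<Rightarrow> complex. True})"


section \<open>Freeness\<close>

inductive_set star_algebra_gen :: "'h::complex_hilbert bop set \<Rightarrow> 'h bop set" for S where
  gen_base: "x \<in> S \<Longrightarrow> x \<in> star_algebra_gen S"
| gen_one: "1 \<in> star_algebra_gen S"
| gen_add: "x \<in> star_algebra_gen S \<Longrightarrow> y \<in> star_algebra_gen S \<Longrightarrow> x + y \<in> star_algebra_gen S"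
| gen_scale: "x \<in> star_algebra_gen S \<Longrightarrow> c *\<^sub>C x \<in> star_algebra_gen S"
| gen_mult: "x \<in> star_algebra_gen S \<Longrightarrow> y \<in> star_algebra_gen S \<Longrightarrow> x * y \<in> star_algebra_gen S"
| gen_adj: "x \<in> star_algebra_gen S \<Longrightarrow> adj x \<in> star_algebra_gen S"

text \<open>Voiculescu freeness of a family of unital subalgebras \<open>B i\<close>: alternating products of
  centred elements are centred.\<close>

definition free_family :: "('h::complex_hilbert bop \<Rightarrow> complex) \<Rightarrow> 'i set \<Rightarrow> ('i \<Rightarrow> 'h bop set) \<Rightarrow> bool"
  where
  "free_family \<tau> I B \<longleftrightarrow> (\<forall>js xs.
     js \<noteq> [] \<and> length xs = length js \<and> set js \<subseteq> I
     \<and> (\<forall>n. Suc n < length js \<longrightarrow> js ! n \<noteq> js ! Suc n)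
     \<and> (\<forall>n<length js. xs ! n \<in> B (js ! n) \<and> \<tau> (xs ! n) = 0)
     \<longrightarrow> \<tau> (prod_list xs) = 0)"

definition free_from :: "('h::complex_hilbert bop \<Rightarrow> complex) \<Rightarrow> 'h bop \<Rightarrow> 'h bop set \<Rightarrow> bool" where
  "free_from \<tau> x M \<longleftrightarrow>
     free_family \<tau> UNIV (\<lambda>b::bool. star_algebra_gen (if b then {x} else M))"


section \<open>Spectral distributions and free convolution powers\<close>

text \<open>The compactly supported Borel probability measure with the moments of \<open>a\<close>.\<close>

definition spectral_distribution :: "('h::complex_hilbert bop \<Rightarrow> complex) \<Rightarrow> 'h bop \<Rightarrow> real measure"
  where
  "spectral_distribution \<tau> a = (THE \<mu>. prob_space \<mu> \<and> sets \<mu> = sets borel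
     \<and> (\<exists>R. AE s in \<mu>. \<bar>s\<bar> \<le> R)
     \<and> (\<forall>n. \<tau> (a ^ n) = complex_of_real (\<integral>s. s ^ n \<partial>\<mu>)))"

definition is_atom :: "real measure \<Rightarrow> real \<Rightarrow> bool" where
  "is_atom \<mu> \<xi> \<longleftrightarrow> emeasure \<mu> {\<xi>} > 0"

definition cauchy_transform :: "real measure \<Rightarrow> complex \<Rightarrow> complex" where
  "cauchy_transform \<mu> z = (\<integral>s. 1 / (z - complex_of_real s) \<partial>\<mu>)"

definition recip_cauchy_transform :: "real measure \<Rightarrow> complex \<Rightarrow> complex" where
  "recip_cauchy_transform \<mu> z = 1 / cauchy_transform \<mu> z"

definition truncated_cone :: "real \<Rightarrow> real \<Rightarrow> complex set" where
  "truncated_cone \<eta> M = {z. Im z > M \<and> \<bar>Re z\<bar> < \<eta> * Im z}"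

text \<open>\<open>\<phi>\<close> is the Voiculescu transform \<open>\<phi>(z) = F\<inverse>(z) - z\<close> of \<open>\<mu>\<close> on \<open>D\<close>, where \<open>F\<inverse>\<close> inverts
  the restriction of \<open>F\<close> to a truncated cone on which \<open>F\<close> is injective and whose image
  contains \<open>D\<close>. The choice of that cone does not affect the values at all sufficiently large
  points of a truncated cone \<open>D\<close>.\<close>

definition is_voiculescu_transform ::
    "real measure \<Rightarrow> complex set \<Rightarrow> (complex \<Rightarrow> complex) \<Rightarrow> bool" where
  "is_voiculescu_transform \<mu> D \<phi> \<longleftrightarrow> (\<exists>\<alpha>>0. \<exists>\<beta>>0.
     inj_on (recip_cauchy_transform \<mu>) (truncated_cone \<alpha> \<beta>)
     \<and> D \<subseteq> recip_cauchy_transform \<mu> ` truncated_cone \<alpha> \<beta>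
     \<and> (\<forall>z\<in>D. \<phi> z = inv_into (truncated_cone \<alpha> \<beta>) (recip_cauchy_transform \<mu>) z - z))"

definition free_convolution_power :: "real measure \<Rightarrow> real \<Rightarrow> real measure" where
  "free_convolution_power \<mu> T = (THE \<nu>. prob_space \<nu> \<and> sets \<nu> = sets borel
     \<and> (\<exists>\<eta>>0. \<exists>M>0. \<exists>\<phi>. is_voiculescu_transform \<mu> (truncated_cone \<eta> M) \<phi>
          \<and> is_voiculescu_transform \<nu> (truncated_cone \<eta> M) (\<lambda>z. complex_of_real T * \<phi> z)))"


section \<open>The quantities in the estimate\<close>

definition t_norm :: "'h::complex_hilbert bop \<Rightarrow> 'h bop \<Rightarrow> real" where
  "t_norm p a = norm (p * a * p)"

text \<open>For Hermitian \<open>a\<close> the numbers \<open>\<tau>(a)\<close> and \<open>\<tau>(a\<^sup>2)\<close> are real, so taking real parts is harmless.\<close>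

definition mean :: "('h::complex_hilbert bop \<Rightarrow> complex) \<Rightarrow> 'h bop \<Rightarrow> real" where
  "mean \<tau> a = Re (\<tau> a)"

definition std_dev :: "('h::complex_hilbert bop \<Rightarrow> complex) \<Rightarrow> 'h bop \<Rightarrow> real" where
  "std_dev \<tau> a = sqrt (mean \<tau> (a ^ 2) - (mean \<tau> a)\<^sup>2)"

end

theory Submission
  imports Defs "HOL-Complex_Analysis.Complex_Analysis" "HOL-Real_Asymp.Real_Asymp"
begin

text \<open>
  Norm estimate. Let \<open>a\<^sub>0 = a - \<tau>(a)\<close> and work in the pre-Hilbert space of noncommutative polynomials
  in \<open>p\<close> and \<open>M\<close> with inner product \<open>\<tau>(y\<^sup>* x)\<close>. A vector \<open>\<xi> = p \<xi>\<close> splits orthogonally as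
  \<open>\<xi> = \<eta> + \<zeta>\<close>, where \<open>\<eta>\<close> is spanned by alternating centred words that begin in \<open>M\<close>. Freeness gives
  \<open>\<langle>a\<^sub>0 \<zeta>, \<zeta>\<rangle> = 0\<close>, \<open>\<parallel>a\<^sub>0 \<zeta>\<parallel> = \<sigma> \<parallel>\<zeta>\<parallel>\<close> and \<open>\<parallel>\<eta>\<parallel>\<^sup>2 \<le> t \<parallel>\<xi>\<parallel>\<^sup>2\<close>. With \<open>L = L\<^sup>+ - \<tau>(a)\<close> and
  \<open>s = \<parallel>\<eta>\<parallel>\<^sup>2 / \<parallel>\<xi>\<parallel>\<^sup>2 \<le> t\<close>, the quotient \<open>\<langle>a\<^sub>0 \<xi>, \<xi>\<rangle> / \<parallel>\<xi>\<parallel>\<^sup>2\<close> is bounded both by \<open>L\<close> and by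
  \<open>f s = s L + 2 \<sigma> sqrt (s (1 - s))\<close>; since \<open>f\<close> is concave and \<open>f 1 = L\<close>, it is bounded by \<open>f t\<close>.
  Faithfulness of the trace turns this into an operator inequality for \<open>p a p\<close>.

  Atoms. For \<open>T = 1/t\<close> and \<open>F = 1/G\<close>, the map \<open>w \<mapsto> T w - (T - 1) F w\<close> has a right inverse \<open>\<omega>\<close> on
  the upper half-plane, and \<open>G \<circ> \<omega>\<close> is, by Nevanlinna's theorem, the Cauchy transform of a probability
  measure, which is the free convolution power. An atom of mass \<open>m\<close> of this measure at \<open>\<xi>\<close> comes from
  an atom of \<open>\<mu>\<^sub>a\<close> at \<open>\<xi>/T\<close> of mass \<open>1 - (1 - m)/T > 1 - 1/T \<ge> 1 - 1/k\<close>.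
\<close>


section \<open>Operators on a complex Hilbert space\<close>

text \<open>Freeness only says that alternating centred words have trace zero, so the norm estimate
  is arranged to use nothing but traces \<open>\<tau> (adj x * c * y)\<close> built from such words.
  No completion of the pre-Hilbert space is formed, and the estimate is available on polynomial
  vectors only. This shapes the way back to operators: for \<open>b = U p - p a p\<close> the
  polynomials in \<open>b\<close> are again combinations of words, and the test vector that detects
  a negative part of \<open>b\<close> is a norm limit of such polynomials. Hence the square root by
  a norm-convergent series, which never leaves the closed algebra generated by \<open>b\<close>.

  The free convolution power is a definite description that leaves the cones open, so existence and
  uniqueness are both required. They rest on one estimate: the difference quotient of
  \<open>F - id\<close> at \<open>w\<close> and \<open>v\<close> is at most sqrt (\<kappa> w *
  \<kappa> v), where \<kappa> is the relative gain of the imaginary part under \<open>F\<close>. It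
  makes \<open>F\<close> injective high up and makes the preimages under \<open>H\<close> unique.
  Their existence comes from Brouwer's theorem, because \<open>F - id\<close> is bounded on every
  half-plane at positive height.\<close>

lemma cinner_eq_inner: "cinner x y = Complex (inner x y) (inner x (\<i> *\<^sub>C y))" for x y :: "'a::complex_hilbert"
proof -
  have "inner x (\<i> *\<^sub>C y) = Im (cinner x y)"
    unfolding Re_cinner[symmetric] cinner_scaleC_right by simp
  then show ?thesis by (simp add: complex_eq_iff Re_cinner)
qed

lemma inner_scaleC_left: "inner (c *\<^sub>C x) y = inner x (cnj c *\<^sub>C y)" for x y :: "'a::complex_hilbert"
  unfolding Re_cinner[symmetric] by (simp add: cinner_scaleC_right cinner_scaleC_left)

lemma cinner_ext: "(\<And>u. cinner u x = cinner u y) \<Longrightarrow> x = y" for x y :: "'a::complex_hilbert"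
  by (metis Re_cinner vector_eq_ldot)

text \<open>The representing vector minimises \<open>\<parallel>x\<parallel>\<^sup>2 - 2 f x\<close>; the parallelogram law makes minimising
  sequences Cauchy.\<close>

lemma riesz_real:
  fixes f :: "'a::{real_inner,complete_space} \<Rightarrow> real"
  assumes "bounded_linear f"
  obtains w where "\<And>x. f x = inner x w"
proof -
  interpret f: bounded_linear f by fact
  define J where "J x = (norm x)\<^sup>2 - 2 * f x" for x
  obtain K where K: "\<And>x. norm (f x) \<le> norm x * K" using f.bounded by blast
  have lb: "J x \<ge> - K\<^sup>2" for x
  proof -
    have "J x \<ge> (norm x)\<^sup>2 - 2 * (norm x * K)" unfolding J_def using K[of x] by auto
    also have "(norm x)\<^sup>2 - 2 * (norm x * K) = (norm x - K)\<^sup>2 - K\<^sup>2" by (simp add: power2_eq_square algebra_simps)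
    finally show ?thesis by (smt (verit) zero_le_power2)
  qed
  define I where "I = Inf (range J)"
  have bdd: "bdd_below (range J)" using lb by (auto intro!: bdd_belowI)
  have I_le: "I \<le> J x" for x unfolding I_def by (rule cInf_lower[OF _ bdd]) auto
  have "\<exists>x. J x < I + 1 / Suc n" for n
    using cInf_lessD[of "range J" "I + 1 / Suc n"] unfolding I_def by auto
  then obtain X where X: "\<And>n. J (X n) < I + 1 / Suc n" by metis
  have par: "(norm (x - y))\<^sup>2 = 2 * J x + 2 * J y - 4 * J ((1/2) *\<^sub>R (x + y))" for x y
    unfolding J_def power2_norm_eq_inner
    by (simp add: f.scaleR f.add inner_diff_left inner_diff_right inner_add_left inner_add_right inner_commute)
      (simp add: field_simps)
  have d: "(norm (X m - X n))\<^sup>2 \<le> 2 * (1 / Suc m) + 2 * (1 / Suc n)" for m n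
    using par[of "X m" "X n"] X[of m] X[of n] I_le[of "(1/2) *\<^sub>R (X m + X n)"] by linarith
  have "Cauchy X"
  proof (rule CauchyI)
    fix e :: real assume e: "e > 0"
    obtain N where "1 / real (Suc N) < e\<^sup>2 / 4" using e nat_approx_posE[of "e\<^sup>2 / 4"] by auto
    then have N: "4 / Suc N < e\<^sup>2" by (simp add: field_simps)
    show "\<exists>M. \<forall>m\<ge>M. \<forall>n\<ge>M. norm (X m - X n) < e"
    proof (intro exI allI impI)
      fix m n assume "m \<ge> N" "n \<ge> N"
      then have "1 / Suc m \<le> 1 / Suc N" "1 / Suc n \<le> 1 / Suc N" by (auto intro!: divide_left_mono)
      then have "(norm (X m - X n))\<^sup>2 < e\<^sup>2" using d[of m n] N by linarith
      then show "norm (X m - X n) < e" using e by (simp add: power_less_imp_less_base)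
    qed
  qed
  then obtain w where w: "X \<longlonglongrightarrow> w" using convergent_eq_Cauchy by blast
  have "(\<lambda>n. J (X n)) \<longlonglongrightarrow> J w" unfolding J_def
    by (intro tendsto_intros w f.tendsto)
  moreover have "(\<lambda>n. I + 1 / Suc n) \<longlonglongrightarrow> I + 0"
    by (intro tendsto_intros LIMSEQ_Suc[OF lim_1_over_n])
  ultimately have "J w \<le> I + 0" by (rule LIMSEQ_le) (use X less_imp_le in blast)
  then have min: "J w \<le> J x" for x using I_le[of x] by simp
  have "f x = inner x w" for x
  proof (rule ccontr)
    define c where "c = f x - inner x w"
    assume "f x \<noteq> inner x w"
    then have c: "c \<noteq> 0" by (simp add: c_def)
    have J: "J (w + r *\<^sub>R x) = J w + r\<^sup>2 * (norm x)\<^sup>2 - 2 * r * c" for r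
      unfolding J_def power2_norm_eq_inner c_def
      by (simp add: f.scaleR f.add inner_add_left inner_add_right inner_commute power2_eq_square algebra_simps)
    have x: "(norm x)\<^sup>2 > 0" using c f.zero by (auto simp: c_def)
    have "(norm x)\<^sup>2 * (c / (norm x)\<^sup>2)\<^sup>2 - 2 * (c / (norm x)\<^sup>2) * c \<ge> 0"
      using min[of "w + (c / (norm x)\<^sup>2) *\<^sub>R x"] unfolding J by (simp add: algebra_simps)
    moreover have "(norm x)\<^sup>2 * (c / (norm x)\<^sup>2)\<^sup>2 - 2 * (c / (norm x)\<^sup>2) * c = - (c\<^sup>2 / (norm x)\<^sup>2)"
      using x by (simp add: field_simps power2_eq_square)
    moreover have "c\<^sup>2 / (norm x)\<^sup>2 > 0" using x c by simp
    ultimately show False by linarith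
  qed
  then show ?thesis using that by blast
qed

section \<open>Adjoints of bounded operators\<close>

lemma bounded_clinear_bop: "bounded_clinear (bop_apply x)" using bop_apply[of x] by simp
lemma bop_bounded_linear: "bounded_linear (bop_apply x)"
  using bounded_clinear_bop by (auto simp: bounded_clinear_def)
lemma bop_apply_scaleC: "bop_apply x (c *\<^sub>C u) = c *\<^sub>C bop_apply x u"
  using bounded_clinear_bop by (auto simp: bounded_clinear_def)
lemma norm_bop_apply: "norm (bop_apply x u) \<le> norm x * norm u"
  by transfer (simp add: bounded_clinear_def onorm)
lemma norm_bop_le: "0 \<le> b \<Longrightarrow> (\<And>u. norm (bop_apply x u) \<le> b * norm u) \<Longrightarrow> norm x \<le> b"
  by transfer (simp add: onorm_bound)
lemma bop_ext: "(\<And>u. bop_apply x u = bop_apply y u) \<Longrightarrow> x = y"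
  by (metis bop_apply_inject ext)
lemmas bop_apply_simps = plus_bop.rep_eq minus_bop.rep_eq uminus_bop.rep_eq zero_bop.rep_eq one_bop.rep_eq
  times_bop.rep_eq scaleR_bop.rep_eq scaleC_bop.rep_eq

text \<open>The Riesz vectors of the functionals \<open>inner (bop_apply x u) v\<close> in
  \<open>u\<close> depend on \<open>v\<close> linearly, also over the complex numbers, and
  boundedly, so they define an operator.\<close>

lemma adj_exists: "\<exists>y. \<forall>u v. inner (bop_apply x u) v = inner u (bop_apply y v)"
proof -
  have "\<exists>w. \<forall>u. inner (bop_apply x u) v = inner u w" for v
  proof -
    have "bounded_linear (\<lambda>u. inner (bop_apply x u) v)"
      by (intro bounded_linear_intros bop_bounded_linear)
    then show ?thesis using riesz_real by metis
  qed
  then obtain g where g: "\<And>u v. inner (bop_apply x u) v = inner u (g v)" by metis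
  have "bounded_clinear g" unfolding bounded_clinear_def
  proof (intro conjI allI bounded_linear_intro)
    show "g (v + w) = g v + g w" for v w
      by (rule vector_eq_ldot[THEN iffD1]) (simp add: inner_add_right flip: g)
    show "g (r *\<^sub>R v) = r *\<^sub>R g v" for r v
      by (rule vector_eq_ldot[THEN iffD1]) (simp flip: g)
    show "g (c *\<^sub>C v) = c *\<^sub>C g v" for c v
    proof (rule vector_eq_ldot[THEN iffD1], rule allI)
      fix u
      have "inner u (g (c *\<^sub>C v)) = inner (bop_apply x (cnj c *\<^sub>C u)) v"
        by (simp add: bop_apply_scaleC inner_scaleC_left flip: g)
      then show "inner u (g (c *\<^sub>C v)) = inner u (c *\<^sub>C g v)" by (simp add: g inner_scaleC_left)
    qed
    show "norm (g v) \<le> norm v * norm x" for v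
    proof -
      have "(norm (g v))\<^sup>2 = inner (bop_apply x (g v)) v" by (simp add: g power2_norm_eq_inner)
      also have "\<dots> \<le> norm x * norm (g v) * norm v"
        by (meson norm_cauchy_schwarz norm_bop_apply order_trans mult_right_mono norm_ge_zero)
      finally have "norm (g v) * norm (g v) \<le> norm (g v) * (norm v * norm x)" by (simp add: power2_eq_square mult_ac)
      then show ?thesis by (cases "norm (g v) = 0") (auto)
    qed
  qed
  then have "bop_apply (Abs_bop g) = g" by (simp add: Abs_bop_inverse)
  then show ?thesis using g by metis
qed

text \<open>The definition of \<open>adj\<close> speaks of the complex inner product. Its imaginary
  part is a real inner product with a vector multiplied by \<i>, so complex linearity of the
  operators reduces everything to the real identity.\<close>

lemma adjI:
  assumes "\<And>u v. inner (bop_apply x u) v = inner u (bop_apply y v)"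
  shows "adj x = y"
  unfolding adj_def
proof (rule the_equality)
  show "\<forall>u v. cinner (bop_apply x u) v = cinner u (bop_apply y v)"
    by (simp add: cinner_eq_inner assms flip: bop_apply_scaleC)
  show "z = y" if "\<forall>u v. cinner (bop_apply x u) v = cinner u (bop_apply z v)" for z
    by (rule bop_ext, rule cinner_ext) (metis that assms Re_cinner vector_eq_ldot)
qed

lemma inner_adj: "inner (bop_apply x u) v = inner u (bop_apply (adj x) v)"
  using adj_exists[of x] adjI by metis

lemma adj_adj [simp]: "adj (adj x) = x"
  by (rule adjI) (metis inner_adj inner_commute)
lemma adj_add [simp]: "adj (x + y) = adj x + adj y"
  by (rule adjI) (simp add: bop_apply_simps inner_add_left inner_add_right inner_adj)
lemma adj_diff [simp]: "adj (x - y) = adj x - adj y"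
  by (rule adjI) (simp add: bop_apply_simps inner_diff_left inner_diff_right inner_adj)
lemma adj_minus [simp]: "adj (- x) = - adj x"
  by (rule adjI) (simp add: bop_apply_simps inner_adj)
lemma adj_zero [simp]: "adj 0 = 0"
  by (rule adjI) (simp add: bop_apply_simps)
lemma adj_one [simp]: "adj 1 = 1"
  by (rule adjI) (simp add: bop_apply_simps)
lemma adj_mult [simp]: "adj (x * y) = adj y * adj x"
  by (rule adjI) (simp add: bop_apply_simps inner_adj)
lemma adj_scaleR [simp]: "adj (r *\<^sub>R x) = r *\<^sub>R adj x"
  by (rule adjI) (simp add: bop_apply_simps inner_adj)
lemma adj_scaleC [simp]: "adj (c *\<^sub>C x) = cnj c *\<^sub>C adj x"
  by (rule adjI) (simp add: bop_apply_simps bop_apply_scaleC inner_adj inner_scaleC_left)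
lemma adj_sum [simp]: "adj (\<Sum>i\<in>I. f i) = (\<Sum>i\<in>I. adj (f i))"
  by (induction I rule: infinite_finite_induct) auto
lemma adj_power [simp]: "adj (x ^ n) = adj x ^ n"
  by (induction n) (simp_all add: power_commutes)

lemma scaleC_one_bop: "1 *\<^sub>C x = x" for x :: "'a::complex_vector"
  using scaleC_of_real[of 1 x] by simp
lemma scaleC_zero_bop: "0 *\<^sub>C x = 0" for x :: "'a::complex_vector"
  using scaleC_of_real[of 0 x] by simp
lemma scaleC_mult_left: "(c *\<^sub>C x) * y = c *\<^sub>C (x * y)" for x y :: "'h::complex_hilbert bop"
  by (rule bop_ext) (simp add: bop_apply_simps)
lemma scaleC_mult_right: "x * (c *\<^sub>C y) = c *\<^sub>C (x * y)" for x y :: "'h::complex_hilbert bop"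
  by (rule bop_ext) (simp add: bop_apply_simps bop_apply_scaleC)
lemma scaleC_minus_left: "(- c) *\<^sub>C x = - (c *\<^sub>C x)" for x :: "'a::complex_vector"
  by (metis add.right_inverse minus_unique scaleC_add_left scaleC_zero_bop)

lemma norm_adj_le: "norm (adj x) \<le> norm x"
proof (rule norm_bop_le)
  fix u
  have "(norm (bop_apply (adj x) u))\<^sup>2 = inner (bop_apply x (bop_apply (adj x) u)) u"
    by (simp add: power2_norm_eq_inner inner_adj)
  also have "\<dots> \<le> norm x * norm (bop_apply (adj x) u) * norm u"
    by (meson norm_cauchy_schwarz norm_bop_apply order_trans mult_right_mono norm_ge_zero)
  finally show "norm (bop_apply (adj x) u) \<le> norm x * norm u"
    by (cases "norm (bop_apply (adj x) u) = 0") (auto simp: power2_eq_square mult_ac)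
qed auto

lemma bounded_linear_adj: "bounded_linear adj"
  by (rule bounded_linear_intro[where K=1]) (auto simp: norm_adj_le)

lemma closed_hermitian: "closed {x. hermitian x}"
  unfolding hermitian_def
  by (intro closed_Collect_eq bounded_linear.continuous_on[OF bounded_linear_adj] continuous_intros)

section \<open>Completeness of the operator algebra\<close>

text \<open>Pointwise limits define the limit operator, and the Cauchy estimate passes to the limit
  in one index, which makes the convergence uniform. Completeness is what lets the square root
  series converge in norm.\<close>

instance bop :: (complex_hilbert) banach
proof
  fix X :: "nat \<Rightarrow> 'a bop" assume C: "Cauchy X"
  have ptC: "Cauchy (\<lambda>n. bop_apply (X n) u)" for u
  proof (rule CauchyI)
    fix e :: real assume e: "e > 0"
    obtain M where M: "\<And>m n. m \<ge> M \<Longrightarrow> n \<ge> M \<Longrightarrow> norm (X m - X n) < e / (norm u + 1)"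
      using CauchyD[OF C, of "e / (norm u + 1)"] e by (auto simp: add_nonneg_pos)
    have "norm (bop_apply (X m) u - bop_apply (X n) u) < e" if "m \<ge> M" "n \<ge> M" for m n
    proof -
      have "norm (bop_apply (X m) u - bop_apply (X n) u) \<le> norm (X m - X n) * norm u"
        using norm_bop_apply[of "X m - X n" u] by (simp add: bop_apply_simps)
      also have "\<dots> \<le> norm (X m - X n) * (norm u + 1)" by (intro mult_left_mono) auto
      also have "\<dots> < e" using M[OF that] by (simp add: pos_less_divide_eq add_nonneg_pos)
      finally show ?thesis .
    qed
    then show "\<exists>M. \<forall>m\<ge>M. \<forall>n\<ge>M. norm (bop_apply (X m) u - bop_apply (X n) u) < e" by blast
  qed
  then obtain g where g: "\<And>u. (\<lambda>n. bop_apply (X n) u) \<longlonglongrightarrow> g u"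
    unfolding convergent_eq_Cauchy[symmetric] by metis
  obtain B where B: "\<And>n. norm (X n) \<le> B"
    using Cauchy_Bseq[OF C] by (auto simp: Bseq_def)
  have est: "norm (g u) \<le> norm u * B" for u
  proof (rule LIMSEQ_le_const2[OF tendsto_norm[OF g]])
    show "\<exists>N. \<forall>n\<ge>N. norm (bop_apply (X n) u) \<le> norm u * B"
      by (metis B norm_bop_apply mult.commute mult_left_mono norm_ge_zero order_trans)
  qed
  have "bounded_clinear g" unfolding bounded_clinear_def
  proof (intro conjI allI bounded_linear_intro[where K=B] est)
    show "g (v + w) = g v + g w" for v w
      by (rule LIMSEQ_unique[OF g]) (auto intro: tendsto_add g simp: bounded_linear.linear[OF bop_bounded_linear] linear_add)
    show "g (r *\<^sub>R v) = r *\<^sub>R g v" for r v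
      by (rule LIMSEQ_unique[OF g]) (auto intro: tendsto_scaleR g simp: bounded_linear.linear[OF bop_bounded_linear] linear_scale)
    show "g (c *\<^sub>C v) = c *\<^sub>C g v" for c v
      by (rule LIMSEQ_unique[OF g]) (simp add: bop_apply_scaleC bounded_linear.tendsto[OF bounded_linear_scaleC] g)
  qed
  then have G: "bop_apply (Abs_bop g) = g" by (simp add: Abs_bop_inverse)
  have "X \<longlonglongrightarrow> Abs_bop g"
  proof (rule LIMSEQ_I)
    fix e :: real assume e: "e > 0"
    obtain M where M: "\<And>m n. m \<ge> M \<Longrightarrow> n \<ge> M \<Longrightarrow> norm (X m - X n) < e / 2"
      using CauchyD[OF C, of "e / 2"] e by auto
    have "norm (X m - Abs_bop g) \<le> e / 2" if m: "m \<ge> M" for m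
    proof (rule norm_bop_le)
      fix u
      have "(\<lambda>n. norm (bop_apply (X m) u - bop_apply (X n) u)) \<longlonglongrightarrow> norm (bop_apply (X m) u - g u)"
        by (intro tendsto_intros g)
      then have "norm (bop_apply (X m) u - g u) \<le> e / 2 * norm u"
      proof (rule LIMSEQ_le_const2)
        have "norm (bop_apply (X m) u - bop_apply (X n) u) \<le> e / 2 * norm u" if "n \<ge> M" for n
          using norm_bop_apply[of "X m - X n" u] M[OF m that]
          by (metis (no_types, lifting) minus_bop.rep_eq less_imp_le mult_right_mono norm_ge_zero order_trans)
        then show "\<exists>N. \<forall>n\<ge>N. norm (bop_apply (X m) u - bop_apply (X n) u) \<le> e / 2 * norm u" by blast
      qed
      then show "norm (bop_apply (X m - Abs_bop g) u) \<le> e / 2 * norm u" by (simp add: bop_apply_simps G)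
    qed (use e in auto)
    then show "\<exists>no. \<forall>n\<ge>no. norm (X n - Abs_bop g) < e" using e by (metis half_gt_zero_iff field_sum_of_halves less_add_same_cancel1 order_le_less_trans)
  qed
  then show "convergent X" by (auto simp: convergent_def)
qed

section \<open>Square roots and positivity\<close>

lemma norm_one_bop: "norm (1 :: 'h::complex_hilbert bop) \<le> 1"
  by (rule norm_bop_le) (auto simp: bop_apply_simps)

lemma norm_power_bop_le_1:
  fixes x :: "'h::complex_hilbert bop"
  assumes "norm x \<le> 1" shows "norm (x ^ n) \<le> 1"
proof (induction n)
  case (Suc n)
  have "norm (x ^ Suc n) \<le> norm x * norm (x ^ n)" by (simp add: norm_mult_ineq)
  also have "\<dots> \<le> 1" using Suc assms mult_le_one norm_ge_zero by blast
  finally show ?case .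
qed (simp add: norm_one_bop)

section \<open>The binomial series of the square root\<close>

lemma gbinomial_Suc_eq: "a gchoose Suc n = (a gchoose n) * (a - of_nat n) / of_nat (Suc n)"
  for a :: "'a::field_char_0"
  using gbinomial_mult_1[of a n] by (simp add: field_simps del: of_nat_Suc)

text \<open>The binomial series of \<open>sqrt (1 - x)\<close> still converges absolutely on the boundary \<open>\<parallel>x\<parallel> = 1\<close>,
  since all coefficients but the first are nonpositive.\<close>

definition sqrt_coeff :: "nat \<Rightarrow> real" where
  "sqrt_coeff n = (1/2 gchoose n) * (-1) ^ n"

lemma sqrt_coeff_0: "sqrt_coeff 0 = 1" by (simp add: sqrt_coeff_def)

text \<open>Consecutive coefficients have the positive ratio (n - 1/2) / (n + 1) from index 1 on, so
  all of them inherit the sign of the coefficient -1/2.\<close>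

lemma sqrt_coeff_Suc_nonpos: "sqrt_coeff (Suc n) \<le> 0"
proof (induction n)
  case (Suc n)
  have "sqrt_coeff (Suc (Suc n)) = sqrt_coeff (Suc n) * ((Suc n - 1/2) / (Suc n + 1))"
  proof -
    have "g * (1/2 - c) / e * (- s) = (g * s) * ((c - 1/2) / e)" for g c e s :: real
      by (cases "e = 0") (simp_all add: field_simps)
    from this[of "1/2 gchoose Suc n" "Suc n" "Suc n + 1" "(-1) ^ Suc n"] show ?thesis
      unfolding sqrt_coeff_def gbinomial_Suc_eq[of "1/2::real" "Suc n"] by (simp del: of_nat_Suc)
  qed
  also have "\<dots> \<le> 0" using Suc by (intro mult_nonpos_nonneg) auto
  finally show ?case .
qed (simp add: sqrt_coeff_def)

text \<open>An alternating partial sum of binomial coefficients is again a binomial coefficient up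
  to sign, here that of -1/2, and this is a product of the positive factors (j + 1/2) / (j +
  1).\<close>

lemma sqrt_coeff_partial_sum: "(\<Sum>n\<le>m. sqrt_coeff n) \<ge> 0"
proof -
  have "(-1) ^ m * ((1/2 :: real) - 1 gchoose m) \<ge> 0"
  proof (induction m)
    case (Suc m)
    have "(-1) ^ Suc m * ((1/2 :: real) - 1 gchoose Suc m) = (-1) ^ m * ((1/2 :: real) - 1 gchoose m) * ((m + 1/2) / (m + 1))"
      by (simp add: gbinomial_Suc_eq) (simp add: field_simps)
    then show ?case using Suc by (metis divide_nonneg_nonneg mult_nonneg_nonneg of_nat_0_le_iff add_nonneg_nonneg zero_le_divide_1_iff zero_le_numeral zero_le_one)
  qed simp
  then show ?thesis unfolding sqrt_coeff_def by (simp add: gbinomial_sum_lower_neg)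
qed

text \<open>The leading coefficient is 1 and the others are nonpositive, so nonnegativity of the
  partial sums bounds the absolute sum of the others by 1. The exact value 1 matters: it yields
  \<open>norm (1 - s) \<le> 1\<close> for the square root \<open>s\<close>, so that a second root
  can be taken.\<close>

lemma sqrt_coeff_abs_sum: "(\<Sum>n<m. \<bar>sqrt_coeff (Suc n)\<bar>) \<le> 1"
proof -
  have "(\<Sum>n\<le>m. sqrt_coeff n) = 1 - (\<Sum>n<m. \<bar>sqrt_coeff (Suc n)\<bar>)"
    unfolding lessThan_Suc_atMost[symmetric]
    by (subst sum.lessThan_Suc_shift) (use sqrt_coeff_Suc_nonpos in \<open>simp add: sqrt_coeff_0 sum_negf abs_of_nonpos\<close>)
  then show ?thesis using sqrt_coeff_partial_sum[of m] by simp
qed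

lemma summable_sqrt_coeff: "summable (\<lambda>n. \<bar>sqrt_coeff (Suc n)\<bar>)"
  by (rule bounded_imp_summable[of _ 1]) (use sqrt_coeff_abs_sum[of "Suc _"] in \<open>auto simp: lessThan_Suc_atMost\<close>)

text \<open>Vandermonde's identity at 1/2 + 1/2 = 1: the Cauchy square of the series is 1 -
  x.\<close>

lemma sqrt_coeff_convolution:
  "(\<Sum>i\<le>n. sqrt_coeff i * sqrt_coeff (n - i)) = (if n = 0 then 1 else if n = 1 then -1 else 0)"
proof -
  have "(\<Sum>i\<le>n. sqrt_coeff i * sqrt_coeff (n - i)) = (-1) ^ n * (\<Sum>i\<le>n. ((1/2::real) gchoose i) * (1/2 gchoose (n - i)))"
    unfolding sqrt_coeff_def sum_distrib_left
    by (intro sum.cong) (auto simp: field_simps simp flip: power_add)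
  also have "\<dots> = (-1) ^ n * ((1::real) gchoose n)"
    using gbinomial_Vandermonde[of "1/2::real" "1/2" n] by (simp add: atMost_atLeast0)
  also have "(1::real) gchoose n = of_nat (1 choose n)" by (metis binomial_gbinomial of_nat_1)
  finally show ?thesis by (cases n; cases "n - 1") auto
qed

text \<open>The set \<open>C\<close> is any closed real subspace containing the powers of
  \<open>x\<close>. It serves once as a closed polynomial algebra and once as the set of Hermitian
  elements of a von Neumann algebra, which is not closed under products.\<close>

lemma sqrt_one_minus:
  fixes x :: "'h::complex_hilbert bop"
  assumes x: "norm x \<le> 1" and C: "closed C" "subspace C" "\<And>n. x ^ n \<in> C"
  obtains s where "s \<in> C" "s * s = 1 - x" "norm (1 - s) \<le> 1"
proof -
  define f where "f n = sqrt_coeff n *\<^sub>R x ^ n" for n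
  have le: "norm (f n) \<le> \<bar>sqrt_coeff n\<bar>" for n
    using norm_power_bop_le_1[OF x, of n] by (simp add: f_def mult_left_le)
  have sumS: "summable (\<lambda>n. norm (f (Suc n)))"
    by (rule summable_comparison_test'[OF summable_sqrt_coeff]) (use le in auto)
  have sum: "summable (\<lambda>n. norm (f n))" using sumS summable_Suc_iff[of "\<lambda>n. norm (f n)"] by blast
  have sf: "summable f" using sum by (rule summable_norm_cancel)
  define s where "s = suminf f"
  have "(\<Sum>i<n. f i) \<in> C" for n
    unfolding f_def by (intro subspace_sum C subspace_scale)
  then have "s \<in> C"
    using closed_sequentially[OF C(1) _ summable_LIMSEQ[OF sf]] unfolding s_def by blast
  moreover have "norm (1 - s) \<le> 1"
  proof -
    have "1 - s = - (\<Sum>n. f (Suc n))"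
      using suminf_split_head[OF sf] by (simp add: s_def f_def sqrt_coeff_0)
    then have "norm (1 - s) = norm (\<Sum>n. f (Suc n))" by simp
    also have "\<dots> \<le> (\<Sum>n. norm (f (Suc n)))" by (rule summable_norm[OF sumS])
    also have "\<dots> \<le> (\<Sum>n. \<bar>sqrt_coeff (Suc n)\<bar>)"
      by (rule suminf_le[OF _ sumS summable_sqrt_coeff]) (rule le)
    also have "\<dots> \<le> 1" by (rule suminf_le_const[OF summable_sqrt_coeff sqrt_coeff_abs_sum])
    finally show ?thesis .
  qed
  moreover have "s * s = 1 - x"
  proof -
    have "s * s = (\<Sum>k. \<Sum>i\<le>k. f i * f (k - i))"
      unfolding s_def by (rule Cauchy_product[OF sum sum])
    also have "(\<lambda>k. \<Sum>i\<le>k. f i * f (k - i)) = (\<lambda>k. if k = 0 then 1 else if k = 1 then - x else 0)"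
    proof
      fix k
      have "(\<Sum>i\<le>k. f i * f (k - i)) = (\<Sum>i\<le>k. (sqrt_coeff i * sqrt_coeff (k - i)) *\<^sub>R x ^ k)"
        unfolding f_def by (intro sum.cong) (auto simp flip: power_add)
      also have "\<dots> = (if k = 0 then 1 else if k = 1 then -1 else 0) *\<^sub>R x ^ k"
        unfolding scaleR_left.sum[symmetric] sqrt_coeff_convolution ..
      finally show "(\<Sum>i\<le>k. f i * f (k - i)) = (if k = 0 then 1 else if k = 1 then - x else 0)" by auto
    qed
    also have "(\<Sum>k. if k = 0 then 1 else if k = 1 then - x else 0) = (\<Sum>k\<in>{0,1::nat}. if k = 0 then 1 else if k = 1 then - x else (0::'h bop))"
      by (rule suminf_finite) auto
    finally show ?thesis by simp
  qed
  ultimately show ?thesis using that by blast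
qed

section \<open>Quadratic forms and absolute values\<close>

text \<open>Polarisation and the parallelogram law bound \<open>inner (bop_apply x u) v\<close>. The
  vector \<open>v\<close> is taken in the direction of \<open>bop_apply x u\<close> with the length
  of \<open>u\<close>, which balances the two squares on the right.\<close>

lemma norm_le_quadratic_form:
  fixes x :: "'h::complex_hilbert bop"
  assumes h: "hermitian x" and B: "0 \<le> B" "\<And>u. \<bar>inner (bop_apply x u) u\<bar> \<le> B * (norm u)\<^sup>2"
  shows "norm x \<le> B"
proof (rule norm_bop_le[OF B(1)])
  fix u
  interpret x: bounded_linear "bop_apply x" by (rule bop_bounded_linear)
  have sym: "inner (bop_apply x v) w = inner (bop_apply x w) v" for v w
    using h by (metis hermitian_def inner_adj inner_commute)
  have pol: "4 * inner (bop_apply x u) v \<le> 2 * B * ((norm u)\<^sup>2 + (norm v)\<^sup>2)" for v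
  proof -
    have "4 * inner (bop_apply x u) v = inner (bop_apply x (u + v)) (u + v) - inner (bop_apply x (u - v)) (u - v)"
      by (simp add: x.add x.diff inner_add_left inner_add_right inner_diff_left inner_diff_right sym[of v u])
    also have "\<dots> \<le> B * (norm (u + v))\<^sup>2 + B * (norm (u - v))\<^sup>2"
      using B(2)[of "u + v"] B(2)[of "u - v"] by linarith
    also have "\<dots> = 2 * B * ((norm u)\<^sup>2 + (norm v)\<^sup>2)"
      by (simp add: power2_norm_eq_inner inner_add_left inner_add_right inner_diff_left inner_diff_right inner_commute algebra_simps)
    finally show ?thesis .
  qed
  show "norm (bop_apply x u) \<le> B * norm u"
  proof (cases "bop_apply x u = 0 \<or> u = 0")
    case False
    then have p: "norm (bop_apply x u) > 0" "norm u > 0" by auto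
    have "4 * (norm u * norm (bop_apply x u)) \<le> 2 * B * (2 * (norm u)\<^sup>2)"
      using pol[of "(norm u / norm (bop_apply x u)) *\<^sub>R bop_apply x u"] p
      by (simp add: power_mult_distrib power_divide flip: power2_norm_eq_inner) (simp add: power2_eq_square)
    then show ?thesis using p by (simp add: power2_eq_square)
  qed (use B in \<open>auto simp: x.zero\<close>)
qed

text \<open>Here \<open>m\<close> plays the role of the absolute value of \<open>b\<close>, and
  \<open>s\<close> certifies that \<open>m\<close> is positive. Both are roots of the form sqrt (1 -
  x): first with x = 1 - b^2, a contraction because \<open>b\<close> is one, then with x = 1 - m, a
  contraction by the extra conclusion of the first root.\<close>

lemma hermitian_abs:
  fixes b :: "'h::complex_hilbert bop"
  assumes b: "hermitian b" "norm b \<le> 1"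
    and C: "closed C" "subspace C" "1 \<in> C" "\<And>x y. x \<in> C \<Longrightarrow> y \<in> C \<Longrightarrow> x * y \<in> C" and bC: "b \<in> C"
  obtains m s where "m \<in> C" "s \<in> C" "m * m = b * b" "s * s = m"
proof -
  have pw: "x ^ n \<in> C" if "x \<in> C" for x n using that by (induction n) (auto intro: C)
  have "norm (1 - b * b) \<le> 1"
  proof (rule norm_le_quadratic_form)
    show "hermitian (1 - b * b)" using b by (simp add: hermitian_def)
    fix u
    have e: "inner (bop_apply (1 - b * b) u) u = (norm u)\<^sup>2 - (norm (bop_apply b u))\<^sup>2"
      using inner_adj[of b "bop_apply b u" u] b(1)
      by (simp add: bop_apply_simps inner_diff_left power2_norm_eq_inner hermitian_def)
    have "norm (bop_apply b u) \<le> 1 * norm u"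
      using norm_bop_apply[of b u] b(2) by (meson mult_right_mono norm_ge_zero order_trans)
    then have "(norm (bop_apply b u))\<^sup>2 \<le> (norm u)\<^sup>2" by (simp add: power_mono)
    then show "\<bar>inner (bop_apply (1 - b * b) u) u\<bar> \<le> 1 * (norm u)\<^sup>2" unfolding e by simp
  qed simp
  then obtain m where m: "m \<in> C" "m * m = 1 - (1 - b * b)" "norm (1 - m) \<le> 1"
    using sqrt_one_minus[OF _ C(1,2)] pw subspace_diff[OF C(2) C(3) C(4)[OF bC bC]] by metis
  obtain s where s: "s \<in> C" "s * s = 1 - (1 - m)"
    using sqrt_one_minus[OF m(3) C(1,2)] pw subspace_diff[OF C(2) C(3) m(1)] by metis
  show ?thesis using that m s by simp
qed

text \<open>If \<open>\<phi>\<close> is a faithful positive functional, \<open>\<phi> (d b d) \<ge> 0\<close> for \<open>d = \<bar>b\<bar> - b\<close> kills the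
  negative part, because \<open>d b d = - \<bar>b\<bar> d\<^sup>2\<close>.\<close>

lemma nonneg_if_weighted_nonneg:
  fixes b :: "'h::complex_hilbert bop" and \<phi> :: "'h bop \<Rightarrow> real"
  assumes C: "closed C" "subspace C" "1 \<in> C" "\<And>x y. x \<in> C \<Longrightarrow> y \<in> C \<Longrightarrow> x * y \<in> C"
    and comm: "\<And>x y. x \<in> C \<Longrightarrow> y \<in> C \<Longrightarrow> x * y = y * x"
    and herm: "\<And>x. x \<in> C \<Longrightarrow> hermitian x" and bC: "b \<in> C"
    and \<phi>_minus: "\<And>x. x \<in> C \<Longrightarrow> \<phi> (- x) = - \<phi> x"
    and \<phi>_scale: "\<And>r x. x \<in> C \<Longrightarrow> \<phi> (r *\<^sub>R x) = r * \<phi> x"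
    and pos: "\<And>x. x \<in> C \<Longrightarrow> \<phi> (x * x) \<ge> 0"
    and faithful: "\<And>x. x \<in> C \<Longrightarrow> \<phi> (x * x) = 0 \<Longrightarrow> x = 0"
    and b: "\<And>y. y \<in> C \<Longrightarrow> \<phi> (y * b * y) \<ge> 0"
  shows "inner (bop_apply b h) h \<ge> 0"
proof -
  \<comment> \<open>Rescaling makes the norm at most 1, as the absolute value requires; the added 1
    covers the case \<open>b = 0\<close>.\<close>
  define r where "r = 1 / (norm b + 1)"
  have r: "r > 0" unfolding r_def by (simp add: add_nonneg_pos)
  define c where "c = r *\<^sub>R b"
  have cC: "c \<in> C" unfolding c_def by (intro subspace_scale C bC)
  have "norm c \<le> 1" unfolding c_def r_def by (simp add: divide_le_eq not_less)
  then obtain m s where m: "m \<in> C" "s \<in> C" "m * m = c * c" "s * s = m"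
    using hermitian_abs[OF herm[OF cC] _ C cC] by blast
  define d where "d = m - c"
  have dC: "d \<in> C" unfolding d_def by (intro subspace_diff C m cC)
  have mc: "m * c = c * m" by (intro comm m cC)
  \<comment> \<open>Because m^2 = c^2, the square of \<open>d\<close> is 2 m d. So it suffices to
    show \<open>m * d = 0\<close>: then \<open>d * d = 0\<close>, faithfulness gives
    \<open>d = 0\<close>, and \<open>c = m\<close> is the square of \<open>s\<close>.\<close>
  have dd: "d * d = 2 *\<^sub>R (m * d)"
    unfolding d_def scaleR_2 by (simp add: algebra_simps m(3) mc)
  have "d * c * d = - (m * d * d)"
    unfolding d_def by (simp add: algebra_simps m(3) mc)
  also have "m * d * d = (s * d) * (s * d)"
    unfolding m(4)[symmetric] by (metis comm dC m(2) mult.assoc)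
  finally have e: "d * c * d = - ((s * d) * (s * d))" .
  have sd: "s * d \<in> C" by (intro C m dC)
  have "\<phi> (d * c * d) = r * \<phi> (d * b * d)"
    unfolding c_def using \<phi>_scale[of "d * b * d"] C(4) dC bC by simp
  then have "\<phi> (d * c * d) \<ge> 0" using b[OF dC] r by simp
  then have "\<phi> ((s * d) * (s * d)) \<le> 0"
    unfolding e using \<phi>_minus[of "(s * d) * (s * d)"] C(4) sd by simp
  then have "s * d = 0" using pos[OF sd] faithful[OF sd] by linarith
  then have "m * d = 0" unfolding m(4)[symmetric] by (simp add: mult.assoc)
  then have "d * d = 0" using dd by simp
  moreover have "\<phi> 0 = 0" using \<phi>_scale[OF C(3), of 0] by simp
  ultimately have "d = 0" using faithful[OF dC] by simp
  then have c: "c = s * s" using m by (simp add: d_def)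
  have "r * inner (bop_apply b h) h = inner (bop_apply c h) h" by (simp add: c_def bop_apply_simps)
  also have "\<dots> = inner (bop_apply s h) (bop_apply s h)"
    using herm[OF m(2)] by (simp add: c bop_apply_simps inner_adj[of s "bop_apply s h"] hermitian_def)
  finally show ?thesis using r by (metis inner_ge_zero zero_le_mult_iff not_less)
qed

section \<open>The closed algebra generated by a Hermitian operator\<close>

lemma subspace_closure_subspace:
  fixes S :: "'a::real_normed_vector set"
  assumes "subspace S" shows "subspace (closure S)"
proof (rule subspaceI)
  show "0 \<in> closure S" using subspace_0[OF assms] closure_subset by blast
  show "x + y \<in> closure S" if xy: "x \<in> closure S" "y \<in> closure S" for x y
  proof -
    obtain f g where "\<And>n. f n \<in> S" "f \<longlonglongrightarrow> x" "\<And>n. g n \<in> S" "g \<longlonglongrightarrow> y"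
      using xy unfolding closure_sequential by metis
    then have "(\<forall>n. f n + g n \<in> S) \<and> (\<lambda>n. f n + g n) \<longlonglongrightarrow> x + y"
      by (simp add: tendsto_add subspace_add assms)
    then show ?thesis unfolding closure_sequential by (intro exI[of _ "\<lambda>n. f n + g n"])
  qed
  show "c *\<^sub>R x \<in> closure S" if x: "x \<in> closure S" for c x
  proof -
    obtain f where "\<And>n. f n \<in> S" "f \<longlonglongrightarrow> x" using x unfolding closure_sequential by metis
    then have "(\<forall>n. c *\<^sub>R f n \<in> S) \<and> (\<lambda>n. c *\<^sub>R f n) \<longlonglongrightarrow> c *\<^sub>R x"
      by (simp add: tendsto_scaleR subspace_scale assms)
    then show ?thesis unfolding closure_sequential by (intro exI[of _ "\<lambda>n. c *\<^sub>R f n"])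
  qed
qed

text \<open>A substitute for the continuous functional calculus of \<open>b\<close>. The span is
  over the reals, which keeps every element Hermitian; products, commutation and Hermiticity then
  pass to norm limits.\<close>

lemma polynomial_closure:
  fixes b :: "'h::complex_hilbert bop"
  assumes b: "hermitian b"
  defines "C \<equiv> closure (span (range (\<lambda>n. b ^ n)))"
  shows "closed C" "subspace C" "1 \<in> C" "b \<in> C"
    and "\<And>x y. x \<in> C \<Longrightarrow> y \<in> C \<Longrightarrow> x * y \<in> C"
    and "\<And>x y. x \<in> C \<Longrightarrow> y \<in> C \<Longrightarrow> x * y = y * x"
    and "\<And>x. x \<in> C \<Longrightarrow> hermitian x"
proof -
  let ?S = "span (range (\<lambda>n. b ^ n))"
  have S: "b ^ n \<in> ?S" for n by (intro span_base) auto
  show "closed C" "subspace C" unfolding C_def by (auto intro: subspace_closure_subspace)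
  show "1 \<in> C" "b \<in> C" unfolding C_def using S[of 0] S[of 1] closure_subset by auto
  have m1: "b ^ n * y \<in> ?S" if "y \<in> ?S" for n y
    using that by (induction rule: span_induct_alt)
      (auto simp: distrib_left simp flip: power_add intro!: span_add span_scale S span_zero)
  have m2: "x * y \<in> ?S" if "x \<in> ?S" "y \<in> ?S" for x y
    using that by (induction rule: span_induct_alt)
      (auto simp: distrib_right m1 intro!: span_add span_scale span_zero)
  have c1: "b ^ n * y = y * b ^ n" if "y \<in> ?S" for n y
    using that by (induction rule: span_induct_alt)
      (auto simp: distrib_left distrib_right add.commute simp flip: power_add)
  have c2: "x * y = y * x" if "x \<in> ?S" "y \<in> ?S" for x y
    using that by (induction rule: span_induct_alt)
      (auto simp: distrib_left distrib_right c1)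
  have h: "hermitian x" if "x \<in> ?S" for x
    using that b unfolding hermitian_def by (induction rule: span_induct_alt) auto
  have seq: "\<exists>f. (\<forall>n. f n \<in> ?S) \<and> f \<longlonglongrightarrow> x" if "x \<in> C" for x
    using that unfolding C_def closure_sequential .
  show "x * y \<in> C" "x * y = y * x" if xy: "x \<in> C" "y \<in> C" for x y
  proof -
    obtain f g where f: "\<And>n. f n \<in> ?S" "f \<longlonglongrightarrow> x" and g: "\<And>n. g n \<in> ?S" "g \<longlonglongrightarrow> y"
      using seq[OF xy(1)] seq[OF xy(2)] by blast
    have l: "(\<lambda>n. f n * g n) \<longlonglongrightarrow> x * y" "(\<lambda>n. g n * f n) \<longlonglongrightarrow> y * x"
      by (intro tendsto_intros f g)+
    show "x * y \<in> C" unfolding C_def closure_sequential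
      by (rule exI[of _ "\<lambda>n. f n * g n"]) (use l(1) m2 f(1) g(1) in simp)
    have "(\<lambda>n. g n * f n) = (\<lambda>n. f n * g n)" using c2[OF f(1) g(1)] by auto
    then show "x * y = y * x" using l LIMSEQ_unique by metis
  qed
  show "hermitian x" if "x \<in> C" for x
    using closure_minimal[OF _ closed_hermitian] h that unfolding C_def by blast
qed

section \<open>Tracial von Neumann algebras\<close>

locale tracial_vN_algebra =
  fixes A :: "'h::complex_hilbert bop set" and \<tau> :: "'h bop \<Rightarrow> complex"
  assumes vN: "von_neumann_algebra A" and trace: "faithful_normal_tracial_state A \<tau>"
begin

lemma A_eq: "A = commutant (commutant A)" using vN by (simp add: von_neumann_algebra_def)

lemma A_adj [simp, intro]: "x \<in> A \<Longrightarrow> adj x \<in> A" using vN by (simp add: von_neumann_algebra_def)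
lemma A_one [simp, intro]: "1 \<in> A" by (subst A_eq) (simp add: commutant_def)
lemma A_add [simp, intro]: "x \<in> A \<Longrightarrow> y \<in> A \<Longrightarrow> x + y \<in> A"
  by (subst (asm) (1 2) A_eq, subst A_eq) (simp add: commutant_def distrib_left distrib_right)
lemma A_mult [simp, intro]: "x \<in> A \<Longrightarrow> y \<in> A \<Longrightarrow> x * y \<in> A"
  by (subst (asm) (1 2) A_eq, subst A_eq) (simp add: commutant_def, metis mult.assoc)
lemma A_scaleC [simp, intro]: "x \<in> A \<Longrightarrow> c *\<^sub>C x \<in> A"
  by (subst (asm) A_eq, subst A_eq) (simp add: commutant_def scaleC_mult_left scaleC_mult_right)
lemma A_scaleR [simp, intro]: "x \<in> A \<Longrightarrow> r *\<^sub>R x \<in> A"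
  using A_scaleC[of x "complex_of_real r"] by (simp add: scaleC_of_real)
lemma A_minus [simp, intro]: "x \<in> A \<Longrightarrow> - x \<in> A" using A_scaleR[of x "-1"] by simp
lemma A_diff [simp, intro]: "x \<in> A \<Longrightarrow> y \<in> A \<Longrightarrow> x - y \<in> A" using A_add[of x "- y"] by auto
lemma A_zero [simp, intro]: "0 \<in> A" using A_scaleR[OF A_one, of 0] by simp
lemma A_power [simp, intro]: "x \<in> A \<Longrightarrow> x ^ n \<in> A" by (induction n) auto
lemma subspace_A: "subspace A" by (rule subspaceI) auto
lemma closed_A: "closed A"
proof -
  have "A = (\<Inter>x\<in>commutant A. {y. x * y = y * x})" by (subst A_eq) (auto simp: commutant_def)
  also have "closed \<dots>" by (intro closed_INT ballI closed_Collect_eq continuous_intros)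
  finally show ?thesis .
qed

lemma tau_add: "x \<in> A \<Longrightarrow> y \<in> A \<Longrightarrow> \<tau> (x + y) = \<tau> x + \<tau> y"
  and tau_scaleC: "x \<in> A \<Longrightarrow> \<tau> (c *\<^sub>C x) = c * \<tau> x"
  and tau_one: "\<tau> 1 = 1"
  and tau_pos: "x \<in> A \<Longrightarrow> \<tau> (adj x * x) \<in> \<real>\<^sub>\<ge>\<^sub>0"
  and tau_faithful: "x \<in> A \<Longrightarrow> \<tau> (adj x * x) = 0 \<Longrightarrow> x = 0"
  using trace unfolding faithful_normal_tracial_state_def by auto

lemma tau_scaleR: "x \<in> A \<Longrightarrow> \<tau> (r *\<^sub>R x) = complex_of_real r * \<tau> x"
  using tau_scaleC[of x "complex_of_real r"] by (simp add: scaleC_of_real)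
lemma tau_minus: "x \<in> A \<Longrightarrow> \<tau> (- x) = - \<tau> x" using tau_scaleR[of x "-1"] by simp
lemma tau_diff: "x \<in> A \<Longrightarrow> y \<in> A \<Longrightarrow> \<tau> (x - y) = \<tau> x - \<tau> y"
  using tau_add[of x "- y"] tau_minus[of y] by auto
lemma tau_zero: "\<tau> 0 = 0" using tau_scaleR[OF A_one, of 0] by simp

text \<open>Positivity of the trace is assumed only on products \<open>adj x * x\<close>, so a
  nonnegative quadratic form has to be turned into a square. After rescaling, \<open>1 - c\<close>
  is a contraction, and its series stays among the Hermitian elements of \<open>A\<close>.\<close>

lemma nonneg_hermitian_is_square:
  assumes x: "x \<in> A" "hermitian x" and pos: "\<And>h. inner (bop_apply x h) h \<ge> 0"
  obtains s where "s \<in> A" "hermitian s" "x = s * s"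
proof -
  define r where "r = 1 / (norm x + 1)"
  have r: "r > 0" unfolding r_def by (simp add: add_nonneg_pos)
  define c where "c = r *\<^sub>R x"
  have nc: "norm c \<le> 1" unfolding c_def r_def by (simp add: divide_le_eq not_less)
  have hc: "hermitian (1 - c)" using x by (simp add: hermitian_def c_def)
  have "norm (1 - c) \<le> 1"
  proof (rule norm_le_quadratic_form[OF hc])
    fix u
    have "inner (bop_apply c u) u \<le> norm (bop_apply c u) * norm u" by (rule norm_cauchy_schwarz)
    also have "\<dots> \<le> (1 * norm u) * norm u"
      by (intro mult_right_mono order_trans[OF norm_bop_apply] nc norm_ge_zero)
    finally have "inner (bop_apply c u) u \<le> (norm u)\<^sup>2" by (simp add: power2_eq_square)
    moreover have "inner (bop_apply c u) u \<ge> 0" using pos[of u] r by (simp add: c_def bop_apply_simps)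
    ultimately show "\<bar>inner (bop_apply (1 - c) u) u\<bar> \<le> 1 * (norm u)\<^sup>2"
      by (simp add: bop_apply_simps inner_diff_left power2_norm_eq_inner)
  qed simp
  then obtain s where s: "s \<in> A \<inter> {x. hermitian x}" "s * s = 1 - (1 - c)"
  proof (rule sqrt_one_minus)
    show "closed (A \<inter> {x. hermitian x})" by (intro closed_Int closed_A closed_hermitian)
    show "subspace (A \<inter> {x. hermitian x})"
      by (rule subspaceI) (auto simp: hermitian_def)
    show "(1 - c) ^ n \<in> A \<inter> {x. hermitian x}" for n
      using hc x by (auto simp: hermitian_def c_def)
  qed blast
  have "x = (sqrt (1 / r) *\<^sub>R s) * (sqrt (1 / r) *\<^sub>R s)" using s r by (simp add: c_def flip: mult.assoc)
  then show ?thesis using that[of "sqrt (1 / r) *\<^sub>R s"] s by (auto simp: hermitian_def)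
qed

lemma tau_sandwich_nonneg:
  assumes x: "x \<in> A" "hermitian x" "\<And>h. inner (bop_apply x h) h \<ge> 0" and y: "y \<in> A"
  shows "\<tau> (adj y * x * y) \<in> \<real>\<^sub>\<ge>\<^sub>0"
proof -
  obtain s where s: "s \<in> A" "hermitian s" "x = s * s" using nonneg_hermitian_is_square x by blast
  then have "adj y * x * y = adj (s * y) * (s * y)" by (simp add: hermitian_def mult.assoc)
  then show ?thesis using tau_pos[of "s * y"] s y by auto
qed

text \<open>Both \<open>norm x *\<^sub>R 1 - x\<close> and \<open>norm x *\<^sub>R 1 + x\<close>
  have nonnegative forms and hence nonnegative traces. The second claim is the norm continuity of
  the trace on Hermitian elements.\<close>

lemma tau_hermitian:
  assumes x: "x \<in> A" "hermitian x"
  shows "\<tau> x \<in> \<real>" "\<bar>Re (\<tau> x)\<bar> \<le> norm x"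
proof -
  have *: "\<tau> (norm x *\<^sub>R 1 - y) \<in> \<real>\<^sub>\<ge>\<^sub>0" if y: "y \<in> A" "hermitian y" "norm y = norm x" for y
  proof -
    have "inner (bop_apply (norm x *\<^sub>R 1 - y) h) h \<ge> 0" for h
    proof -
      have "inner (bop_apply y h) h \<le> norm (bop_apply y h) * norm h" by (rule norm_cauchy_schwarz)
      also have "\<dots> \<le> (norm x * norm h) * norm h"
        using norm_bop_apply[of y h] y by (intro mult_right_mono) auto
      finally show ?thesis
        by (simp add: bop_apply_simps inner_diff_left power2_eq_square mult.assoc flip: power2_norm_eq_inner)
    qed
    moreover have "hermitian (norm x *\<^sub>R 1 - y)" using y by (simp add: hermitian_def)
    ultimately show ?thesis using tau_sandwich_nonneg[of "norm x *\<^sub>R 1 - y" 1] y by auto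
  qed
  have 1: "norm x - \<tau> x \<in> \<real>\<^sub>\<ge>\<^sub>0" using *[of x] x by (simp add: tau_diff tau_scaleR tau_one A_one A_scaleR)
  have 2: "norm x + \<tau> x \<in> \<real>\<^sub>\<ge>\<^sub>0"
    using *[of "- x"] x by (simp add: tau_add tau_scaleR tau_one A_one A_scaleR hermitian_def)
  show "\<tau> x \<in> \<real>" using 1 by (auto simp: complex_nonneg_Reals_iff complex_is_Real_iff)
  show "\<bar>Re (\<tau> x)\<bar> \<le> norm x" using 1 2 by (auto simp: complex_nonneg_Reals_iff)
qed

lemma tau_adj:
  assumes x: "x \<in> A" shows "\<tau> (adj x) = cnj (\<tau> x)"
proof -
  define u where "u = x + adj x"
  define v where "v = \<i> *\<^sub>C (x - adj x)"
  have uv: "u \<in> A" "hermitian u" "v \<in> A" "hermitian v"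
    using x by (auto simp: u_def v_def hermitian_def add.commute scaleC_diff_right scaleC_minus_left)
  have "\<tau> u \<in> \<real>" "\<tau> v \<in> \<real>" using tau_hermitian uv by blast+
  then have "\<tau> x + \<tau> (adj x) \<in> \<real>" "\<i> * (\<tau> x - \<tau> (adj x)) \<in> \<real>"
    using x unfolding u_def v_def by (auto simp: tau_add tau_scaleC tau_diff A_adj A_diff)
  then show ?thesis by (auto simp: complex_is_Real_iff complex_eq_iff)
qed

section \<open>The trace inner product\<close>

definition norm2_sq :: "'h bop \<Rightarrow> real" where "norm2_sq x = Re (\<tau> (adj x * x))"

lemma norm2_sq_nonneg: "x \<in> A \<Longrightarrow> norm2_sq x \<ge> 0"
  using tau_pos[of x] by (simp add: norm2_sq_def complex_nonneg_Reals_iff)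

lemma tau_Re_commute: "x \<in> A \<Longrightarrow> y \<in> A \<Longrightarrow> Re (\<tau> (adj x * y)) = Re (\<tau> (adj y * x))"
  using tau_adj[of "adj x * y"] by (simp add: A_adj A_mult)

lemma tau_Cauchy_Schwarz:
  assumes x: "x \<in> A" and y: "y \<in> A"
  shows "Re (\<tau> (adj x * y)) \<le> sqrt (norm2_sq x) * sqrt (norm2_sq y)"
proof -
  define c where "c = Re (\<tau> (adj x * y))"
  have q: "norm2_sq x - 2 * r * c + r\<^sup>2 * norm2_sq y \<ge> 0" for r
  proof -
    have "adj (x - r *\<^sub>R y) * (x - r *\<^sub>R y) = adj x * x - r *\<^sub>R (adj x * y) - r *\<^sub>R (adj y * x) + r\<^sup>2 *\<^sub>R (adj y * y)"
      by (simp add: algebra_simps power2_eq_square)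
    then have "norm2_sq (x - r *\<^sub>R y) = norm2_sq x - r * c - r * c + r\<^sup>2 * norm2_sq y"
      unfolding norm2_sq_def c_def using x y tau_Re_commute[OF y x]
      by (simp add: tau_add tau_diff tau_scaleR A_adj A_mult A_diff A_scaleR)
    then show ?thesis using norm2_sq_nonneg[of "x - r *\<^sub>R y"] x y by (simp add: algebra_simps)
  qed
  have "c\<^sup>2 \<le> norm2_sq x * norm2_sq y"
  proof (cases "norm2_sq y = 0")
    case True
    have "c = 0"
    proof (rule ccontr)
      assume "c \<noteq> 0"
      \<comment> \<open>The quadratic term vanishes, and this value of \<open>r\<close> turns the
        left side into -1.\<close>
      then show False using q[of "(norm2_sq x + 1) / (2 * c)"] True by simp
    qed
    then show ?thesis using True by simp
  next
    case False
    then have "norm2_sq y > 0" using norm2_sq_nonneg[OF y] by simp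
    then show ?thesis using q[of "c / norm2_sq y"] by (simp add: field_simps power2_eq_square)
  qed
  then have "\<bar>c\<bar> \<le> sqrt (norm2_sq x * norm2_sq y)" by (metis real_sqrt_abs real_sqrt_le_mono)
  then show ?thesis by (simp add: c_def real_sqrt_mult)
qed

text \<open>The bridge from traces to operators. Only polynomials in \<open>b\<close> have to be
  tested, since their closure contains the vector used to detect a negative part and the tested
  expression is continuous there.\<close>

lemma nonneg_if_trace_nonneg:
  assumes b: "b \<in> A" "hermitian b"
    and pos: "\<And>y. y \<in> span (range (\<lambda>n. b ^ n)) \<Longrightarrow> Re (\<tau> (adj y * b * y)) \<ge> 0"
  shows "inner (bop_apply b h) h \<ge> 0"
proof -
  define C where "C = closure (span (range (\<lambda>n. b ^ n)))"
  note pc = polynomial_closure[OF b(2), folded C_def]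
  have CA: "C \<subseteq> A" unfolding C_def
    by (intro closure_minimal span_minimal closed_A subspace_A) (use b in auto)
  show ?thesis
  proof (rule nonneg_if_weighted_nonneg[where \<phi> = "\<lambda>x. Re (\<tau> x)", OF pc(1,2,3,5,6,7,4)])
    fix x r assume x: "x \<in> C"
    then have xA: "x \<in> A" and xh: "adj x = x" using CA pc(7) by (auto simp: hermitian_def)
    show "Re (\<tau> (- x)) = - Re (\<tau> x)" "Re (\<tau> (r *\<^sub>R x)) = r * Re (\<tau> x)"
      using xA by (simp_all add: tau_minus tau_scaleR)
    show "Re (\<tau> (x * x)) \<ge> 0" using norm2_sq_nonneg[OF xA] by (simp add: norm2_sq_def xh)
    show "x = 0" if "Re (\<tau> (x * x)) = 0"
      using tau_faithful[OF xA] tau_pos[OF xA] that by (simp add: xh complex_nonneg_Reals_iff complex_eq_iff)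
    show "Re (\<tau> (x * b * x)) \<ge> 0"
    proof -
      obtain f where f: "\<And>n. f n \<in> span (range (\<lambda>n. b ^ n))" "f \<longlonglongrightarrow> x"
        using x unfolding C_def closure_sequential by blast
      have fC: "f n \<in> C" for n using f(1) closure_subset unfolding C_def by blast
      have fh: "adj (f n) = f n" for n using pc(7)[OF fC] by (simp add: hermitian_def)
      have "\<bar>Re (\<tau> (f n * b * f n)) - Re (\<tau> (x * b * x))\<bar> \<le> norm (f n * b * f n - x * b * x)" for n
      proof -
        \<comment> \<open>Membership in \<open>C\<close> makes the difference Hermitian, so that the
          trace is controlled by its norm.\<close>
        have "f n * b * f n - x * b * x \<in> C" by (intro subspace_diff pc fC x)
        moreover have "f n * b * f n \<in> A" "x * b * x \<in> A" using CA fC x b by auto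
        ultimately show ?thesis
          using tau_hermitian(2)[of "f n * b * f n - x * b * x"] pc(7)[of "f n * b * f n - x * b * x"]
            tau_diff[of "f n * b * f n" "x * b * x"] A_diff[of "f n * b * f n" "x * b * x"] by simp
      qed
      then have le: "\<forall>\<^sub>F n in sequentially. norm (Re (\<tau> (f n * b * f n)) - Re (\<tau> (x * b * x))) \<le> norm (f n * b * f n - x * b * x)"
        by simp
      have "(\<lambda>n. norm (f n * b * f n - x * b * x)) \<longlonglongrightarrow> norm (x * b * x - x * b * x)"
        by (intro tendsto_intros f)
      then have "(\<lambda>n. Re (\<tau> (f n * b * f n)) - Re (\<tau> (x * b * x))) \<longlonglongrightarrow> 0"
        unfolding diff_self norm_zero by (rule Lim_null_comparison[OF le])
      then have "(\<lambda>n. Re (\<tau> (f n * b * f n))) \<longlonglongrightarrow> Re (\<tau> (x * b * x))" by (simp add: LIM_zero_iff)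
      then show ?thesis
        by (rule LIMSEQ_le_const) (metis pos[OF f(1)] fh)
    qed
  qed
qed

lemma star_algebra_gen_subset:
  assumes "S \<subseteq> A" "x \<in> star_algebra_gen S" shows "x \<in> A"
  using assms(2) by induction (use assms(1) in auto)

end

text \<open>\<open>E\<close> and \<open>Z\<close> are the squared norms of the two components of a
  vector, and \<open>Q\<close> is the value of the form. The concavity argument is carried out by
  mixing the two bounds on \<open>Q\<close>, without calculus.\<close>

lemma compression_bound_concave:
  fixes E Z t L \<sigma> Q :: real
  assumes E: "0 \<le> E" and Z: "0 \<le> Z" and t: "0 \<le> t" "t \<le> 1" and \<sigma>: "0 \<le> \<sigma>"
    and ET: "E \<le> t * (E + Z)" and Q1: "Q \<le> L * E + 2 * \<sigma> * sqrt E * sqrt Z" and Q2: "Q \<le> L * (E + Z)"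
  shows "Q \<le> (t * L + 2 * \<sigma> * sqrt (t * (1 - t))) * (E + Z)"
proof (cases "Z = 0")
  case True
  then have "E = 0 \<or> t = 1" using ET t E by (cases "E = 0") auto
  then show ?thesis using True Q2 by auto
next
  case False
  define X where "X = E + Z"
  have X: "X > 0" using False Z E by (simp add: X_def)
  \<comment> \<open>The weight for which mixing the ratio E / (E + Z) with 1 gives exactly
    \<open>t\<close>. The assumption \<open>ET\<close> says precisely that
    \<open>l \<le> 1\<close>.\<close>
  define l where "l = (1 - t) * X / Z"
  have "Z > 0" using False Z by simp
  moreover have "(1 - t) * X \<le> Z" using ET by (simp add: X_def algebra_simps)
  ultimately have l: "0 \<le> l" "l \<le> 1" unfolding l_def using t X by simp_all
  have lZ: "l * Z = (1 - t) * X" using False by (simp add: l_def)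
  \<comment> \<open>Of the two factors, \<open>l * Z\<close> is known exactly, while
    \<open>l * E\<close> is at most \<open>E\<close> and hence at most \<open>t * X\<close>.\<close>
  have "l\<^sup>2 * (E * Z) = (l * E) * (l * Z)" by (simp add: power2_eq_square)
  also have "\<dots> \<le> (t * X) * ((1 - t) * X)"
    unfolding lZ using l E t X ET mult_right_mono[of l 1 E]
    by (intro mult_right_mono) (auto simp: X_def)
  finally have "sqrt (l\<^sup>2 * (E * Z)) \<le> sqrt ((t * (1 - t)) * X\<^sup>2)"
    by (intro real_sqrt_le_mono) (simp add: power2_eq_square mult_ac)
  then have s: "l * (sqrt E * sqrt Z) \<le> sqrt (t * (1 - t)) * X"
    using l X by (simp add: real_sqrt_mult)
  have "Q = l * Q + (1 - l) * Q" by (simp add: algebra_simps)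
  also have "\<dots> \<le> l * (L * E + 2 * \<sigma> * sqrt E * sqrt Z) + (1 - l) * (L * X)"
    using l Q1 Q2 by (intro add_mono mult_left_mono) (auto simp: X_def)
  also have "\<dots> = L * (X - l * Z) + 2 * \<sigma> * (l * (sqrt E * sqrt Z))"
    by (simp add: X_def algebra_simps)
  also have "X - l * Z = t * X" unfolding lZ by (simp add: algebra_simps)
  also have "L * (t * X) + 2 * \<sigma> * (l * (sqrt E * sqrt Z)) \<le> L * (t * X) + 2 * \<sigma> * (sqrt (t * (1 - t)) * X)"
    using s \<sigma> by (intro add_left_mono mult_left_mono) auto
  finally show ?thesis by (simp add: X_def algebra_simps)
qed

section \<open>Compression by a free projection\<close>

locale free_projection = tracial_vN_algebra A \<tau>
  for A :: "'h::complex_hilbert bop set" and \<tau> :: "'h bop \<Rightarrow> complex" +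
  fixes p :: "'h bop" and M :: "'h bop set" and t :: real
  assumes p: "p \<in> A" "is_projection p" "\<tau> p = complex_of_real t" and MA: "M \<subseteq> A" and t: "0 \<le> t" "t \<le> 1"
    and free: "free_from \<tau> p M"
begin

definition B :: "bool \<Rightarrow> 'h bop set" where "B b = star_algebra_gen (if b then {p} else M)"

lemma B_A [simp, intro]: "x \<in> B b \<Longrightarrow> x \<in> A"
  unfolding B_def using star_algebra_gen_subset[of "if b then {p} else M" x] p MA by (auto split: if_splits)
lemma B_intros [simp, intro]:
  "1 \<in> B b" "x \<in> B b \<Longrightarrow> y \<in> B b \<Longrightarrow> x + y \<in> B b" "x \<in> B b \<Longrightarrow> y \<in> B b \<Longrightarrow> x * y \<in> B b"
  "x \<in> B b \<Longrightarrow> c *\<^sub>C x \<in> B b" "x \<in> B b \<Longrightarrow> adj x \<in> B b"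
  unfolding B_def by (auto intro: star_algebra_gen.intros)
lemma B_diff [simp, intro]: "x \<in> B b \<Longrightarrow> y \<in> B b \<Longrightarrow> x - y \<in> B b"
  using B_intros(2)[of x b "(-1) *\<^sub>C y"] B_intros(4)[of y b "-1"] by (simp add: scaleC_minus_left scaleC_one_bop)
lemma B_scaleR [simp, intro]: "x \<in> B b \<Longrightarrow> r *\<^sub>R x \<in> B b"
  using B_intros(4)[of x b "complex_of_real r"] by (simp add: scaleC_of_real)
lemma p_B: "p \<in> B True" and M_B: "x \<in> M \<Longrightarrow> x \<in> B False"
  unfolding B_def by (auto intro: star_algebra_gen.intros)
lemma p_idem: "p * p = p" "adj p = p" "p * (p * x) = p * x"
  using p(2) by (auto simp: is_projection_def hermitian_def simp flip: mult.assoc)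

section \<open>Alternating centred words\<close>

text \<open>Each letter carries a Boolean tag for its algebra, because an operator alone need not
  determine it: zero, for instance, is a centred element of both.\<close>

definition letters :: "(bool \<times> 'h bop) list \<Rightarrow> bool" where
  "letters ws \<longleftrightarrow> (\<forall>w\<in>set ws. snd w \<in> B (fst w) \<and> \<tau> (snd w) = 0) \<and> successively (\<lambda>u v. fst u \<noteq> fst v) ws"

abbreviation val :: "(bool \<times> 'h bop) list \<Rightarrow> 'h bop" where "val ws \<equiv> prod_list (map snd ws)"

lemma tau_word: "letters ws \<Longrightarrow> ws \<noteq> [] \<Longrightarrow> \<tau> (val ws) = 0"
  using free unfolding free_from_def free_family_def letters_def B_def[symmetric]
  apply (elim allE[of _ "map fst ws"] allE[of _ "map snd ws"])
  apply (auto simp: successively_conv_nth)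
  done

lemma val_A [simp, intro]: "letters ws \<Longrightarrow> val ws \<in> A"
proof (induction ws)
  case (Cons w ws)
  then have "letters ws" by (auto simp: letters_def successively_Cons)
  then show ?case using Cons by (auto simp: letters_def intro!: A_mult)
qed auto

text \<open>Complex multiples are built into the generators because \<open>span\<close> is the real
  span. The empty word belongs to \<open>gens b\<close> for both values of \<open>b\<close>; in the
  splitting into \<open>WP\<close> and \<open>WM\<close> the scalars are counted with
  \<open>WP\<close> only, which keeps the two spaces orthogonal.\<close>

definition gens :: "bool \<Rightarrow> 'h bop set" where
  "gens b = {c *\<^sub>C val ws | c ws. letters ws \<and> (ws = [] \<or> fst (hd ws) = b)}"
definition WP :: "'h bop set" where "WP = span (gens True)"
definition WM :: "'h bop set" where
  "WM = span {c *\<^sub>C val ws | c ws. letters ws \<and> ws \<noteq> [] \<and> fst (hd ws) = False}"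

definition rev_adj :: "(bool \<times> 'h bop) list \<Rightarrow> (bool \<times> 'h bop) list" where
  "rev_adj ws = rev (map (apsnd adj) ws)"

lemma adj_val: "adj (val ws) = val (rev_adj ws)"
  by (induction ws) (auto simp: rev_adj_def)

lemma letters_rev_adj [simp]: "letters ws \<Longrightarrow> letters (rev_adj ws)"
  by (auto simp: letters_def rev_adj_def successively_map tau_adj elim!: successively_mono)

lemma letters_append:
  "letters (us @ ws) \<longleftrightarrow> letters us \<and> letters ws \<and> (us = [] \<or> ws = [] \<or> fst (last us) \<noteq> fst (hd ws))"
  by (auto simp: letters_def successively_append_iff)

lemma letters_Nil [simp]: "letters []" by (simp add: letters_def)

lemma letters_Cons: "letters (w # ws) \<longleftrightarrow> snd w \<in> B (fst w) \<and> \<tau> (snd w) = 0 \<and> letters ws \<and> (ws = [] \<or> fst w \<noteq> fst (hd ws))"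
  by (auto simp: letters_def successively_Cons)

lemma last_rev_adj: "ws \<noteq> [] \<Longrightarrow> fst (last (rev_adj ws)) = fst (hd ws)"
  by (cases ws) (auto simp: rev_adj_def)

lemma rev_adj_Nil: "rev_adj ws = [] \<longleftrightarrow> ws = []" by (simp add: rev_adj_def)

lemma gens_subset_A: "gens b \<subseteq> A" by (auto simp: gens_def)
lemma WP_A [simp, intro]: "x \<in> WP \<Longrightarrow> x \<in> A"
  using span_minimal[OF gens_subset_A subspace_A] unfolding WP_def by auto
lemma WM_subset: "WM \<subseteq> span (gens False)"
  unfolding WM_def gens_def by (rule span_mono) auto
lemma WM_A [simp, intro]: "x \<in> WM \<Longrightarrow> x \<in> A"
  using WM_subset span_minimal[OF gens_subset_A subspace_A] by blast

text \<open>For either argument held fixed, the other arguments with vanishing trace form a real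
  subspace of \<open>A\<close>, so the generators decide.\<close>

lemma tau_bilinear_zero:
  assumes "x \<in> span X" "y \<in> span Y" "X \<subseteq> A" "Y \<subseteq> A" and c: "c \<in> A"
    and "\<And>x y. x \<in> X \<Longrightarrow> y \<in> Y \<Longrightarrow> \<tau> (adj x * c * y) = 0"
  shows "\<tau> (adj x * c * y) = 0"
proof -
  have Y: "Y \<subseteq> {y \<in> A. \<tau> (adj x * c * y) = 0}" if "x \<in> X" for x
    using assms(4) assms(6)[OF that] by auto
  have "subspace {y \<in> A. \<tau> (adj x * c * y) = 0}" if "x \<in> A" for x
    by (rule subspaceI) (use that c in \<open>auto simp: tau_zero distrib_left tau_add tau_scaleR\<close>)
  then have "span Y \<subseteq> {y \<in> A. \<tau> (adj x * c * y) = 0}" if "x \<in> X" for x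
    using span_minimal[OF Y[OF that]] assms(3) that by auto
  then have *: "y \<in> A \<and> \<tau> (adj x * c * y) = 0" if "x \<in> X" for x
    using assms(2) that by auto
  have yA: "y \<in> A" using span_minimal[OF assms(4) subspace_A] assms(2) by auto
  have "X \<subseteq> {x \<in> A. \<tau> (adj x * c * y) = 0}" using * assms(3) by auto
  moreover have "subspace {x \<in> A. \<tau> (adj x * c * y) = 0}"
    by (rule subspaceI) (use yA c in \<open>auto simp: tau_zero distrib_right tau_add tau_scaleR\<close>)
  ultimately show ?thesis
    using span_minimal[of X "{x \<in> A. \<tau> (adj x * c * y) = 0}"] assms(1) by auto
qed

text \<open>The reversed word of \<open>x\<close>, the centred letter \<open>c\<close> and the word
  of \<open>y\<close> fit together into one alternating word. The uses are \<open>c = p - t\<close>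
  between words beginning in the algebra of \<open>M\<close>, and the centred element and its
  centred square between words beginning with \<open>p\<close> or empty.\<close>

lemma tau_sandwich:
  assumes "x \<in> span (gens (\<not> b))" "y \<in> span (gens (\<not> b))" "c \<in> B b" "\<tau> c = 0"
  shows "\<tau> (adj x * c * y) = 0"
proof (rule tau_bilinear_zero[OF assms(1,2) gens_subset_A gens_subset_A])
  fix x y assume "x \<in> gens (\<not> b)" "y \<in> gens (\<not> b)"
  then obtain d e us ws where *: "x = d *\<^sub>C val us" "y = e *\<^sub>C val ws"
    and l: "letters us" "letters ws" "us = [] \<or> fst (hd us) = (\<not> b)" "ws = [] \<or> fst (hd ws) = (\<not> b)"
    by (auto simp: gens_def)
  have L: "letters (rev_adj us @ [(b, c)] @ ws)"
    using l assms by (cases "us = []"; cases "ws = []") (simp_all add: letters_append letters_Cons last_rev_adj rev_adj_Nil)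
  have e: "adj x * c * y = (cnj d * e) *\<^sub>C val (rev_adj us @ [(b, c)] @ ws)"
    by (simp add: * adj_val scaleC_mult_left scaleC_mult_right scaleC_scaleC mult.assoc mult.commute[of e "cnj d"])
  show "\<tau> (adj x * c * y) = 0"
    unfolding e by (subst tau_scaleC) (use L tau_word[OF L] in \<open>auto simp del: map_append prod_list.append\<close>)
qed (use assms in auto)

text \<open>Reversing a nonempty word that begins in the algebra of \<open>M\<close> gives one that
  ends there, and it can be followed by any word that is empty or begins with a letter from the
  algebra of \<open>p\<close>.\<close>

lemma tau_WM_WP:
  assumes "x \<in> WM" "y \<in> WP"
  shows "\<tau> (adj x * y) = 0"
proof -
  have "\<tau> (adj x * 1 * y) = 0"
  proof (rule tau_bilinear_zero[OF assms[unfolded WM_def WP_def]])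
    fix x y assume "x \<in> {c *\<^sub>C val ws | c ws. letters ws \<and> ws \<noteq> [] \<and> fst (hd ws) = False}" "y \<in> gens True"
    then obtain a b us ws where *: "x = a *\<^sub>C val us" "y = b *\<^sub>C val ws"
      and l: "letters us" "letters ws" "us \<noteq> []" "fst (hd us) = False" "ws = [] \<or> fst (hd ws) = True"
      by (auto simp: gens_def)
    have L: "letters (rev_adj us @ ws)" "rev_adj us @ ws \<noteq> []"
      using l by (cases "ws = []"; simp add: letters_append last_rev_adj rev_adj_Nil)+
    have e: "adj x * 1 * y = (cnj a * b) *\<^sub>C val (rev_adj us @ ws)"
      by (simp add: * adj_val scaleC_mult_left scaleC_mult_right scaleC_scaleC mult.commute[of b "cnj a"])
    show "\<tau> (adj x * 1 * y) = 0"
      unfolding e by (subst tau_scaleC) (use L tau_word[OF L] in \<open>auto simp del: map_append prod_list.append\<close>)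
  qed (auto simp: gens_def simp del: mult_1_right)
  then show ?thesis by simp
qed

definition words :: "'h bop set" where "words = {c *\<^sub>C val ws | c ws. letters ws}"

lemma words_decomp: "x \<in> span words \<Longrightarrow> \<exists>u\<in>WM. \<exists>v\<in>WP. x = u + v"
proof -
  have "words \<subseteq> {c *\<^sub>C val ws | c ws. letters ws \<and> ws \<noteq> [] \<and> fst (hd ws) = False} \<union> gens True"
    unfolding words_def gens_def by blast
  then have "span words \<subseteq> {u + v |u v. u \<in> WM \<and> v \<in> WP}"
    unfolding WM_def WP_def span_Un[symmetric] by (rule span_mono)
  then show "x \<in> span words \<Longrightarrow> \<exists>u\<in>WM. \<exists>v\<in>WP. x = u + v" by blast
qed

lemma span_words_A [simp, intro]: "x \<in> span words \<Longrightarrow> x \<in> A"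
  using span_minimal[OF _ subspace_A, of words] by (auto simp: words_def)

lemma tau_centred: "x \<in> A \<Longrightarrow> \<tau> (x - \<tau> x *\<^sub>C 1) = 0"
  by (simp add: tau_diff tau_scaleC tau_one)

text \<open>A new letter is either prepended or merged with a first letter from the same algebra.
  Splitting off the trace of the result leaves two alternating words in both cases. In this way
  polynomials in \<open>p\<close> and \<open>a\<close> become combinations of words.\<close>

lemma letter_mult_words:
  assumes "y \<in> span words" "x \<in> B b"
  shows "x * y \<in> span words"
  using assms(1)
proof (induction rule: span_induct_alt)
  case base then show ?case by (simp add: span_zero)
next
  case (step r z w)
  have cons: "u * val ws \<in> span words" if u: "u \<in> B b" and l: "letters ws" "ws = [] \<or> fst (hd ws) \<noteq> b" for u ws
  proof -
    let ?c = "u - \<tau> u *\<^sub>C 1"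
    have L: "letters ([(b, ?c)] @ ws)" using u tau_centred[of u] l by (auto simp: letters_Cons)
    have "u * val ws = 1 *\<^sub>C val ([(b, ?c)] @ ws) + \<tau> u *\<^sub>C val ws"
      by (simp add: left_diff_distrib scaleC_mult_left scaleC_one_bop)
    moreover have "1 *\<^sub>C val ([(b, ?c)] @ ws) \<in> words" "\<tau> u *\<^sub>C val ws \<in> words"
      unfolding words_def using L l by blast+
    ultimately show ?thesis by (simp add: span_add span_base del: map_append prod_list.append)
  qed
  have sC: "c *\<^sub>C y \<in> span words" if "y \<in> span words" for c y
    using that
  proof (induction rule: span_induct_alt)
    case base then show ?case by (simp add: scaleC_0_right span_zero)
  next
    case (step r z w)
    obtain d ws where "z = d *\<^sub>C val ws" "letters ws" using step(1) unfolding words_def by auto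
    then have "c *\<^sub>C z \<in> words" unfolding words_def scaleC_scaleC by (auto simp: scaleC_scaleC intro: exI[of _ "c * d"])
    then show ?case using step by (simp add: scaleC_add_right scaleC_scaleR span_add span_scale span_base)
  qed
  obtain a ws where z: "z = a *\<^sub>C val ws" "letters ws" using step unfolding words_def by auto
  have "x * val ws \<in> span words"
  proof (cases "ws = [] \<or> fst (hd ws) \<noteq> b")
    case True then show ?thesis using cons assms z by blast
  next
    case False
    then obtain y vs where ws: "ws = (b, y) # vs" by (cases ws) auto
    then have "letters ([(b, y)] @ vs)" using z by simp
    then have "letters [(b, y)]" "letters vs" "vs = [] \<or> fst (hd vs) \<noteq> b" by (auto simp: letters_Cons)
    then have "(x * y) * val vs \<in> span words" using cons[of "x * y" vs] assms by (auto simp: letters_def)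
    then show ?thesis by (simp add: ws mult.assoc)
  qed
  then have "x * z \<in> span words" using sC by (simp add: z scaleC_mult_right)
  then show ?case using step by (simp add: distrib_left span_add span_scale)
qed

lemma one_words: "1 \<in> span words"
proof -
  have "letters []" by (simp add: letters_def)
  then have "1 *\<^sub>C val [] \<in> words" unfolding words_def by blast
  then show ?thesis by (simp add: scaleC_one_bop span_base)
qed

text \<open>Split \<open>\<xi> = p y\<close> as \<open>\<eta> + \<zeta>\<close>, with \<open>\<eta>\<close> spanned by the words that begin in the algebra of \<open>M\<close>.
  A centred element of that algebra maps \<open>\<zeta>\<close> to \<open>\<sigma>\<close> times an isometric copy of \<open>\<zeta>\<close> orthogonal to it,
  while \<open>\<parallel>p \<eta>\<parallel>\<^sup>2 = t \<parallel>\<eta>\<parallel>\<^sup>2\<close> forces \<open>\<parallel>\<eta>\<parallel>\<^sup>2 \<le> t \<parallel>\<xi>\<parallel>\<^sup>2\<close>.\<close>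

lemma compression_form_le:
  assumes a: "a \<in> M" "hermitian a" and L: "\<And>h. inner (bop_apply a h) h \<le> L * (norm h)\<^sup>2"
    and y: "y \<in> span words"
  shows "Re (\<tau> (adj (p * y) * a * (p * y)))
    \<le> (t * L + 2 * std_dev \<tau> a * sqrt (t * (1 - t)) + (1 - t) * mean \<tau> a) * norm2_sq (p * y)"
proof -
  define m where "m = mean \<tau> a"
  define \<sigma> where "\<sigma> = std_dev \<tau> a"
  have aA: "a \<in> A" "a \<in> B False" using a MA M_B by auto
  have aj: "adj a = a" using a by (simp add: hermitian_def)
  have tm: "\<tau> a = complex_of_real m"
    using tau_hermitian(1)[OF aA(1) a(2)] by (simp add: m_def mean_def of_real_Re)
  have ta2: "\<tau> (a * a) \<in> \<real>" using tau_hermitian(1)[of "a * a"] aA aj by (simp add: hermitian_def)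
  define c where "c = a - m *\<^sub>R 1"
  have cB: "c \<in> B False" "adj c = c" using aA aj by (simp_all add: c_def)
  have tc: "\<tau> c = 0" using aA by (simp add: c_def tau_diff tau_scaleR tau_one tm)
  have "c * c = a * a - (2 * m) *\<^sub>R a + (m * m) *\<^sub>R 1"
    by (simp add: c_def algebra_simps flip: scaleR_2)
  then have tcc: "\<tau> (c * c) = complex_of_real (mean \<tau> (a ^ 2) - m\<^sup>2)"
    using aA ta2 by (simp add: tau_add tau_diff tau_scaleR tau_one tm mean_def power2_eq_square of_real_Re)
  have ge0: "mean \<tau> (a ^ 2) - m\<^sup>2 \<ge> 0"
    using norm2_sq_nonneg[of c] cB by (simp add: norm2_sq_def tcc)
  then have \<sigma>2: "\<sigma>\<^sup>2 = mean \<tau> (a ^ 2) - m\<^sup>2" "\<sigma> \<ge> 0" by (simp_all add: \<sigma>_def std_dev_def m_def)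
  define \<xi> where "\<xi> = p * y"
  have "\<xi> \<in> span words" unfolding \<xi>_def by (rule letter_mult_words[OF y p_B])
  then obtain u v where uv: "u \<in> WM" "v \<in> WP" "\<xi> = u + v" using words_decomp by blast
  have uvA: "u \<in> A" "v \<in> A" "c \<in> A" using uv cB by auto
  have p\<xi>: "p * \<xi> = \<xi>" by (simp add: \<xi>_def p_idem flip: mult.assoc)
  have uv0: "\<tau> (adj u * v) = 0" using tau_WM_WP uv by blast
  have vu0: "\<tau> (adj v * u) = 0" using tau_adj[of "adj u * v"] uv0 uvA by simp
  have n\<xi>: "norm2_sq \<xi> = norm2_sq u + norm2_sq v"
    unfolding norm2_sq_def uv(3) using uvA by (simp add: distrib_left distrib_right tau_add uv0 vu0)
  have \<xi>A: "\<xi> \<in> A" using uv uvA by simp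
  have npu: "norm2_sq (p * u) = t * norm2_sq u"
  proof -
    have "\<tau> (adj u * (p - t *\<^sub>R 1) * u) = 0"
      by (rule tau_sandwich[of u True u]) (use p p_B uv WM_subset in \<open>auto simp: tau_diff tau_scaleR tau_one\<close>)
    then have "\<tau> (adj u * p * u) = t * \<tau> (adj u * u)"
      using uvA p by (simp add: left_diff_distrib right_diff_distrib tau_diff tau_scaleR)
    then show ?thesis unfolding norm2_sq_def by (simp add: p_idem mult.assoc)
  qed
  have n: "norm2_sq u \<ge> 0" "norm2_sq v \<ge> 0" "norm2_sq \<xi> \<ge> 0" using norm2_sq_nonneg uvA \<xi>A by auto
  have ET: "norm2_sq u \<le> t * (norm2_sq u + norm2_sq v)"
  proof (cases "norm2_sq u = 0")
    case False
    \<comment> \<open>As \<open>u\<close> is orthogonal to \<open>v\<close> and \<open>p\<close>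
      fixes \<xi>, the squared norm of \<open>u\<close> is the inner product of \<open>p * u\<close>
      with \<xi>. Cauchy-Schwarz then costs only the norm of \<open>p * u\<close>, which is sqrt t
      times that of \<open>u\<close>.\<close>
    have "norm2_sq u = Re (\<tau> (adj u * \<xi>))" unfolding uv(3) norm2_sq_def using uvA by (simp add: distrib_left tau_add uv0)
    also have "\<dots> = Re (\<tau> (adj (p * u) * \<xi>))" by (simp add: p_idem mult.assoc p\<xi>)
    also have "\<dots> \<le> sqrt (norm2_sq (p * u)) * sqrt (norm2_sq \<xi>)" by (rule tau_Cauchy_Schwarz) (use p uvA \<xi>A in auto)
    also have "\<dots> = sqrt (norm2_sq u) * sqrt (t * norm2_sq \<xi>)" by (simp add: npu real_sqrt_mult)
    finally have "sqrt (norm2_sq u) * sqrt (norm2_sq u) \<le> sqrt (norm2_sq u) * sqrt (t * norm2_sq \<xi>)"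
      using n by (simp only: real_sqrt_mult_self abs_of_nonneg)
    then have "sqrt (norm2_sq u) \<le> sqrt (t * norm2_sq \<xi>)"
      by (rule mult_left_le_imp_le) (use False n in simp)
    then have "norm2_sq u \<le> t * norm2_sq \<xi>" by (simp only: real_sqrt_le_iff)
    then show ?thesis by (simp add: n\<xi>)
  qed (use n t in simp)
  have ncv: "norm2_sq (c * v) = \<sigma>\<^sup>2 * norm2_sq v"
  proof -
    have "\<tau> (adj v * (c * c - \<sigma>\<^sup>2 *\<^sub>R 1) * v) = 0"
      by (rule tau_sandwich[of v False v]) (use cB uv in \<open>auto simp: WP_def tau_diff tau_scaleR tau_one tcc \<sigma>2\<close>)
    then have "\<tau> (adj v * (c * c) * v) = complex_of_real (\<sigma>\<^sup>2) * \<tau> (adj v * v)"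
      using uvA by (simp add: left_diff_distrib right_diff_distrib tau_diff tau_scaleR)
    then show ?thesis unfolding norm2_sq_def by (simp add: cB mult.assoc)
  qed
  \<comment> \<open>The upper bound on \<open>a\<close>, read in the trace inner product. Applied to
    \<open>u\<close> it gives the first term of \<open>Q1\<close>, applied to \<xi> it gives
    \<open>Q2\<close>.\<close>
  have form: "Re (\<tau> (adj z * c * z)) \<le> (L - m) * norm2_sq z" if z: "z \<in> A" for z
  proof -
    have "\<tau> (adj z * (L *\<^sub>R 1 - a) * z) \<in> \<real>\<^sub>\<ge>\<^sub>0"
      by (rule tau_sandwich_nonneg)
        (use L z aA aj in \<open>auto simp: hermitian_def bop_apply_simps inner_diff_left power2_norm_eq_inner\<close>)
    then show ?thesis using z aA
      by (simp add: norm2_sq_def c_def left_diff_distrib right_diff_distrib tau_diff tau_scaleR complex_nonneg_Reals_iff)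
  qed
  have vcv: "\<tau> (adj v * c * v) = 0" by (rule tau_sandwich[of v False v, OF _ _ cB(1) tc]) (use uv in \<open>auto simp: WP_def\<close>)
  have Q: "Re (\<tau> (adj \<xi> * c * \<xi>)) = Re (\<tau> (adj u * c * u)) + 2 * Re (\<tau> (adj u * (c * v)))"
  proof -
    have "Re (\<tau> (adj v * c * u)) = Re (\<tau> (adj u * (c * v)))"
      using tau_Re_commute[of "c * v" u] uvA by (simp add: cB mult.assoc)
    then show ?thesis unfolding uv(3) using uvA vcv
      by (simp add: distrib_left distrib_right tau_add mult.assoc)
  qed
  have Q1: "Re (\<tau> (adj \<xi> * c * \<xi>)) \<le> (L - m) * norm2_sq u + 2 * \<sigma> * sqrt (norm2_sq u) * sqrt (norm2_sq v)"
    using tau_Cauchy_Schwarz[of u "c * v"] form[of u] uvA \<sigma>2(2) unfolding Q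
    by (simp add: ncv real_sqrt_mult mult_ac)
  have Q2: "Re (\<tau> (adj \<xi> * c * \<xi>)) \<le> (L - m) * (norm2_sq u + norm2_sq v)" using form[OF \<xi>A] by (simp add: n\<xi>)
  have "Re (\<tau> (adj \<xi> * c * \<xi>)) \<le> (t * (L - m) + 2 * \<sigma> * sqrt (t * (1 - t))) * norm2_sq \<xi>"
    unfolding n\<xi> by (rule compression_bound_concave[OF n(1,2) t \<sigma>2(2) ET Q1 Q2])
  moreover have "Re (\<tau> (adj \<xi> * a * \<xi>)) = Re (\<tau> (adj \<xi> * c * \<xi>)) + m * norm2_sq \<xi>"
    using \<xi>A aA by (simp add: norm2_sq_def c_def left_diff_distrib right_diff_distrib tau_diff tau_scaleR)
  ultimately show ?thesis
    unfolding m_def[symmetric] \<sigma>_def[symmetric] \<xi>_def[symmetric] by (simp add: algebra_simps)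
qed

section \<open>From the trace form to the norm of the compression\<close>

text \<open>The form estimate covers the vectors \<open>p * y\<close> with \<open>y\<close> a
  combination of words. Since \<open>b\<close> maps combinations of words to such combinations, all
  polynomials in \<open>b\<close> are covered, and that is enough for \<open>b\<close> to be a
  nonnegative operator.\<close>

lemma compression_le:
  assumes a: "a \<in> M" "hermitian a" and L: "\<And>h. inner (bop_apply a h) h \<le> L * (norm h)\<^sup>2"
  shows "inner (bop_apply (p * a * p) h) h
    \<le> (t * L + 2 * std_dev \<tau> a * sqrt (t * (1 - t)) + (1 - t) * mean \<tau> a) * inner (bop_apply p h) h"
proof -
  define U where "U = t * L + 2 * std_dev \<tau> a * sqrt (t * (1 - t)) + (1 - t) * mean \<tau> a"
  define b where "b = U *\<^sub>R p - p * a * p"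
  have aA: "a \<in> A" "a \<in> B False" using a MA M_B by auto
  have bA: "b \<in> A" "adj b = b" using p a aA p_idem by (simp_all add: b_def hermitian_def mult.assoc)
  have bw: "b * y \<in> span words" if "y \<in> span words" for y
  proof -
    have "b * y = U *\<^sub>R (p * y) - p * (a * (p * y))" by (simp add: b_def left_diff_distrib mult.assoc)
    then show ?thesis using that aA p_B by (simp add: span_diff span_scale letter_mult_words)
  qed
  have "b ^ n \<in> span words" for n by (induction n) (auto simp: one_words bw)
  then have sub: "span (range (\<lambda>n. b ^ n)) \<subseteq> span words" by (intro span_minimal) auto
  have "inner (bop_apply b h) h \<ge> 0"
  proof (rule nonneg_if_trace_nonneg)
    fix y assume "y \<in> span (range (\<lambda>n. b ^ n))"
    then have y: "y \<in> span words" using sub by blast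
    then have yA: "y \<in> A" by blast
    have "adj y * b * y = U *\<^sub>R (adj (p * y) * (p * y)) - adj (p * y) * a * (p * y)"
      by (simp add: b_def left_diff_distrib right_diff_distrib p_idem mult.assoc)
    then have "Re (\<tau> (adj y * b * y)) = U * norm2_sq (p * y) - Re (\<tau> (adj (p * y) * a * (p * y)))"
      using yA aA p by (simp add: tau_diff tau_scaleR norm2_sq_def)
    then show "Re (\<tau> (adj y * b * y)) \<ge> 0" using compression_form_le[OF a L y] by (simp add: U_def)
  qed (use bA in \<open>auto simp: hermitian_def\<close>)
  then show ?thesis by (simp add: b_def U_def bop_apply_simps inner_diff_left)
qed

text \<open>The lower estimate is the upper one for \<open>- a\<close>, whose upper bound is
  \<open>- Lm\<close>, whose mean changes sign and whose deviation stays the same.\<close>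

lemma t_norm_le:
  assumes a: "a \<in> M" "hermitian a" "- a \<in> M" and L: "Lm *\<^sub>R 1 \<preceq> a" "a \<preceq> Lp *\<^sub>R 1"
  shows "t_norm p a \<le> max
    \<bar>t * Lp + 2 * std_dev \<tau> a * sqrt (t * (1 - t)) + (1 - t) * mean \<tau> a\<bar>
    \<bar>t * Lm - 2 * std_dev \<tau> a * sqrt (t * (1 - t)) + (1 - t) * mean \<tau> a\<bar>" (is "_ \<le> max \<bar>?U\<bar> \<bar>?V\<bar>")
  unfolding t_norm_def
proof (rule norm_le_quadratic_form)
  have aA: "a \<in> A" using a MA by auto
  have ge: "inner (bop_apply (y - x) h) h \<ge> 0" if "x \<preceq> y" for x y :: "'h bop" and h
    using that unfolding op_le_def Re_cinner[symmetric] by (auto simp: complex_nonneg_Reals_iff)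
  have Lp: "inner (bop_apply a h) h \<le> Lp * (norm h)\<^sup>2" and Lm: "inner (bop_apply (- a) h) h \<le> (- Lm) * (norm h)\<^sup>2" for h
    using ge[OF L(1), of h] ge[OF L(2), of h]
    by (simp_all add: bop_apply_simps inner_diff_left power2_norm_eq_inner)
  show "hermitian (p * a * p)" using a(2) p_idem by (simp add: hermitian_def mult.assoc)
  show "0 \<le> max \<bar>?U\<bar> \<bar>?V\<bar>" by simp
  fix h
  define q where "q = inner (bop_apply p h) h"
  have "q = inner (bop_apply p (bop_apply p h)) h"
    unfolding q_def by (metis p_idem(1) times_bop.rep_eq)
  then have q: "q = (norm (bop_apply p h))\<^sup>2"
    by (simp add: inner_adj[of p "bop_apply p h"] p_idem power2_norm_eq_inner)
  have "norm (bop_apply p h) * norm (bop_apply p h) \<le> norm (bop_apply p h) * norm h"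
    using norm_cauchy_schwarz[of "bop_apply p h" h] q by (simp add: q_def power2_eq_square)
  then have "norm (bop_apply p h) \<le> norm h" by (cases "norm (bop_apply p h) = 0") auto
  then have q1: "0 \<le> q" "q \<le> (norm h)\<^sup>2" unfolding q by (auto intro: power_mono)
  have u: "inner (bop_apply (p * a * p) h) h \<le> ?U * q"
    unfolding q_def by (rule compression_le[OF a(1,2) Lp])
  have "hermitian (- a)" using a(2) by (simp add: hermitian_def)
  moreover have "std_dev \<tau> (- a) = std_dev \<tau> a" "mean \<tau> (- a) = - mean \<tau> a"
    using aA by (simp_all add: std_dev_def mean_def tau_minus power2_eq_square)
  ultimately have "inner (bop_apply (p * (- a) * p) h) h \<le> (t * (- Lm) + 2 * std_dev \<tau> a * sqrt (t * (1 - t)) + (1 - t) * (- mean \<tau> a)) * q"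
    using compression_le[OF a(3) _ Lm] by (simp add: q_def)
  then have v: "inner (bop_apply (p * a * p) h) h \<ge> ?V * q"
    by (simp add: bop_apply_simps algebra_simps)
  \<comment> \<open>The factors \<open>?U\<close> and \<open>?V\<close> may have either sign, so
    they are first replaced by a common bound of their absolute values; only then is
    \<open>q\<close> enlarged to the squared norm of the vector.\<close>
  have "x \<le> b * n" "- x \<le> b * n"
    if "x \<le> U * q" "V * q \<le> x" "\<bar>U\<bar> \<le> b" "\<bar>V\<bar> \<le> b" "0 \<le> q" "q \<le> n" for x U V b n :: real
  proof -
    have "U * q \<le> b * q" "- b * q \<le> V * q" using that by (intro mult_right_mono; linarith)+
    moreover have "b * q \<le> b * n" using that by (intro mult_left_mono) auto
    ultimately show "x \<le> b * n" "- x \<le> b * n" using that by linarith+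
  qed
  from this[OF u v max.cobounded1 max.cobounded2 q1]
  show "\<bar>inner (bop_apply (p * a * p) h) h\<bar> \<le> max \<bar>?U\<bar> \<bar>?V\<bar> * (norm h)\<^sup>2"
    by (rule abs_leI)
qed

end

section \<open>A representation formula in the half-plane\<close>

abbreviation upper_half_plane :: "complex set" where "upper_half_plane \<equiv> {z. Im z > 0}"

lemma convex_Im_gt: "convex {z. Im z > c}" and open_Im_gt: "open {z. Im z > c}"
  using convex_halfspace_Im_gt[of c] open_halfspace_Im_gt[of c] by simp_all

lemma upper_arc_image:
  assumes "R > 0" "x \<in> path_image (part_circlepath 0 R 0 pi)"
  shows "norm x = R" "Im x \<ge> 0"
proof -
  obtain s where s: "s \<in> {0..pi}" "x = of_real R * cis s"
    using assms(2) by (auto simp: path_image_part_circlepath' closed_segment_eq_real_ivl)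
  show "norm x = R" using s assms by (simp add: norm_mult)
  show "Im x \<ge> 0" using s assms sin_ge_zero[of s] by simp
qed

lemma lower_arc_image:
  assumes "R > 0" "x \<in> path_image (part_circlepath 0 R pi (2 * pi))"
  shows "Im x \<le> 0"
proof -
  obtain s where s: "s \<in> {pi..2*pi}" "x = of_real R * cis s"
    using assms(2) by (auto simp: path_image_part_circlepath' closed_segment_eq_real_ivl)
  have "sin s \<le> 0" using s sin_le_zero[of s] by (cases "s = 2 * pi") auto
  then show "Im x \<le> 0" using s assms by (simp add: mult_nonneg_nonpos)
qed

lemma real_segment_image:
  assumes "x \<in> path_image (linepath (- of_real R) (of_real R))"
  shows "Im x = 0" "norm x \<le> \<bar>R\<bar>"
proof -
  have "x \<in> closed_segment (of_real (- R)) (of_real R)" using assms by simp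
  then have "x \<in> of_real ` closed_segment (- R) R" by (simp only: closed_segment_of_real)
  then obtain s where "x = of_real s" "\<bar>s\<bar> \<le> \<bar>R\<bar>"
    by (auto simp: closed_segment_eq_real_ivl split: if_splits)
  then show "Im x = 0" "norm x \<le> \<bar>R\<bar>" by auto
qed

definition semicircle :: "real \<Rightarrow> real \<Rightarrow> complex" where
  "semicircle R = linepath (- of_real R) (of_real R) +++ part_circlepath 0 R 0 pi"

lemma semicircle_path:
  assumes "R > 0"
  shows "valid_path (semicircle R)" "pathfinish (semicircle R) = pathstart (semicircle R)"
    and "x \<in> path_image (semicircle R) \<Longrightarrow> Im x \<ge> 0 \<and> (Im x = 0 \<or> norm x = R) \<and> norm x \<le> R"
proof -
  have j: "pathfinish (linepath (- of_real R) (of_real R)) = pathstart (part_circlepath 0 R 0 pi)"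
    by simp
  show "valid_path (semicircle R)" unfolding semicircle_def
    by (intro valid_path_join) (simp_all)
  show "pathfinish (semicircle R) = pathstart (semicircle R)"
    unfolding semicircle_def by (simp flip: cis_conv_exp)
  show "Im x \<ge> 0 \<and> (Im x = 0 \<or> norm x = R) \<and> norm x \<le> R" if "x \<in> path_image (semicircle R)"
    using that upper_arc_image[OF assms, of x] real_segment_image[of x R] assms
    unfolding semicircle_def path_image_join[OF j] by auto
qed

text \<open>The lower arc and the diameter have the same endpoints and lie below the height of
  \<open>z\<close>, where 1 / (w - z) is holomorphic, so their integrals agree. The semicircle thus
  has the same integral as the full circle.\<close>

lemma winding_number_semicircle:
  assumes z: "Im z > 0" "norm z < R"
  shows "winding_number (semicircle R) z = 1"
proof -
  have R: "R > 0" using z by (meson norm_ge_zero order_le_less_trans)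
  define g where "g w = 1 / (w - z)" for w
  have notin: "z \<notin> path_image (semicircle R)" using semicircle_path(3)[OF R, of z] z by auto
  have hol: "g holomorphic_on {w. Im w < Im z}"
    unfolding g_def by (intro holomorphic_intros) auto
  have op: "open {w. Im w < Im z}" "convex {w. Im w < Im z}"
    using open_halfspace_Im_lt[of "Im z"] convex_halfspace_Im_lt[of "Im z"] by simp_all
  have circ: "(g has_contour_integral 2 * of_real pi * \<i>) (part_circlepath 0 R 0 (2 * pi))"
    using Cauchy_integral_circlepath_simple[of "\<lambda>_. 1" 0 R z] z
    by (simp add: g_def[abs_def] circlepath_def)
  have cont: "continuous_on (path_image (part_circlepath 0 R 0 pi)) g"
    unfolding g_def by (intro continuous_intros) (use upper_arc_image[OF R] z in force)
  obtain I where I: "(g has_contour_integral I) (part_circlepath 0 R 0 pi)"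
    using contour_integrable_continuous_part_circlepath[OF cont] by (auto simp: contour_integrable_on_def)
  have lower: "path_image (part_circlepath 0 R pi (2 * pi)) \<subseteq> {w. Im w < Im z}"
    using lower_arc_image[OF R] z by fastforce
  have line: "path_image (linepath (- of_real R) (of_real R)) \<subseteq> {w. Im w < Im z}"
    using real_segment_image z by fastforce
  obtain J where J: "(g has_contour_integral J) (part_circlepath 0 R pi (2 * pi))"
    using contour_integrable_holomorphic_simple[OF hol op(1) valid_path_part_circlepath lower]
    by (auto simp: contour_integrable_on_def)
  obtain K where K: "(g has_contour_integral K) (linepath (- of_real R) (of_real R))"
    using contour_integrable_holomorphic_simple[OF hol op(1) valid_path_linepath line]
    by (auto simp: contour_integrable_on_def)
  have IJ: "I + J = 2 * of_real pi * \<i>"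
  proof -
    have "((\<lambda>t. g (0 + R * cis t) * R * \<i> * cis t) has_integral (I + J)) {0..2 * pi}"
      by (rule has_integral_combine[of 0 pi "2 * pi"])
        (use I J in \<open>simp_all add: has_contour_integral_part_circlepath_iff\<close>)
    moreover have "((\<lambda>t. g (0 + R * cis t) * R * \<i> * cis t) has_integral (2 * of_real pi * \<i>)) {0..2 * pi}"
      using circ by (subst (asm) has_contour_integral_part_circlepath_iff) simp_all
    ultimately show ?thesis by (rule has_integral_unique)
  qed
  have e: "exp (\<i> * (2 * complex_of_real pi)) = 1"
    by (metis cis_2pi cis_conv_exp of_real_mult of_real_numeral)
  have "J - K = 0"
  proof -
    let ?l = "reversepath (linepath (- of_real R) (of_real R)) :: real \<Rightarrow> complex"
    have "(g has_contour_integral (J + - K)) (part_circlepath 0 R pi (2 * pi) +++ ?l)"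
      by (intro has_contour_integral_join J has_contour_integral_reversepath K) auto
    moreover have "(g has_contour_integral 0) (part_circlepath 0 R pi (2 * pi) +++ ?l)"
    proof (rule Cauchy_theorem_convex_simple[OF hol op(2)])
      show "valid_path (part_circlepath 0 R pi (2 * pi) +++ ?l)"
        by (intro valid_path_join) (simp_all add: e)
      show "path_image (part_circlepath 0 R pi (2 * pi) +++ ?l) \<subseteq> {w. Im w < Im z}"
        using subset_trans[OF path_image_join_subset Un_least[OF lower]] line by (simp add: closed_segment_commute)
      show "pathfinish (part_circlepath 0 R pi (2 * pi) +++ ?l) = pathstart (part_circlepath 0 R pi (2 * pi) +++ ?l)"
        by (simp add: e)
    qed
    ultimately show ?thesis using has_contour_integral_unique by fastforce
  qed
  then have "K + I = 2 * of_real pi * \<i>" using IJ by (simp add: algebra_simps)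
  moreover have "(g has_contour_integral (K + I)) (semicircle R)"
    unfolding semicircle_def by (intro has_contour_integral_join K I) auto
  ultimately have "contour_integral (semicircle R) g = 2 * of_real pi * \<i>"
    using contour_integral_unique by metis
  then show ?thesis
    using winding_number_valid_path[OF semicircle_path(1)[OF R] notin] by (simp add: g_def[abs_def])
qed

text \<open>Subtracting from Cauchy's formula at \<open>z\<close> the conjugate of Cauchy's theorem at the reflected
  point \<open>cnj z\<close> leaves only the imaginary part of the boundary values.\<close>

lemma half_plane_representation:
  fixes f :: "complex \<Rightarrow> complex"
  assumes e: "e > 0" and hol: "f holomorphic_on {z. Im z > - e}"
    and dec: "\<And>w. Im w \<ge> 0 \<Longrightarrow> norm w \<ge> B \<Longrightarrow> norm (f w) \<le> C / norm w" and z: "Im z > 0"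
  shows "((\<lambda>R. integral {-R..R} (\<lambda>x. complex_of_real (- Im (f (of_real x)) / pi) / (z - of_real x))) \<longlongrightarrow> f z) at_top"
proof -
  define \<phi> where "\<phi> x = complex_of_real (- Im (f (of_real x)) / pi) / (z - of_real x)" for x
  have "\<forall>\<^sub>F R in at_top. norm (integral {-R..R} \<phi> - f z) \<le> \<bar>C\<bar> / (R - norm z)"
    using eventually_gt_at_top[of "max B (norm z)"]
  proof eventually_elim
    case (elim R)
    have R: "R > 0" "norm z < R" "B \<le> R" using elim by (auto intro: le_less_trans[OF norm_ge_zero])
    \<comment> \<open>A convex open half-plane that contains the closed upper half-plane but is cut
      off high enough to miss the reflected point.\<close>
    define S where "S = {w. Im w > - min e (Im z)}"
    have S: "convex S" "open S" unfolding S_def by (rule convex_Im_gt open_Im_gt)+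
    have holS: "f holomorphic_on S" by (rule holomorphic_on_subset[OF hol]) (auto simp: S_def)
    have zS: "z \<in> interior S" using S(2) z e by (simp add: interior_open S_def)
    have cS: "cnj z \<notin> S" by (simp add: S_def)
    have img: "path_image (semicircle R) \<subseteq> S - {z}"
      using semicircle_path(3)[OF R(1)] e z R by (fastforce simp: S_def)
    define g where "g w = f w / (w - z)" for w
    define h where "h w = f w / (w - cnj z)" for w
    have int: "(g has_contour_integral (2 * of_real pi * \<i> * f z)) (semicircle R)"
      using Cauchy_integral_formula_convex_simple[OF S(1) holS zS semicircle_path(1)[OF R(1)] img semicircle_path(2)[OF R(1)]]
        winding_number_semicircle[OF z R(2)] by (simp add: g_def[abs_def])
    have holh: "h holomorphic_on S"
      unfolding h_def using cS by (intro holomorphic_intros holS) auto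
    have inth: "(h has_contour_integral 0) (semicircle R)"
      by (rule Cauchy_theorem_convex_simple[OF holh S(1) semicircle_path(1)[OF R(1)] _ semicircle_path(2)[OF R(1)]])
        (use img in auto)
    have holg: "g holomorphic_on S - {z}"
      unfolding g_def by (intro holomorphic_intros holomorphic_on_subset[OF holS]) auto
    have imgs: "path_image (linepath (- of_real R) (of_real R)) \<subseteq> S - {z}" "path_image (part_circlepath 0 R 0 pi) \<subseteq> S - {z}"
      using img unfolding semicircle_def by (subst (asm) path_image_join; simp)+
    have "g contour_integrable_on linepath (- of_real R) (of_real R)" "g contour_integrable_on part_circlepath 0 R 0 pi"
      by (intro contour_integrable_holomorphic_simple[OF holg] imgs valid_path_linepath valid_path_part_circlepath open_delete S)+
    then obtain I J where I: "(g has_contour_integral I) (linepath (- of_real R) (of_real R))"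
      and J: "(g has_contour_integral J) (part_circlepath 0 R 0 pi)" by (auto simp: contour_integrable_on_def)
    have "h contour_integrable_on linepath (- of_real R) (of_real R)" "h contour_integrable_on part_circlepath 0 R 0 pi"
      using imgs by (intro contour_integrable_holomorphic_simple[OF holh S(2)] valid_path_linepath valid_path_part_circlepath; blast)+
    then obtain I' J' where I': "(h has_contour_integral I') (linepath (- of_real R) (of_real R))"
      and J': "(h has_contour_integral J') (part_circlepath 0 R 0 pi)" by (auto simp: contour_integrable_on_def)
    have "(g has_contour_integral (I + J)) (semicircle R)" "(h has_contour_integral (I' + J')) (semicircle R)"
      unfolding semicircle_def by (intro has_contour_integral_join I J I' J'; simp)+
    then have IJ: "I + J = 2 * of_real pi * \<i> * f z" "I' + J' = 0"
      using int inth has_contour_integral_unique by blast+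
    \<comment> \<open>The decay of \<open>f\<close> cancels the length of the arc, leaving a
      multiple of 1 / (R - norm z). The estimate depends only on the modulus of the pole, so it
      serves both \<open>z\<close> and \<open>cnj z\<close>.\<close>
    have bound: "norm i \<le> \<bar>C\<bar> * pi / (R - norm z)"
      if i: "((\<lambda>w. f w / (w - c)) has_contour_integral i) (part_circlepath 0 R 0 pi)" and c: "norm c = norm z" for i c
    proof -
      have "norm i \<le> (\<bar>C\<bar> / R / (R - norm z)) * R * (pi - 0)"
      proof (rule has_contour_integral_bound_part_circlepath[OF i])
        fix x assume "x \<in> path_image (part_circlepath 0 R 0 pi)"
        then have x: "norm x = R" "Im x \<ge> 0" using upper_arc_image R by auto
        have "norm (f x) \<le> \<bar>C\<bar> / R"
          using dec[of x] x R by (smt (verit) divide_right_mono)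
        moreover have "R - norm z \<le> norm (x - c)" using norm_triangle_ineq2[of x c] x c by simp
        ultimately show "norm (f x / (x - c)) \<le> \<bar>C\<bar> / R / (R - norm z)"
          using R unfolding norm_divide by (intro frac_le) auto
      qed (use R in auto)
      then show ?thesis using R by simp
    qed
    have nJ: "norm J \<le> \<bar>C\<bar> * pi / (R - norm z)" using bound[of z J] J by (simp add: g_def[abs_def])
    have nJ': "norm J' \<le> \<bar>C\<bar> * pi / (R - norm z)" using bound[of "cnj z" J'] J' by (simp add: h_def[abs_def])
    have 1: "((\<lambda>x. g (of_real x)) has_integral I) {-R..R}"
      using I R by (subst (asm) has_contour_integral_linepath_Reals_iff) auto
    have "((\<lambda>x. h (of_real x)) has_integral I') {-R..R}"
      using I' R by (subst (asm) has_contour_integral_linepath_Reals_iff) auto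
    then have 2: "((\<lambda>x. cnj (h (of_real x))) has_integral cnj I') {-R..R}" using has_integral_cnj[of "\<lambda>x. h (of_real x)" I' "{-R..R}"] by (simp add: comp_def)
    have "((\<lambda>x. (- \<i> / (2 * of_real pi)) * (g (of_real x) - cnj (h (of_real x)))) has_integral (- \<i> / (2 * of_real pi)) * (I - cnj I')) {-R..R}"
      by (intro has_integral_mult_right has_integral_diff 1 2)
    moreover have "(- \<i> / (2 * of_real pi)) * (g (of_real x) - cnj (h (of_real x))) = \<phi> x" for x
    proof -
      have nz: "z \<noteq> of_real x" using z by auto
      have "g (of_real x) - cnj (h (of_real x)) = (f (of_real x) - cnj (f (of_real x))) / (of_real x - z)"
        by (simp add: g_def h_def diff_divide_distrib)
      also have "f (of_real x) - cnj (f (of_real x)) = 2 * \<i> * of_real (Im (f (of_real x)))"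
        by (simp add: complex_eq_iff)
      finally have d: "g (of_real x) - cnj (h (of_real x)) = 2 * \<i> * of_real (Im (f (of_real x))) / (of_real x - z)" .
      show ?thesis unfolding d \<phi>_def using nz by (simp add: field_simps)
    qed
    ultimately have "(\<phi> has_integral (- \<i> / (2 * of_real pi)) * (I - cnj I')) {-R..R}" by simp
    then have "integral {-R..R} \<phi> = (- \<i> / (2 * of_real pi)) * (I - cnj I')" by (rule integral_unique)
    also have "I - cnj I' = 2 * of_real pi * \<i> * f z + (cnj J' - J)"
    proof -
      have "I = 2 * of_real pi * \<i> * f z - J" "I' = - J'" using IJ by (simp_all add: algebra_simps eq_neg_iff_add_eq_0)
      then show ?thesis by simp
    qed
    also have "(- \<i> / (2 * of_real pi)) * (2 * of_real pi * \<i> * f z + (cnj J' - J)) = f z + (- \<i> / (2 * of_real pi)) * (cnj J' - J)"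
      by (simp add: field_simps)
    finally have "norm (integral {-R..R} \<phi> - f z) = norm (cnj J' - J) / (2 * pi)"
      by (simp add: norm_mult norm_divide)
    also have "\<dots> \<le> (\<bar>C\<bar> * pi / (R - norm z) + \<bar>C\<bar> * pi / (R - norm z)) / (2 * pi)"
      by (intro divide_right_mono order_trans[OF norm_triangle_ineq4] add_mono) (use nJ nJ' in simp_all)
    also have "\<dots> = \<bar>C\<bar> / (R - norm z)"
    proof -
      have "(c * pi / d + c * pi / d) / (2 * pi) = c / d" for c d :: real
        by (cases "d = 0") (simp_all add: field_simps)
      then show ?thesis .
    qed
    finally show ?case .
  qed
  moreover have "((\<lambda>R. \<bar>C\<bar> / (R - norm z)) \<longlongrightarrow> 0) at_top"
    by real_asymp
  ultimately have "((\<lambda>R. integral {-R..R} \<phi> - f z) \<longlongrightarrow> 0) at_top" by (rule Lim_null_comparison)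
  then show ?thesis unfolding \<phi>_def[abs_def] by (simp add: LIM_zero_iff)
qed

section \<open>Cauchy transforms\<close>

lemma norm_diff_real_ge_Im: "\<bar>Im z\<bar> \<le> norm (z - complex_of_real s)"
  using abs_Im_le_cmod[of "z - complex_of_real s"] by simp

lemma norm_resolvent_le: "Im z \<noteq> 0 \<Longrightarrow> norm (1 / (z - complex_of_real s)) \<le> 1 / \<bar>Im z\<bar>"
  unfolding norm_divide norm_one by (intro divide_left_mono norm_diff_real_ge_Im) (auto simp: complex_eq_iff intro!: mult_pos_pos)

context real_distribution
begin

lemma integrable_resolvent: "Im z \<noteq> 0 \<Longrightarrow> integrable M (\<lambda>s. 1 / (z - complex_of_real s))"
  by (rule integrable_const_bound[of _ "1 / \<bar>Im z\<bar>"]) (use norm_resolvent_le in auto)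

text \<open>The right side is \<pi> times the Poisson integral of the measure.\<close>

lemma Im_cauchy_transform:
  assumes "Im z > 0"
  shows "- Im (cauchy_transform M z) = (\<integral>s. Im z / ((Re z - s)\<^sup>2 + (Im z)\<^sup>2) \<partial>M)"
    and "integrable M (\<lambda>s. Im z / ((Re z - s)\<^sup>2 + (Im z)\<^sup>2))"
proof -
  have e: "Im (1 / (z - complex_of_real s)) = - (Im z / ((Re z - s)\<^sup>2 + (Im z)\<^sup>2))" for s
    by (simp add: Im_divide power2_eq_square)
  have i: "integrable M (\<lambda>s. 1 / (z - complex_of_real s))" using assms by (intro integrable_resolvent) auto
  have "Im (cauchy_transform M z) = (\<integral>s. Im (1 / (z - complex_of_real s)) \<partial>M)"
    unfolding cauchy_transform_def using integral_Im[OF i] by simp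
  then show "- Im (cauchy_transform M z) = (\<integral>s. Im z / ((Re z - s)\<^sup>2 + (Im z)\<^sup>2) \<partial>M)"
    unfolding e by simp
  have "integrable M (\<lambda>s. - Im (1 / (z - complex_of_real s)))"
    by (intro integrable_minus integrable_Im i)
  then show "integrable M (\<lambda>s. Im z / ((Re z - s)\<^sup>2 + (Im z)\<^sup>2))" unfolding e by simp
qed

text \<open>Differentiation under the integral by an explicit remainder: it is \<open>w - z\<close>
  times a kernel bounded by 2 / (Im z)^3, as long as \<open>w\<close> stays within Im z / 2 of
  \<open>z\<close>.\<close>

lemma holomorphic_cauchy_transform: "cauchy_transform M holomorphic_on upper_half_plane"
proof (rule holomorphic_onI)
  fix z :: complex assume "z \<in> upper_half_plane"
  then have z: "Im z > 0" by simp
  define D where "D = (\<integral>s. - 1 / (z - complex_of_real s)\<^sup>2 \<partial>M)"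
  have iD: "integrable M (\<lambda>s. - 1 / (z - complex_of_real s)\<^sup>2)"
  proof (rule integrable_const_bound[of _ "1 / (Im z)\<^sup>2"])
    show "AE s in M. norm (- 1 / (z - complex_of_real s)\<^sup>2) \<le> 1 / (Im z)\<^sup>2"
    proof (rule AE_I2)
      fix s
      have "norm (- 1 / (z - complex_of_real s)\<^sup>2) = (norm (1 / (z - complex_of_real s)))\<^sup>2"
        by (simp add: norm_divide norm_power power_divide)
      also have "\<dots> \<le> (1 / \<bar>Im z\<bar>)\<^sup>2" using norm_resolvent_le[of z s] z by (intro power_mono) auto
      finally show "norm (- 1 / (z - complex_of_real s)\<^sup>2) \<le> 1 / (Im z)\<^sup>2" by (simp add: power_divide)
    qed
  qed auto
  have est: "norm ((cauchy_transform M w - cauchy_transform M z) / (w - z) - D) \<le> 2 / (Im z) ^ 3 * norm (w - z)"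
    if w: "w \<noteq> z" "norm (w - z) < Im z / 2" for w
  proof -
    have Iw: "Im w \<ge> Im z / 2" using abs_Im_le_cmod[of "w - z"] w by auto
    have k: "(1 / (w - complex_of_real s) - 1 / (z - complex_of_real s)) / (w - z) - (- 1 / (z - complex_of_real s)\<^sup>2)
       = (w - z) * (1 / (w - complex_of_real s) * (1 / (z - complex_of_real s))\<^sup>2)" for s
    proof -
      have "w \<noteq> complex_of_real s" "z \<noteq> complex_of_real s" using Iw z by auto
      then have "w - of_real s \<noteq> 0" "z - of_real s \<noteq> 0" "w - z = (w - of_real s) - (z - of_real s)" by auto
      moreover have "(1 / u - 1 / v) / (u - v) - (- 1 / v\<^sup>2) = (u - v) * (1 / u * (1 / v)\<^sup>2)"
        if "u \<noteq> 0" "v \<noteq> 0" "u \<noteq> v" for u v :: complex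
      proof -
        have "(1 / u - 1 / v) = (u - v) * (- 1 / (u * v))" using that by (simp add: field_simps)
        then have "(1 / u - 1 / v) / (u - v) = - 1 / (u * v)"
          using that by (metis nonzero_mult_div_cancel_left right_minus_eq)
        then show ?thesis using that by (simp add: field_simps power2_eq_square)
      qed
      ultimately show ?thesis using w(1) by (metis diff_add_cancel)
    qed
    have iw: "integrable M (\<lambda>s. 1 / (w - complex_of_real s))" "integrable M (\<lambda>s. 1 / (z - complex_of_real s))"
      using Iw z by (auto intro!: integrable_resolvent)
    have "(cauchy_transform M w - cauchy_transform M z) / (w - z) - D
      = (\<integral>s. (1 / (w - complex_of_real s) - 1 / (z - complex_of_real s)) / (w - z) - (- 1 / (z - complex_of_real s)\<^sup>2) \<partial>M)"
      unfolding cauchy_transform_def D_def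
      by (subst Bochner_Integration.integral_diff) (use iw iD in auto)
    also have "\<dots> = (\<integral>s. (w - z) * (1 / (w - complex_of_real s) * (1 / (z - complex_of_real s))\<^sup>2) \<partial>M)"
      unfolding k ..
    also have "norm \<dots> \<le> (\<integral>s. 2 / (Im z) ^ 3 * norm (w - z) \<partial>M)"
    proof (rule Bochner_Integration.integral_norm_bound_integral)
      have b: "norm ((w - z) * (1 / (w - complex_of_real s) * (1 / (z - complex_of_real s))\<^sup>2)) \<le> 2 / (Im z) ^ 3 * norm (w - z)" for s
      proof -
        have "norm (1 / (w - complex_of_real s)) \<le> 1 / \<bar>Im w\<bar>" using Iw z by (intro norm_resolvent_le) auto
        also have "\<dots> \<le> 1 / (Im z / 2)" using Iw z by (intro divide_left_mono) auto
        finally have "norm (1 / (w - complex_of_real s)) \<le> 2 / Im z" by simp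
        moreover have "norm ((1 / (z - complex_of_real s))\<^sup>2) \<le> (1 / Im z)\<^sup>2"
          unfolding norm_power using norm_resolvent_le[of z s] z by (intro power_mono) auto
        ultimately have "norm (1 / (w - complex_of_real s) * (1 / (z - complex_of_real s))\<^sup>2) \<le> 2 / Im z * (1 / Im z)\<^sup>2"
          unfolding norm_mult using z by (intro mult_mono) auto
        then have le: "norm (1 / (w - complex_of_real s) * (1 / (z - complex_of_real s))\<^sup>2) \<le> 2 / (Im z) ^ 3"
          by (simp add: power_divide power2_eq_square power3_eq_cube)
        show ?thesis unfolding norm_mult[of "w - z"]
          by (subst mult.commute) (rule mult_right_mono[OF le norm_ge_zero])
      qed
      show "integrable M (\<lambda>s. (w - z) * (1 / (w - complex_of_real s) * (1 / (z - complex_of_real s))\<^sup>2))"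
        by (rule integrable_const_bound[of _ "2 / (Im z) ^ 3 * norm (w - z)"]) (use b in auto)
      show "\<And>x. x \<in> space M \<Longrightarrow> norm ((w - z) * (1 / (w - complex_of_real x) * (1 / (z - complex_of_real x))\<^sup>2)) \<le> 2 / (Im z) ^ 3 * norm (w - z)"
        using b by blast
    qed auto
    finally show ?thesis using prob_space by simp
  qed
  have "((\<lambda>w. (cauchy_transform M w - cauchy_transform M z) / (w - z) - D) \<longlongrightarrow> 0) (at z)"
  proof (rule Lim_null_comparison)
    show "\<forall>\<^sub>F w in at z. norm ((cauchy_transform M w - cauchy_transform M z) / (w - z) - D) \<le> 2 / (Im z) ^ 3 * norm (w - z)"
      using est z by (auto simp: eventually_at dist_norm intro!: exI[of _ "Im z / 2"])
    have "((\<lambda>w. 2 / (Im z) ^ 3 * norm (w - z)) \<longlongrightarrow> 2 / (Im z) ^ 3 * norm (z - z)) (at z)" by (intro tendsto_intros)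
    then show "((\<lambda>w. 2 / (Im z) ^ 3 * norm (w - z)) \<longlongrightarrow> 0) (at z)" by simp
  qed
  then have "(cauchy_transform M has_field_derivative D) (at z)"
    unfolding has_field_derivative_iff by (simp add: LIM_zero_iff)
  then show "cauchy_transform M field_differentiable at z within upper_half_plane"
    using field_differentiable_def field_differentiable_at_within by blast
qed

text \<open>Multiplied by the distance to the axis, the resolvent is bounded by 1 and tends to the
  indicator of the point, so dominated convergence reads off the mass.\<close>

lemma cauchy_transform_atom:
  assumes Y: "Y \<longlonglongrightarrow> 0" "\<And>n. Y n > (0::real)"
  shows "(\<lambda>n. \<i> * of_real (Y n) * cauchy_transform M (of_real \<xi> + \<i> * of_real (Y n))) \<longlonglongrightarrow> of_real (prob {\<xi>})"
proof -
  define g where "g n s = \<i> * of_real (Y n) / (of_real \<xi> + \<i> * of_real (Y n) - complex_of_real s)" for n s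
  have "(\<lambda>n. \<integral>s. g n s \<partial>M) \<longlonglongrightarrow> (\<integral>s. complex_of_real (indicator {\<xi>} s) \<partial>M)"
  proof (rule integral_dominated_convergence[where w = "\<lambda>_. 1"])
    show "AE s in M. (\<lambda>n. g n s) \<longlonglongrightarrow> complex_of_real (indicator {\<xi>} s)"
    proof (rule AE_I2)
      fix s
      show "(\<lambda>n. g n s) \<longlonglongrightarrow> complex_of_real (indicator {\<xi>} s)"
      proof (cases "s = \<xi>")
        case True
        have "g n s = 1" for n using Y(2)[of n] True by (simp add: g_def)
        then show ?thesis using True by simp
      next
        case False
        have "(\<lambda>n. g n s) \<longlonglongrightarrow> \<i> * of_real 0 / (of_real \<xi> + \<i> * of_real 0 - complex_of_real s)"
          unfolding g_def by (intro tendsto_intros Y) (use False in auto)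
        then show ?thesis using False by simp
      qed
    qed
    show "AE s in M. norm (g n s) \<le> 1" for n
    proof (rule AE_I2)
      fix s
      have "\<bar>Y n\<bar> \<le> norm (of_real \<xi> + \<i> * of_real (Y n) - complex_of_real s)"
        using abs_Im_le_cmod[of "of_real \<xi> + \<i> * of_real (Y n) - complex_of_real s"] by simp
      then show "norm (g n s) \<le> 1" using Y(2)[of n] unfolding g_def norm_divide
        by (subst divide_le_eq_1_pos) (auto simp: norm_mult)
    qed
  qed (auto simp: g_def)
  moreover have "(\<integral>s. g n s \<partial>M) = \<i> * of_real (Y n) * cauchy_transform M (of_real \<xi> + \<i> * of_real (Y n))" for n
    unfolding cauchy_transform_def integral_mult_right_zero[symmetric] by (simp add: g_def)
  moreover have "(\<integral>s. complex_of_real (indicator {\<xi>} s) \<partial>M) = of_real (prob {\<xi>})"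
    unfolding integral_of_real by simp
  ultimately show ?thesis by simp
qed

text \<open>The Poisson kernel has an arctangent as primitive in \<open>x\<close>. Nonnegative
  integrals are used so that exchanging the integrations requires only measurability.\<close>

lemma stieltjes_nn_integral:
  assumes y: "y > 0" and ab: "a \<le> b"
  shows "(\<integral>\<^sup>+x. ennreal (- Im (cauchy_transform M (of_real x + \<i> * of_real y))) * indicator {a..b} x \<partial>lborel)
    = ennreal (\<integral>s. arctan ((b - s) / y) - arctan ((a - s) / y) \<partial>M)"
proof -
  define P where "P x s = y / ((x - s)\<^sup>2 + y\<^sup>2)" for x s
  have P0: "P x s \<ge> 0" for x s using y by (simp add: P_def)
  have e: "ennreal (- Im (cauchy_transform M (of_real x + \<i> * of_real y))) = (\<integral>\<^sup>+s. ennreal (P x s) \<partial>M)" for x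
  proof -
    have "Im (of_real x + \<i> * of_real y) > 0" using y by simp
    from Im_cauchy_transform[OF this] show ?thesis
      using P0 by (simp add: nn_integral_eq_integral P_def)
  qed
  interpret lM: pair_sigma_finite lborel M
    by (intro pair_sigma_finite.intro sigma_finite_lborel prob_space_imp_sigma_finite prob_space_axioms)
  have "(\<integral>\<^sup>+x. (\<integral>\<^sup>+s. ennreal (P x s) \<partial>M) * indicator {a..b} x \<partial>lborel)
      = (\<integral>\<^sup>+x. (\<integral>\<^sup>+s. ennreal (P x s) * indicator {a..b} x \<partial>M) \<partial>lborel)"
    by (intro nn_integral_cong nn_integral_multc[symmetric]) (auto simp: P_def)
  also have "\<dots> = (\<integral>\<^sup>+s. (\<integral>\<^sup>+x. ennreal (P x s) * indicator {a..b} x \<partial>lborel) \<partial>M)"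
    by (rule lM.Fubini'[symmetric]) (auto simp: P_def)
  also have "\<dots> = (\<integral>\<^sup>+s. ennreal (arctan ((b - s) / y) - arctan ((a - s) / y)) \<partial>M)"
  proof (intro nn_integral_cong nn_integral_FTC_Icc ab)
    fix s x
    have "((\<lambda>x. arctan ((x - s) / y)) has_real_derivative (1 / y) / (1 + ((x - s) / y)\<^sup>2)) (at x)"
      by (auto intro!: derivative_eq_intros simp: divide_inverse)
    moreover have "(1 / y) / (1 + ((x - s) / y)\<^sup>2) = P x s"
    proof -
      have "1 + ((x - s) / y)\<^sup>2 = ((x - s)\<^sup>2 + y\<^sup>2) / y\<^sup>2" using y by (simp add: field_simps)
      then show ?thesis using y by (simp add: P_def power2_eq_square)
    qed
    ultimately show "((\<lambda>x. arctan ((x - s) / y)) has_real_derivative P x s) (at x)" by simp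
  qed (auto simp: P_def y less_imp_le)
  also have "\<dots> = ennreal (\<integral>s. arctan ((b - s) / y) - arctan ((a - s) / y) \<partial>M)"
  proof (rule nn_integral_eq_integral)
    show "integrable M (\<lambda>s. arctan ((b - s) / y) - arctan ((a - s) / y))"
    proof (rule integrable_const_bound[of _ "pi"])
      have "\<bar>arctan u - arctan v\<bar> \<le> pi" for u v
        using arctan_bounded[of u] arctan_bounded[of v] by linarith
      then show "AE s in M. norm (arctan ((b - s) / y) - arctan ((a - s) / y)) \<le> pi" by simp
    qed measurable
    show "AE s in M. 0 \<le> arctan ((b - s) / y) - arctan ((a - s) / y)"
      using ab y by (simp add: arctan_le_iff divide_right_mono)
  qed
  finally show ?thesis unfolding e .
qed

end

section \<open>Stieltjes inversion\<close>

lemma tendsto_arctan_sgn: "(\<lambda>n. arctan (c * real (Suc n))) \<longlonglongrightarrow> pi / 2 * sgn c"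
proof -
  have pos: "(\<lambda>n. arctan (c * real (Suc n))) \<longlonglongrightarrow> pi / 2" if "c > 0" for c
    using that by real_asymp
  consider "c > 0" | "c = 0" | "c < 0" by linarith
  then show ?thesis
  proof cases
    case 3
    then have "(\<lambda>n. - arctan (- c * real (Suc n))) \<longlonglongrightarrow> - (pi / 2)" by (intro tendsto_minus pos) simp
    then show ?thesis using 3 by (simp add: arctan_minus)
  qed (use pos in auto)
qed

text \<open>The distribution function is recovered by three limits, each applied to both measures
  under dominated convergence.\<close>

theorem cauchy_transform_inj:
  assumes "real_distribution M" "real_distribution N"
    and eq: "\<And>z. Im z > 0 \<Longrightarrow> cauchy_transform M z = cauchy_transform N z"
  shows "M = N"
proof (rule cdf_unique[OF assms(1,2)], rule ext)
  interpret M: real_distribution M by fact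
  interpret N: real_distribution N by fact
  have int1: "(\<integral>s. arctan ((b - s) * real (Suc n)) - arctan ((a - s) * real (Suc n)) \<partial>M) = (\<integral>s. arctan ((b - s) * real (Suc n)) - arctan ((a - s) * real (Suc n)) \<partial>N)"
    if ab: "a \<le> b" for a b n
  proof -
    have y: "1 / real (Suc n) > 0" by simp
    have nn: "0 \<le> (\<integral>s. arctan ((b - s) / (1 / real (Suc n))) - arctan ((a - s) / (1 / real (Suc n))) \<partial>L)" for L :: "real measure"
      by (rule integral_nonneg_AE) (use ab in \<open>simp add: arctan_le_iff mult_right_mono\<close>)
    have c: "cauchy_transform M (of_real x + \<i> * of_real (1 / real (Suc n))) = cauchy_transform N (of_real x + \<i> * of_real (1 / real (Suc n)))" for x
      by (rule eq) simp
    have "(\<integral>s. arctan ((b - s) / (1 / real (Suc n))) - arctan ((a - s) / (1 / real (Suc n))) \<partial>M)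
      = (\<integral>s. arctan ((b - s) / (1 / real (Suc n))) - arctan ((a - s) / (1 / real (Suc n))) \<partial>N)"
      using trans[OF M.stieltjes_nn_integral[OF y ab, unfolded c, symmetric] N.stieltjes_nn_integral[OF y ab]]
        ennreal_inj[OF nn nn] by blast
    then show ?thesis by simp
  qed
  \<comment> \<open>Letting the height tend to zero turns arctangents into signs. Since the sign of
    0 is 0, atoms at the endpoints of the interval count with half their mass.\<close>
  have lim1: "(\<lambda>n. \<integral>s. arctan ((b - s) * real (Suc n)) - arctan ((a - s) * real (Suc n)) \<partial>L)
      \<longlonglongrightarrow> (\<integral>s. pi / 2 * sgn (b - s) - pi / 2 * sgn (a - s) \<partial>L)" if "real_distribution L" for L a b
  proof -
    interpret real_distribution L by fact
    show ?thesis
    proof (rule integral_dominated_convergence[where w = "\<lambda>_. pi"])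
      have "\<bar>arctan u - arctan v\<bar> \<le> pi" for u v
        using arctan_bounded[of u] arctan_bounded[of v] by linarith
      then show "AE s in L. norm (arctan ((b - s) * real (Suc n)) - arctan ((a - s) * real (Suc n))) \<le> pi" for n by simp
      show "AE s in L. (\<lambda>n. arctan ((b - s) * real (Suc n)) - arctan ((a - s) * real (Suc n))) \<longlonglongrightarrow> pi / 2 * sgn (b - s) - pi / 2 * sgn (a - s)"
        by (intro AE_I2 tendsto_diff tendsto_arctan_sgn)
    qed auto
  qed
  have int2: "(\<integral>s. pi / 2 * sgn (b - s) - pi / 2 * sgn (a - s) \<partial>M) = (\<integral>s. pi / 2 * sgn (b - s) - pi / 2 * sgn (a - s) \<partial>N)"
    if "a \<le> b" for a b
    using LIMSEQ_unique[OF lim1[OF assms(1)]] lim1[OF assms(2)] int1[OF that] by simp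
  \<comment> \<open>The lower endpoint moves to minus infinity.\<close>
  have lim2: "(\<lambda>n. \<integral>s. pi / 2 * sgn (b - s) - pi / 2 * sgn (b - real n - s) \<partial>L)
      \<longlonglongrightarrow> (\<integral>s. pi / 2 * sgn (b - s) - pi / 2 * (-1) \<partial>L)" if "real_distribution L" for L b
  proof -
    interpret real_distribution L by fact
    show ?thesis
    proof (rule integral_dominated_convergence[where w = "\<lambda>_. pi"])
      have "\<bar>pi / 2 * sgn u - pi / 2 * sgn v\<bar> \<le> pi" for u v :: real by (auto simp: sgn_if)
      then show "AE s in L. norm (pi / 2 * sgn (b - s) - pi / 2 * sgn (b - real n - s)) \<le> pi" for n by simp
      have "(\<lambda>n. sgn (b - real n - s)) \<longlonglongrightarrow> -1" for s
      proof (rule tendsto_eventually)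
        show "\<forall>\<^sub>F n in sequentially. sgn (b - real n - s) = -1"
          using eventually_gt_at_top[of "nat \<lceil>\<bar>b - s\<bar>\<rceil>"] by eventually_elim (auto simp: sgn_if nat_less_iff ceiling_less_iff abs_if split: if_splits; linarith)
      qed
      then show "AE s in L. (\<lambda>n. pi / 2 * sgn (b - s) - pi / 2 * sgn (b - real n - s)) \<longlonglongrightarrow> pi / 2 * sgn (b - s) - pi / 2 * (-1)"
        by (intro AE_I2 tendsto_intros)
    qed auto
  qed
  have int3: "(\<integral>s. pi / 2 * sgn (b - s) - pi / 2 * (-1) \<partial>M) = (\<integral>s. pi / 2 * sgn (b - s) - pi / 2 * (-1) \<partial>N)" for b
    using LIMSEQ_unique[OF lim2[OF assms(1)]] lim2[OF assms(2)] int2[of "b - real _" b] by simp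
  \<comment> \<open>Approaching \<open>b\<close> from the right removes the half weight at the
    endpoint and gives the closed half-line of the distribution function.\<close>
  have lim3: "(\<lambda>n. \<integral>s. pi / 2 * sgn (b + 1 / real (Suc n) - s) - pi / 2 * (-1) \<partial>L)
      \<longlonglongrightarrow> (\<integral>s. pi * indicator {..b} s \<partial>L)" if "real_distribution L" for L b
  proof -
    interpret real_distribution L by fact
    show ?thesis
    proof (rule integral_dominated_convergence[where w = "\<lambda>_. pi"])
      have "\<bar>pi / 2 * sgn u - pi / 2 * (-1)\<bar> \<le> pi" for u :: real by (auto simp: sgn_if)
      then show "AE s in L. norm (pi / 2 * sgn (b + 1 / real (Suc n) - s) - pi / 2 * (-1)) \<le> pi" for n by simp
      have "(\<lambda>n. sgn (b + 1 / real (Suc n) - s)) \<longlonglongrightarrow> 2 * indicator {..b} s - 1" for s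
      proof (cases "s \<le> b")
        case True
        then have "sgn (b + 1 / real (Suc n) - s) = 1" for n
          using zero_less_divide_1_iff[of "real (Suc n)"] by (smt (verit) of_nat_0_less_iff sgn_pos zero_less_Suc)
        then show ?thesis using True by simp
      next
        case False
        have "(\<lambda>n. b + 1 / real (Suc n) - s) \<longlonglongrightarrow> b + 0 - s" by (intro tendsto_intros LIMSEQ_Suc[OF lim_1_over_n])
        then have "(\<lambda>n. sgn (b + 1 / real (Suc n) - s)) \<longlonglongrightarrow> sgn (b + 0 - s)" by (rule tendsto_sgn) (use False in simp)
        then show ?thesis using False by simp
      qed
      then have "(\<lambda>n. pi / 2 * sgn (b + 1 / real (Suc n) - s) - pi / 2 * (-1)) \<longlonglongrightarrow> pi / 2 * (2 * indicator {..b} s - 1) - pi / 2 * (-1)" for s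
        by (intro tendsto_intros)
      then show "AE s in L. (\<lambda>n. pi / 2 * sgn (b + 1 / real (Suc n) - s) - pi / 2 * (-1)) \<longlonglongrightarrow> pi * indicator {..b} s"
        by (intro AE_I2) (simp add: algebra_simps)
    qed auto
  qed
  fix b
  have "(\<integral>s. pi * indicator {..b} s \<partial>M) = (\<integral>s. pi * indicator {..b} s \<partial>N)"
    by (rule LIMSEQ_unique[OF lim3[OF assms(1), of b, unfolded int3] lim3[OF assms(2)]])
  then show "cdf M b = cdf N b" by (simp add: cdf_def)
qed

section \<open>The Nevanlinna representation\<close>

text \<open>After the shift the function is holomorphic across the real axis, so the candidate
  measure has the continuous positive density \<open>h\<close> and the half-plane representation
  applies. What remains is that this density has total mass 1.\<close>

lemma nevanlinna_shift:
  fixes G :: "complex \<Rightarrow> complex" and e c :: real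
  assumes hol: "G holomorphic_on upper_half_plane" and neg: "\<And>z. Im z > 0 \<Longrightarrow> Im (G z) < 0"
    and e: "e > 0" and c: "\<And>z. Im z \<ge> e \<Longrightarrow> norm (1 / G z - z) \<le> c"
  obtains N where "real_distribution N" "\<And>z. Im z > 0 \<Longrightarrow> cauchy_transform N z = G (z + \<i> * of_real e)"
proof -
  define f where "f w = G (w + \<i> * of_real e)" for w
  define h where "h x = - Im (f (of_real x)) / pi" for x
  have c0: "c \<ge> 0" using c[of "\<i> * of_real e"] by (simp add: order_trans[OF norm_ge_zero])
  have holf: "f holomorphic_on {z. Im z > - e}"
  proof -
    have "(G \<circ> (\<lambda>w. w + \<i> * of_real e)) holomorphic_on {z. Im z > - e}"
      by (rule holomorphic_on_compose_gen[OF _ hol]) (auto intro!: holomorphic_intros)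
    then show ?thesis by (simp add: f_def[abs_def] comp_def)
  qed
  have fnz: "f w \<noteq> 0" if "Im w \<ge> 0" for w using neg[of "w + \<i> * of_real e"] that e by (auto simp: f_def)
  have Fd: "norm (1 / f w - w) \<le> c + e" if "Im w \<ge> 0" for w
  proof -
    have "norm (1 / f w - w) \<le> norm (1 / f w - (w + \<i> * of_real e)) + norm (\<i> * of_real e)"
      using norm_triangle_ineq[of "1 / f w - (w + \<i> * of_real e)" "\<i> * of_real e"] by simp
    then show ?thesis using c[of "w + \<i> * of_real e"] that e by (simp add: f_def norm_mult)
  qed
  \<comment> \<open>Beyond this radius the deviation \<open>c + e\<close> is less than half of the
    modulus of \<open>w\<close>, so the reciprocal of \<open>f w\<close> has modulus at least half
    of that of \<open>w\<close>.\<close>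
  define B where "B = 2 * (c + e) + 1"
  have dec: "norm (f w) \<le> 2 / norm w" if w: "Im w \<ge> 0" "norm w \<ge> B" for w
  proof -
    have p: "norm w > 0" "norm (f w) > 0" using w e c0 fnz by (auto simp: B_def)
    have "norm w - norm (1 / f w) \<le> c + e" using Fd[OF w(1)] norm_triangle_ineq3[of "1 / f w" w] by linarith
    then have "norm w / 2 \<le> norm (1 / f w)" using w by (simp add: B_def)
    then show ?thesis using p by (simp add: norm_divide field_simps)
  qed
  have h0: "h x > 0" for x using neg[of "of_real x + \<i> * of_real e"] e by (simp add: h_def f_def divide_neg_pos)
  have conth: "continuous_on S h" for S
  proof -
    have "continuous_on S (f \<circ> of_real)"
      by (intro continuous_on_compose continuous_intros continuous_on_subset[OF holomorphic_on_imp_continuous_on[OF holf]]) (use e in auto)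
    then show ?thesis unfolding h_def by (auto intro!: continuous_intros simp: comp_def)
  qed
  have hm [measurable]: "h \<in> borel_measurable borel" by (rule borel_measurable_continuous_onI[OF conth])
  have si: "set_integrable lborel {-R..R} g" if "continuous_on {-R..R} g" for R :: real and g :: "real \<Rightarrow> 'b::euclidean_space"
    using borel_integrable_compact[OF compact_Icc that] by (simp add: set_integrable_def)
  define \<phi> where "\<phi> z x = complex_of_real (h x) / (z - of_real x)" for z x
  have \<phi>c: "continuous_on S (\<phi> z)" if "Im z > 0" for z S
    unfolding \<phi>_def by (intro continuous_intros conth) (use that in auto)
  have limA: "((\<lambda>R. LINT x:{-R..R}|lborel. \<phi> z x) \<longlongrightarrow> f z) at_top" if "Im z > 0" for z
  proof -
    have "(LINT x:{-R..R}|lborel. \<phi> z x) = integral {-R..R} (\<phi> z)" for R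
      by (rule set_borel_integral_eq_integral(2)[OF si[OF \<phi>c[OF that]]])
    then show ?thesis
      using half_plane_representation[OF e holf dec that] by (simp add: \<phi>_def[abs_def] h_def)
  qed
  define p where "p y x = h x * (y / (x\<^sup>2 + y\<^sup>2))" for y x
  have pc: "continuous_on S (p y)" if "y > 0" for y S
    unfolding p_def by (intro continuous_intros conth) (use that in \<open>auto simp: add_nonneg_eq_0_iff\<close>)
  have limB: "((\<lambda>R. LINT x:{-R..R}|lborel. p y x) \<longlongrightarrow> - Im (f (\<i> * of_real y))) at_top" if y: "y > 0" for y
  proof -
    have "((\<lambda>R. - Im (LINT x:{-R..R}|lborel. \<phi> (\<i> * of_real y) x)) \<longlongrightarrow> - Im (f (\<i> * of_real y))) at_top"
      by (intro tendsto_intros limA) (use y in auto)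
    moreover have "- Im (LINT x:{-R..R}|lborel. \<phi> (\<i> * of_real y) x) = (LINT x:{-R..R}|lborel. p y x)" for R
    proof -
      have i: "integrable lborel (\<lambda>x. indicator {-R..R} x *\<^sub>R \<phi> (\<i> * of_real y) x)"
        using si[OF \<phi>c[of "\<i> * of_real y"]] y by (simp add: set_integrable_def)
      have e: "- Im (indicator {-R..R} x *\<^sub>R \<phi> (\<i> * of_real y) x) = indicator {-R..R} x *\<^sub>R p y x" for x
        by (simp add: \<phi>_def p_def Im_divide power2_eq_square)
      show ?thesis unfolding set_lebesgue_integral_def integral_Im[OF i, symmetric] integral_minus[symmetric] e ..
    qed
    ultimately show ?thesis by simp
  qed
  \<comment> \<open>So far the integrals over the whole line are known only as limits of
    truncations. For nonnegative integrands the truncations increase, so each is bounded by the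
    limit.\<close>
  have monoR: "(LINT x:{-R..R}|lborel. g x) \<le> (LINT x:{-R'..R'}|lborel. g x)"
    if "R \<le> R'" "\<And>S. continuous_on S g" "\<And>x. g x \<ge> 0" for R R' :: real and g :: "real \<Rightarrow> real"
    unfolding set_lebesgue_integral_def
  proof (rule integral_mono)
    show "integrable lborel (\<lambda>x. indicator {-R..R} x *\<^sub>R g x)" "integrable lborel (\<lambda>x. indicator {-R'..R'} x *\<^sub>R g x)"
      using si[OF that(2), of R] si[OF that(2), of R'] by (simp_all only: set_integrable_def)
    show "indicator {-R..R} x *\<^sub>R g x \<le> indicator {-R'..R'} x *\<^sub>R g x" for x
      using that(1,3) by (auto simp: indicator_def)
  qed
  have leC: "(LINT x:{-R..R}|lborel. p y x) \<le> - Im (f (\<i> * of_real y))" if y: "y > 0" for y R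
  proof (rule tendsto_lowerbound[OF limB[OF y]])
    show "\<forall>\<^sub>F R' in at_top. (LINT x:{-R..R}|lborel. p y x) \<le> (LINT x:{-R'..R'}|lborel. p y x)"
      using eventually_ge_at_top[of R]
    proof eventually_elim
      case (elim R')
      show ?case
        by (rule monoR[OF elim pc[OF y]]) (use h0 y in \<open>simp add: p_def less_imp_le\<close>)
    qed
  qed simp
  \<comment> \<open>The behaviour along the imaginary axis encodes the total mass; the two bounds
    \<open>le1\<close> and \<open>ge1\<close> are read off from it.\<close>
  have lim1: "((\<lambda>y. y * (- Im (f (\<i> * of_real y)))) \<longlongrightarrow> 1) at_top"
  proof -
    have "\<forall>\<^sub>F y in at_top. norm (y * (- Im (f (\<i> * of_real y))) - 1) \<le> 2 * (c + e) / y"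
      using eventually_gt_at_top[of B]
    proof eventually_elim
      case (elim y)
      then have y: "y > 0" using c0 e by (simp add: B_def)
      let ?w = "\<i> * of_real y"
      have "?w * f ?w - 1 = f ?w * (?w - 1 / f ?w)" using fnz[of ?w] y by (simp add: field_simps)
      then have "norm (?w * f ?w - 1) = norm (f ?w) * norm (1 / f ?w - ?w)" by (simp add: norm_mult norm_minus_commute)
      also have "\<dots> \<le> 2 / norm ?w * (c + e)" using dec[of ?w] Fd[of ?w] y elim by (intro mult_mono) (auto simp: norm_mult)
      finally have "norm (?w * f ?w - 1) \<le> 2 * (c + e) / y" using y by (simp add: norm_mult)
      then show ?case using abs_Re_le_cmod[of "?w * f ?w - 1"] by simp
    qed
    moreover have "((\<lambda>y. 2 * (c + e) / y) \<longlongrightarrow> 0) at_top" by real_asymp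
    ultimately have "((\<lambda>y. y * (- Im (f (\<i> * of_real y))) - 1) \<longlongrightarrow> 0) at_top" by (rule Lim_null_comparison)
    then show ?thesis by (simp add: LIM_zero_iff)
  qed
  \<comment> \<open>On the interval the kernel is smallest at the endpoints, so the truncated mass
    is at most (1 + R^2 / y^2) times a quantity tending to 1 as \<open>y\<close> grows with
    \<open>R\<close> fixed.\<close>
  have massD: "(LINT x:{-R..R}|lborel. h x) \<le> 1" if R: "R > 0" for R
  proof (rule tendsto_lowerbound)
    have "((\<lambda>y. (1 + R\<^sup>2 / y\<^sup>2) * (y * (- Im (f (\<i> * of_real y))))) \<longlongrightarrow> 1 * 1) at_top"
      by (intro tendsto_mult lim1) real_asymp
    then show "((\<lambda>y. (1 + R\<^sup>2 / y\<^sup>2) * (y * (- Im (f (\<i> * of_real y))))) \<longlongrightarrow> 1) at_top" by simp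
    show "\<forall>\<^sub>F y in at_top. (LINT x:{-R..R}|lborel. h x) \<le> (1 + R\<^sup>2 / y\<^sup>2) * (y * (- Im (f (\<i> * of_real y))))"
      using eventually_gt_at_top[of 0]
    proof eventually_elim
      case (elim y)
      have "y / (R\<^sup>2 + y\<^sup>2) * (LINT x:{-R..R}|lborel. h x) = (LINT x:{-R..R}|lborel. y / (R\<^sup>2 + y\<^sup>2) * h x)"
        by (simp add: set_integral_mult_right)
      also have "\<dots> \<le> (LINT x:{-R..R}|lborel. p y x)"
      proof (rule set_integral_mono)
        show "set_integrable lborel {-R..R} (\<lambda>x. y / (R\<^sup>2 + y\<^sup>2) * h x)" "set_integrable lborel {-R..R} (p y)"
          by (rule si; intro continuous_intros conth pc elim)+
        fix x assume "x \<in> {-R..R}"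
        then have "x\<^sup>2 \<le> R\<^sup>2" by (intro power2_le_iff_abs_le[THEN iffD2]) auto
        then have "y / (R\<^sup>2 + y\<^sup>2) \<le> y / (x\<^sup>2 + y\<^sup>2)" using elim by (intro divide_left_mono) (auto intro!: mult_pos_pos add_nonneg_pos)
        then show "y / (R\<^sup>2 + y\<^sup>2) * h x \<le> p y x"
          using mult_left_mono[OF _ less_imp_le[OF h0[of x]]] by (simp only: p_def mult.commute[of _ "h x"])
      qed
      also have "\<dots> \<le> - Im (f (\<i> * of_real y))" by (rule leC[OF elim])
      finally have "y / (R\<^sup>2 + y\<^sup>2) * (LINT x:{-R..R}|lborel. h x) \<le> - Im (f (\<i> * of_real y))" .
      then have "(LINT x:{-R..R}|lborel. h x) \<le> (R\<^sup>2 + y\<^sup>2) / y * (- Im (f (\<i> * of_real y)))"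
        using elim by (simp add: field_simps add_nonneg_pos)
      also have "(R\<^sup>2 + y\<^sup>2) / y = (1 + R\<^sup>2 / y\<^sup>2) * y" using elim by (simp add: field_simps power2_eq_square)
      finally show ?case by (simp add: mult.assoc)
    qed
  qed simp
  define N where "N = density lborel (\<lambda>x. ennreal (h x))"
  have sN [simp, measurable_cong]: "sets N = sets borel" and spN [simp]: "space N = UNIV" by (simp_all add: N_def)
  have emN: "emeasure N {-R..R} = ennreal (LINT x:{-R..R}|lborel. h x)" for R
  proof -
    have "emeasure N {-R..R} = (\<integral>\<^sup>+x. ennreal (indicator {-R..R} x *\<^sub>R h x) \<partial>lborel)"
      unfolding N_def by (subst emeasure_density) (auto intro!: nn_integral_cong simp: indicator_def)
    also have "\<dots> = ennreal (LINT x:{-R..R}|lborel. h x)" unfolding set_lebesgue_integral_def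
      by (rule nn_integral_eq_integral) (use si[OF conth] h0 in \<open>auto simp: set_integrable_def less_imp_le\<close>)
    finally show ?thesis .
  qed
  have un: "(\<Union>n. {- real (Suc n)..real (Suc n)}) = UNIV"
  proof (intro equalityI subsetI UNIV_I UN_I)
    fix x :: real
    have "\<bar>x\<bar> \<le> real (nat \<lceil>\<bar>x\<bar>\<rceil>)" by (rule real_nat_ceiling_ge)
    then show "x \<in> {- real (Suc (nat \<lceil>\<bar>x\<bar>\<rceil>))..real (Suc (nat \<lceil>\<bar>x\<bar>\<rceil>))}"
      by (simp only: atLeastAtMost_iff of_nat_Suc) linarith
  qed
  have limN: "(\<lambda>n. emeasure N {- real (Suc n)..real (Suc n)}) \<longlonglongrightarrow> emeasure N UNIV"
    unfolding un[symmetric] by (rule Lim_emeasure_incseq) (auto simp: incseq_def)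
  have le1: "emeasure N UNIV \<le> 1"
  proof (rule LIMSEQ_le_const2[OF limN])
    have "emeasure N {- real (Suc n)..real (Suc n)} \<le> 1" for n
      unfolding emN ennreal_le_1 by (rule massD) simp
    then show "\<exists>K. \<forall>n\<ge>K. emeasure N {- real (Suc n)..real (Suc n)} \<le> 1" by blast
  qed
  have inth: "integrable lborel h"
  proof (rule integrableI_nonneg)
    have "(\<integral>\<^sup>+x. ennreal (h x) \<partial>lborel) = emeasure N UNIV" unfolding N_def by (subst emeasure_density) auto
    then show "(\<integral>\<^sup>+x. ennreal (h x) \<partial>lborel) < \<infinity>" using le1 by (simp add: le_less_trans)
  qed (use h0 in \<open>auto simp: less_imp_le\<close>)
  have full: "(\<lambda>n. LINT x:{- real (Suc n)..real (Suc n)}|lborel. g x) \<longlonglongrightarrow> (LINT x|lborel. g x)"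
    if "integrable lborel g" for g :: "real \<Rightarrow> complex"
    unfolding set_lebesgue_integral_def
  proof (rule integral_dominated_convergence[where w = "\<lambda>x. norm (g x)"])
    show "AE x in lborel. (\<lambda>n. indicator {- real (Suc n)..real (Suc n)} x *\<^sub>R g x) \<longlonglongrightarrow> g x"
    proof (intro AE_I2 tendsto_eventually)
      fix x :: real
      show "\<forall>\<^sub>F n in sequentially. indicator {- real (Suc n)..real (Suc n)} x *\<^sub>R g x = g x"
        using eventually_ge_at_top[of "nat \<lceil>\<bar>x\<bar>\<rceil>"]
      proof eventually_elim
        case (elim n)
        then have "\<bar>x\<bar> \<le> real n" using real_nat_ceiling_ge[of "\<bar>x\<bar>"] by linarith
        then have "x \<in> {- real (Suc n)..real (Suc n)}" by auto
        then show ?case by simp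
      qed
    qed
  qed (use that in \<open>auto simp: indicator_def\<close>)
  have ct: "cauchy_transform N z = f z" if z: "Im z > 0" for z
  proof -
    have b: "norm (\<phi> z x) \<le> norm (h x / Im z)" for x
    proof -
      have "\<bar>Im z\<bar> \<le> norm (z - of_real x)" using abs_Im_le_cmod[of "z - of_real x"] by simp
      then show ?thesis using h0[of x] z by (simp add: \<phi>_def norm_divide frac_le)
    qed
    have i: "integrable lborel (\<phi> z)"
      by (rule Bochner_Integration.integrable_bound[of _ "\<lambda>x. h x / Im z"])
        (use inth b in \<open>auto intro!: borel_measurable_continuous_onI \<phi>c z\<close>)
    have "cauchy_transform N z = (LINT x|lborel. h x *\<^sub>R (1 / (z - complex_of_real x)))"
      unfolding cauchy_transform_def N_def by (rule integral_density) (use h0 in \<open>auto simp: less_imp_le\<close>)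
    also have "\<dots> = (LINT x|lborel. \<phi> z x)" by (simp add: \<phi>_def scaleR_conv_of_real)
    also have "\<dots> = f z"
    proof (rule LIMSEQ_unique[OF full[OF i]])
      have "filterlim (\<lambda>n. real (Suc n)) at_top sequentially"
        by real_asymp
      from filterlim_compose[OF limA[OF z] this]
      show "(\<lambda>n. LINT x:{- real (Suc n)..real (Suc n)}|lborel. \<phi> z x) \<longlonglongrightarrow> f z" .
    qed
    finally show ?thesis .
  qed
  have fin: "finite_measure N" by (rule finite_measureI) (use le1 in \<open>auto simp: top_unique\<close>)
  \<comment> \<open>Conversely, y^2 / (x^2 + y^2) is at most 1, so every value of the expression in
    \<open>lim1\<close> is at most the total mass.\<close>
  have ge1: "measure N UNIV \<ge> 1"
  proof (rule tendsto_upperbound[OF lim1])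
    show "\<forall>\<^sub>F y in at_top. y * - Im (f (\<i> * complex_of_real y)) \<le> measure N UNIV"
      using eventually_gt_at_top[of 0]
    proof eventually_elim
      case (elim y)
      have "y * (LINT x:{-R..R}|lborel. p y x) \<le> measure N UNIV" for R
      proof -
        have "y * (LINT x:{-R..R}|lborel. p y x) = (LINT x:{-R..R}|lborel. y * p y x)" by (simp add: set_integral_mult_right)
        also have "\<dots> \<le> (LINT x:{-R..R}|lborel. h x)"
        proof (rule set_integral_mono)
          show "set_integrable lborel {-R..R} (\<lambda>x. y * p y x)" "set_integrable lborel {-R..R} h"
            by (rule si; intro continuous_intros conth pc elim)+
          fix x
          have "y * (y / (x\<^sup>2 + y\<^sup>2)) \<le> 1" using elim by (simp add: divide_le_eq_1_pos add_nonneg_pos power2_eq_square)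
          then have "h x * (y * (y / (x\<^sup>2 + y\<^sup>2))) \<le> h x * 1" using h0[of x] by (intro mult_left_mono) auto
          then show "y * p y x \<le> h x" by (simp add: p_def mult_ac)
        qed
        also have "\<dots> = measure N {-R..R}"
          unfolding measure_def emN
          by (subst enn2real_ennreal) (auto intro!: integral_nonneg_AE simp: set_lebesgue_integral_def less_imp_le[OF h0])
        also have "\<dots> \<le> measure N UNIV" by (intro finite_measure.finite_measure_mono[OF fin]) auto
        finally show ?thesis .
      qed
      then show ?case
        by (intro tendsto_upperbound[OF tendsto_mult_left[OF limB[OF elim]]]) auto
    qed
  qed simp
  have "emeasure N UNIV = 1"
  proof (rule antisym[OF le1])
    show "1 \<le> emeasure N UNIV" using ge1 finite_measure.emeasure_eq_measure[OF fin, of UNIV] by simp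
  qed
  then have "prob_space N" by (intro prob_spaceI) simp
  then have "real_distribution N" by (simp add: real_distribution_def real_distribution_axioms_def)
  then show ?thesis using that ct by (simp add: f_def)
qed

text \<open>The representing measures of the shifts \<open>G(\<cdot> + i \<epsilon>)\<close> are tight, and their weak limit
  represents \<open>G\<close>.\<close>

theorem nevanlinna:
  fixes G :: "complex \<Rightarrow> complex"
  assumes hol: "G holomorphic_on upper_half_plane" and neg: "\<And>z. Im z > 0 \<Longrightarrow> Im (G z) < 0"
    and c: "\<And>d. d > 0 \<Longrightarrow> \<exists>c. \<forall>z. Im z \<ge> d \<longrightarrow> norm (1 / G z - z) \<le> c"
  obtains N where "real_distribution N" "\<And>z. Im z > 0 \<Longrightarrow> cauchy_transform N z = G z"
proof -
  define e where "e n = 1 / real (Suc n)" for n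
  have e: "e n > 0" "e n \<le> 1" for n by (auto simp: e_def)
  have "\<exists>N. real_distribution N \<and> (\<forall>z. Im z > 0 \<longrightarrow> cauchy_transform N z = G (z + \<i> * of_real (e n)))" for n
  proof -
    obtain c where "\<And>z. Im z \<ge> e n \<Longrightarrow> norm (1 / G z - z) \<le> c" using c[OF e(1)] by blast
    then show ?thesis by (metis nevanlinna_shift[OF hol neg e(1)])
  qed
  then obtain N where rd: "\<And>n. real_distribution (N n)"
    and ct: "\<And>n z. Im z > 0 \<Longrightarrow> cauchy_transform (N n) z = G (z + \<i> * of_real (e n))" by metis
  \<comment> \<open>At height 1 a single constant serves all the shifts, since shifting only raises
    the point. This gives the uniformity in \<open>n\<close> behind tightness.\<close>
  obtain c where c: "\<And>z. Im z \<ge> 1 \<Longrightarrow> norm (1 / G z - z) \<le> c" using c[of 1] by auto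
  have c0: "c \<ge> 0" using c[of \<i>] by (simp add: order_trans[OF norm_ge_zero])
  have tail: "1 - y * (- Im (G (\<i> * of_real y + \<i> * of_real (e n)))) \<le> 2 * (c + 1) / y" if y: "y > 2 * c + 1" for y n
  proof -
    let ?w = "\<i> * of_real y" and ?g = "G (\<i> * of_real y + \<i> * of_real (e n))"
    have y1: "y > 0" "y > 1" using y c0 by auto
    have gnz: "?g \<noteq> 0" using neg[of "?w + \<i> * of_real (e n)"] y1 e[of n] by auto
    have F: "norm (1 / ?g - (?w + \<i> * of_real (e n))) \<le> c" using c[of "?w + \<i> * of_real (e n)"] y1 e[of n] by simp
    have nw: "norm (?w + \<i> * of_real (e n)) = y + e n"
      using y1 e[of n] by (simp flip: distrib_left of_real_add add: norm_mult)
    have "norm (1 / ?g) \<ge> y + e n - c" using F norm_triangle_ineq3[of "1 / ?g" "?w + \<i> * of_real (e n)"] nw by linarith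
    then have "norm (1 / ?g) \<ge> y / 2" using y e[of n] by linarith
    then have ng: "norm ?g \<le> 2 / y" using y1 gnz by (simp add: norm_divide field_simps)
    have F1: "norm (?w - 1 / ?g) \<le> c + 1"
      using F e[of n] norm_triangle_ineq[of "1 / ?g - (?w + \<i> * of_real (e n))" "\<i> * of_real (e n)"]
      by (simp add: norm_mult norm_minus_commute)
    have "?w * ?g - 1 = ?g * (?w - 1 / ?g)" using gnz by (simp add: field_simps)
    then have "norm (?w * ?g - 1) = norm ?g * norm (?w - 1 / ?g)" by (simp only: norm_mult)
    also have "\<dots> \<le> 2 / y * (c + 1)" using ng F1 y1 by (intro mult_mono) auto
    finally have "norm (?w * ?g - 1) \<le> 2 / y * (c + 1)" .
    then show ?thesis using abs_Re_le_cmod[of "?w * ?g - 1"] by simp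
  qed
  have mass: "measure (N n) {-y<..y} \<ge> 1 - 4 * (c + 1) / y" if y: "y > 2 * c + 1" for y n
  proof -
    interpret real_distribution "N n" by (rule rd)
    have y1: "y > 0" using y c0 by auto
    have z: "Im (\<i> * complex_of_real y) > 0" using y1 by simp
    have i: "integrable (N n) (\<lambda>s. y / (s\<^sup>2 + y\<^sup>2))" using Im_cauchy_transform(2)[OF z] by simp
    have I: "y * (- Im (G (\<i> * of_real y + \<i> * of_real (e n)))) = (\<integral>s. y * (y / (s\<^sup>2 + y\<^sup>2)) \<partial>N n)"
      unfolding integral_mult_right_zero using Im_cauchy_transform(1)[OF z] by (simp add: ct[OF z])
    \<comment> \<open>The integrand y^2 / (s^2 + y^2) is at most 1 inside the interval and at most
      1/2 outside, so a value of the integral close to 1 forces the interval to carry most of the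
      mass.\<close>
    have "(\<integral>s. y * (y / (s\<^sup>2 + y\<^sup>2)) \<partial>N n) \<le> (\<integral>s. (1 + indicator {-y<..y} s) / 2 \<partial>N n)"
    proof (rule integral_mono)
      fix s
      have d: "s\<^sup>2 + y\<^sup>2 > 0" using y1 by (simp add: add_nonneg_pos)
      show "y * (y / (s\<^sup>2 + y\<^sup>2)) \<le> (1 + indicator {-y<..y} s) / 2"
      proof (cases "s \<in> {-y<..y}")
        case True then show ?thesis using d by (simp add: divide_le_eq_1_pos power2_eq_square)
      next
        case False
        then have "\<bar>s\<bar> \<ge> \<bar>y\<bar>" using y1 by (auto simp: not_less not_le)
        then have "y\<^sup>2 \<le> s\<^sup>2" by (simp add: abs_le_square_iff)
        then show ?thesis using False d by (simp add: field_simps power2_eq_square)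
      qed
    next
      show "integrable (N n) (\<lambda>s. y * (y / (s\<^sup>2 + y\<^sup>2)))" by (intro integrable_mult_right i)
      show "integrable (N n) (\<lambda>s. (1 + indicator {-y<..y} s) / (2::real))"
        by (rule integrable_const_bound[of _ 1]) (auto simp: indicator_def)
    qed
    also have "\<dots> = (1 + measure (N n) {-y<..y}) / 2"
    proof -
      have "(\<integral>s. 1 + indicator {-y<..y} s \<partial>N n) = (\<integral>s. (1::real) \<partial>N n) + (\<integral>s. indicator {-y<..y} s \<partial>N n)"
        by (rule Bochner_Integration.integral_add) (auto intro!: integrable_const_bound[of _ 1] simp: indicator_def)
      then show ?thesis using prob_space by simp
    qed
    finally have "(\<integral>s. y * (y / (s\<^sup>2 + y\<^sup>2)) \<partial>N n) \<le> (1 + measure (N n) {-y<..y}) / 2" .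
    moreover have "4 * (c + 1) / y = 2 * (2 * (c + 1) / y)" by simp
    moreover have "1 - d \<le> m" if "x \<le> (1 + m) / 2" "d = 2 * b" "1 - x \<le> b" for x m d b :: real
    proof -
      have "2 * x \<le> 1 + m" using that(1) by simp
      then show ?thesis using that by linarith
    qed
    ultimately show ?thesis using tail[OF y, of n] unfolding I by blast
  qed
  have "tight N" unfolding tight_def
  proof (intro conjI allI impI rd)
    fix \<epsilon> :: real assume \<epsilon>: "\<epsilon> > 0"
    define y where "y = max (2 * c + 2) (4 * (c + 1) / \<epsilon> + 1)"
    have y: "y > 2 * c + 1" "y > 0" using c0 by (auto simp: y_def)
    have "4 * (c + 1) / \<epsilon> < y" by (simp add: y_def)
    then have "4 * (c + 1) / y < \<epsilon>" using \<epsilon> y by (simp add: field_simps)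
    then have "\<forall>n. measure (N n) {-y<..y} > 1 - \<epsilon>" using mass[OF y(1)] by (smt (verit))
    then show "\<exists>a b. a < b \<and> (\<forall>n. 1 - \<epsilon> < measure (N n) {a<..b})" using y by (intro exI[of _ "-y"] exI[of _ y]) auto
  qed
  from tight_imp_convergent_subsubsequence[OF this strict_mono_id]
  obtain r L where r: "strict_mono r" and L: "real_distribution L" and w: "weak_conv_m (N \<circ> id \<circ> r) L" by blast
  have "cauchy_transform L z = G z" if z: "Im z > 0" for z
  proof (rule LIMSEQ_unique)
    have "(\<lambda>n. integral\<^sup>L ((N \<circ> id \<circ> r) n) (\<lambda>s. 1 / (z - complex_of_real s))) \<longlonglongrightarrow> integral\<^sup>L L (\<lambda>s. 1 / (z - complex_of_real s))"
    proof (rule weak_conv_imp_integral_bdd_continuous_conv[where B = "1 / \<bar>Im z\<bar>"])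
      show "isCont (\<lambda>s. 1 / (z - complex_of_real s)) x" for x
        by (intro continuous_intros) (use z in auto)
      show "norm (1 / (z - complex_of_real x)) \<le> 1 / \<bar>Im z\<bar>" for x
        by (rule norm_resolvent_le) (use z in auto)
    qed (use rd L w in \<open>auto simp: comp_def\<close>)
    then show "(\<lambda>n. G (z + \<i> * of_real (e (r n)))) \<longlonglongrightarrow> cauchy_transform L z"
      using ct[OF z] by (simp add: cauchy_transform_def)
    have "isCont G z"
      using holomorphic_on_imp_continuous_on[OF hol] z open_Im_gt[of 0] by (simp add: continuous_on_eq_continuous_at)
    moreover have "(\<lambda>n. z + \<i> * of_real (e (r n))) \<longlonglongrightarrow> z + \<i> * of_real 0"
    proof (intro tendsto_intros)
      have "e \<longlonglongrightarrow> 0" unfolding e_def by (rule LIMSEQ_Suc[OF lim_1_over_n])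
      then show "(\<lambda>n. e (r n)) \<longlonglongrightarrow> 0" using LIMSEQ_subseq_LIMSEQ[OF _ r] by (auto simp: comp_def)
    qed
    ultimately show "(\<lambda>n. G (z + \<i> * of_real (e (r n)))) \<longlonglongrightarrow> G z"
      using isCont_tendsto_compose[of z G] by simp
  qed
  then show ?thesis using that L by blast
qed

section \<open>Subordination for a finitely supported measure\<close>

locale finite_atoms =
  fixes k :: nat and \<alpha> :: "nat \<Rightarrow> real"
  assumes k: "k > 0"
begin

definition G :: "complex \<Rightarrow> complex" where "G w = (\<Sum>i<k. 1 / (w - of_real (\<alpha> i))) / of_nat k"
definition F :: "complex \<Rightarrow> complex" where "F w = 1 / G w"
definition \<kappa> :: "complex \<Rightarrow> real" where "\<kappa> w = Im (F w) / Im w - 1"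
definition u :: "complex \<Rightarrow> nat \<Rightarrow> complex" where "u w i = 1 / ((w - of_real (\<alpha> i)) * G w)"

lemma nonreal: "Im w > 0 \<Longrightarrow> w - of_real x \<noteq> 0" by (auto simp: complex_eq_iff)

lemma Im_G: "Im (G w) = - Im w * ((\<Sum>i<k. 1 / (norm (w - of_real (\<alpha> i)))\<^sup>2) / k)"
proof -
  have "Im (1 / (w - of_real (\<alpha> i))) = - Im w * (1 / (norm (w - of_real (\<alpha> i)))\<^sup>2)" for i
    by (simp add: Im_divide cmod_power2)
  then have "Im (\<Sum>i<k. 1 / (w - of_real (\<alpha> i))) = - Im w * (\<Sum>i<k. 1 / (norm (w - of_real (\<alpha> i)))\<^sup>2)"
    by (simp only: Im_sum sum_distrib_left)
  then show ?thesis unfolding G_def by (simp add: Im_divide_of_nat)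
qed

lemma Im_G_neg: "Im w > 0 \<Longrightarrow> Im (G w) < 0"
proof -
  assume w: "Im w > 0"
  have "(\<Sum>i<k. 1 / (norm (w - of_real (\<alpha> i)))\<^sup>2) > 0"
    by (rule sum_pos) (use k nonreal[OF w] in auto)
  then show ?thesis unfolding Im_G using w k by simp
qed

lemma G_nonzero: "Im w > 0 \<Longrightarrow> G w \<noteq> 0" using Im_G_neg[of w] by auto

lemma G_holomorphic: "G holomorphic_on {w. Im w > 0}"
  unfolding G_def by (intro holomorphic_intros) (use nonreal k in auto)

lemma F_holomorphic: "F holomorphic_on {w. Im w > 0}"
  unfolding F_def by (intro holomorphic_intros G_holomorphic) (use G_nonzero in auto)

lemma sum_u: "Im w > 0 \<Longrightarrow> (\<Sum>i<k. u w i) = of_nat k"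
proof -
  assume w: "Im w > 0"
  have "(\<Sum>i<k. u w i) = (\<Sum>i<k. 1 / (w - of_real (\<alpha> i))) / G w"
    by (simp add: u_def sum_divide_distrib)
  also have "(\<Sum>i<k. 1 / (w - of_real (\<alpha> i))) = of_nat k * G w" using k by (simp add: G_def)
  finally show ?thesis using G_nonzero[OF w] by simp
qed

text \<open>The identities below are a variance and a covariance of the functions \<open>u w\<close>, which have mean
  1; Cauchy-Schwarz then bounds the difference quotients of \<open>F w - w\<close> by its imaginary parts.\<close>

lemma \<kappa>_eq: assumes w: "Im w > 0" shows "\<kappa> w = (\<Sum>i<k. (norm (u w i - 1))\<^sup>2) / k"
proof -
  have n: "(norm (x - 1))\<^sup>2 = (norm x)\<^sup>2 - 2 * Re x + 1" for x :: complex
    unfolding cmod_power2 by (simp add: power2_eq_square algebra_simps)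
  have "(\<Sum>i<k. Re (u w i)) = k" using arg_cong[OF sum_u[OF w], of Re] by simp
  then have "(\<Sum>i<k. (norm (u w i - 1))\<^sup>2) = (\<Sum>i<k. (norm (u w i))\<^sup>2) - k"
    unfolding n by (simp add: sum.distrib sum_subtractf flip: sum_distrib_left)
  also have "(\<Sum>i<k. (norm (u w i))\<^sup>2) = (\<Sum>i<k. 1 / (norm (w - of_real (\<alpha> i)))\<^sup>2) / (norm (G w))\<^sup>2"
    by (simp add: u_def norm_divide norm_mult power_divide power_mult_distrib sum_divide_distrib)
  finally have 1: "(\<Sum>i<k. (norm (u w i - 1))\<^sup>2) / k = (\<Sum>i<k. 1 / (norm (w - of_real (\<alpha> i)))\<^sup>2) / k / (norm (G w))\<^sup>2 - 1"
    using k by (simp add: diff_divide_distrib)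
  have "Im (F w) = - Im (G w) / (norm (G w))\<^sup>2" unfolding F_def by (simp add: Im_divide cmod_power2)
  then show ?thesis unfolding \<kappa>_def 1 Im_G using w by simp
qed

lemma \<kappa>_nonneg: "Im w > 0 \<Longrightarrow> \<kappa> w \<ge> 0" by (simp add: \<kappa>_eq sum_nonneg)

lemma F_diff:
  assumes w: "Im w > 0" "Im v > 0"
  shows "(F w - F v) - (w - v) = (w - v) * ((\<Sum>i<k. (u w i - 1) * (u v i - 1)) / of_nat k)"
proof -
  have "(\<Sum>i<k. (u w i - 1) * (u v i - 1)) = (\<Sum>i<k. u w i * u v i) - of_nat k"
    using sum_u[OF w(1)] sum_u[OF w(2)] by (simp add: algebra_simps sum.distrib sum_subtractf)
  then have 1: "(\<Sum>i<k. (u w i - 1) * (u v i - 1)) / of_nat k = (\<Sum>i<k. u w i * u v i) / of_nat k - 1"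
    using k by (simp add: diff_divide_distrib)
  have t: "1 / (v - of_real (\<alpha> i)) - 1 / (w - of_real (\<alpha> i)) = (w - v) * (u w i * u v i) * (G w * G v)" for i
  proof -
    have "u w i * u v i * (G w * G v) = 1 / ((w - of_real (\<alpha> i)) * (v - of_real (\<alpha> i)))"
      using G_nonzero[OF w(1)] G_nonzero[OF w(2)] by (simp add: u_def)
    moreover have "1 / (v - of_real (\<alpha> i)) - 1 / (w - of_real (\<alpha> i)) = (w - v) * (1 / ((w - of_real (\<alpha> i)) * (v - of_real (\<alpha> i))))"
      using nonreal[OF w(1), of "\<alpha> i"] nonreal[OF w(2), of "\<alpha> i"] by (simp add: field_simps)
    ultimately show ?thesis by (simp only: mult.assoc)
  qed
  have "G v - G w = (\<Sum>i<k. 1 / (v - of_real (\<alpha> i)) - 1 / (w - of_real (\<alpha> i))) / of_nat k"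
    by (simp add: G_def sum_subtractf diff_divide_distrib)
  also have "\<dots> = (w - v) * (\<Sum>i<k. u w i * u v i) * (G w * G v) / of_nat k"
    unfolding t by (simp add: sum_distrib_left sum_distrib_right)
  finally have "(G v - G w) / (G w * G v) = (w - v) * ((\<Sum>i<k. u w i * u v i) / of_nat k)"
    using G_nonzero[OF w(1)] G_nonzero[OF w(2)] by simp
  moreover have "F w - F v = (G v - G w) / (G w * G v)"
    using G_nonzero[OF w(1)] G_nonzero[OF w(2)] by (simp add: F_def field_simps)
  ultimately show ?thesis unfolding 1 by (simp add: algebra_simps)
qed

text \<open>Wherever \<kappa> is small, \<open>F - id\<close> is a strict contraction. Both
  injectivity statements, for \<open>F\<close> and for \<open>H\<close>, come from here.\<close>

lemma F_pick:
  assumes w: "Im w > 0" "Im v > 0"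
  shows "norm ((F w - F v) - (w - v)) \<le> norm (w - v) * (sqrt (\<kappa> w) * sqrt (\<kappa> v))"
proof -
  have "norm (\<Sum>i<k. (u w i - 1) * (u v i - 1)) \<le> (\<Sum>i<k. \<bar>norm (u w i - 1)\<bar> * \<bar>norm (u v i - 1)\<bar>)"
    by (rule sum_norm_le) (simp add: norm_mult)
  also have "\<dots> \<le> L2_set (\<lambda>i. norm (u w i - 1)) {..<k} * L2_set (\<lambda>i. norm (u v i - 1)) {..<k}"
    by (rule L2_set_mult_ineq)
  also have "\<dots> = sqrt (k * \<kappa> w) * sqrt (k * \<kappa> v)" using k by (simp add: L2_set_def \<kappa>_eq w)
  also have "\<dots> = k * (sqrt (\<kappa> w) * sqrt (\<kappa> v))" by (simp add: real_sqrt_mult)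
  finally have "norm (\<Sum>i<k. (u w i - 1) * (u v i - 1)) / k \<le> sqrt (\<kappa> w) * sqrt (\<kappa> v)"
    using k by (simp add: divide_le_eq mult.commute)
  then show ?thesis unfolding F_diff[OF w] norm_mult norm_divide norm_of_nat by (intro mult_left_mono) auto
qed

section \<open>Bounds and injectivity for F on half-planes\<close>

text \<open>With \<open>R\<close> the sum of the moduli of the atoms, 4 R is the radius where far
  and near points are separated in the next estimate. At near points all distances to atoms are at
  most 5 R, which is the source of the 25.\<close>

definition C :: "real \<Rightarrow> real" where
  "C d = 25 * (\<Sum>i<k. \<bar>\<alpha> i\<bar>)\<^sup>2 / d + 4 * (\<Sum>i<k. \<bar>\<alpha> i\<bar>)"

lemma C_nonneg: "d > 0 \<Longrightarrow> C d \<ge> 0" unfolding C_def by (intro add_nonneg_nonneg) (auto intro: sum_nonneg)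

text \<open>Far away, \<open>w * G w\<close> is within 1/3 of 1 and \<open>F w - w\<close> is at
  most 2 R. Nearby, the imaginary part bounds \<open>G w\<close> below by d / (5 R)^2, so
  \<open>F w\<close> itself is bounded. The bound is uniform on half-planes, as Nevanlinna's theorem
  requires.\<close>

lemma F_bound:
  assumes d: "d > 0" "Im w \<ge> d" shows "norm (F w - w) \<le> C d"
proof -
  define R where "R = (\<Sum>i<k. \<bar>\<alpha> i\<bar>)"
  have R: "\<bar>\<alpha> i\<bar> \<le> R" if "i < k" for i
    unfolding R_def using that by (intro member_le_sum) auto
  have R0: "R \<ge> 0" by (simp add: R_def sum_nonneg)
  have w: "Im w > 0" using d by simp
  then have wn: "norm w > 0" by auto
  note G0 = G_nonzero[OF w]
  show ?thesis
  proof (cases "norm w \<ge> 4 * R")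
    case True
    have "w * G w - 1 = (\<Sum>i<k. of_real (\<alpha> i) / (w - of_real (\<alpha> i))) / of_nat k"
    proof -
      have "w * (1 / (w - of_real (\<alpha> i))) = 1 + of_real (\<alpha> i) / (w - of_real (\<alpha> i))" for i
        using nonreal[OF w, of "\<alpha> i"] by (simp add: field_simps)
      then have "w * (\<Sum>i<k. 1 / (w - of_real (\<alpha> i))) = of_nat k + (\<Sum>i<k. of_real (\<alpha> i) / (w - of_real (\<alpha> i)))"
        by (simp only: sum_distrib_left sum.distrib) simp
      then show ?thesis using k by (simp add: G_def add_divide_distrib)
    qed
    then have "norm (w * G w - 1) = norm (\<Sum>i<k. of_real (\<alpha> i) / (w - of_real (\<alpha> i))) / k"
      by (simp add: norm_divide)
    also have "\<dots> \<le> (\<Sum>i<k. R / (3/4 * norm w)) / k"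
    proof (intro divide_right_mono sum_norm_le)
      fix i assume "i \<in> {..<k}"
      then have i: "\<bar>\<alpha> i\<bar> \<le> R" using R by simp
      have "norm w - \<bar>\<alpha> i\<bar> \<le> norm (w - of_real (\<alpha> i))" using norm_triangle_ineq2[of w "of_real (\<alpha> i)"] by simp
      then have "3/4 * norm w \<le> norm (w - of_real (\<alpha> i))" using i True by linarith
      then show "norm (of_real (\<alpha> i) / (w - of_real (\<alpha> i))) \<le> R / (3/4 * norm w)"
        unfolding norm_divide using i wn R0 by (intro frac_le) auto
    qed auto
    also have "\<dots> = R / (3/4 * norm w)" using k by simp
    finally have a: "norm (w * G w - 1) \<le> R / (3/4 * norm w)" .
    also have "\<dots> \<le> 1/3" using True wn by (simp add: divide_le_eq)
    finally have b: "norm (w * G w) \<ge> 2/3"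
      using norm_triangle_ineq2[of 1 "1 - w * G w"] by (simp add: norm_minus_commute)
    have "F w - w = - w * (w * G w - 1) / (w * G w)" using G0 wn by (auto simp: F_def field_simps)
    then have "norm (F w - w) = norm w * norm (w * G w - 1) / norm (w * G w)" by (simp only: norm_mult norm_divide norm_minus_cancel)
    also have "\<dots> \<le> norm w * (R / (3/4 * norm w)) / (2/3)"
      by (intro frac_le mult_left_mono a b) (use R0 wn in auto)
    also have "\<dots> = 2 * R" using wn by simp
    also have "\<dots> \<le> C d" unfolding C_def R_def[symmetric] using d R0 by (simp add: add_increasing)
    finally show ?thesis .
  next
    case False
    then have Rp: "R > 0" using wn by linarith
    have "d * (1 / (5 * R)\<^sup>2) = d * ((\<Sum>i<k. 1 / (5 * R)\<^sup>2) / k)" using k by simp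
    also have "\<dots> \<le> Im w * ((\<Sum>i<k. 1 / (norm (w - of_real (\<alpha> i)))\<^sup>2) / k)"
    proof (intro mult_mono divide_right_mono sum_mono)
      fix i assume "i \<in> {..<k}"
      then have i: "\<bar>\<alpha> i\<bar> \<le> R" using R by simp
      have "norm (w - of_real (\<alpha> i)) \<le> norm w + \<bar>\<alpha> i\<bar>" using norm_triangle_ineq4[of w "of_real (\<alpha> i)"] by simp
      then have "norm (w - of_real (\<alpha> i)) \<le> 5 * R" using i False by linarith
      then show "1 / (5 * R)\<^sup>2 \<le> 1 / (norm (w - of_real (\<alpha> i)))\<^sup>2"
        using nonreal[OF w, of "\<alpha> i"] Rp by (intro divide_left_mono power_mono) auto
    qed (use d w in \<open>auto intro: sum_nonneg\<close>)
    also have "\<dots> = - Im (G w)" unfolding Im_G by simp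
    also have "\<dots> \<le> \<bar>Im (G w)\<bar>" by simp
    also have "\<dots> \<le> norm (G w)" by (rule abs_Im_le_cmod)
    finally have le: "d * (1 / (5 * R)\<^sup>2) \<le> norm (G w)" .
    have "norm (F w) \<le> 1 / (d * (1 / (5 * R)\<^sup>2))"
      unfolding F_def norm_divide norm_one using d Rp G0 by (intro divide_left_mono[OF le]) auto
    then have "norm (F w) \<le> 25 * R\<^sup>2 / d" by (simp add: power_mult_distrib)
    then show ?thesis using False norm_triangle_ineq4[of "F w" w] unfolding C_def R_def[symmetric] by linarith
  qed
qed

lemma \<kappa>_le: "d > 0 \<Longrightarrow> Im w \<ge> d \<Longrightarrow> \<kappa> w \<le> C d / Im w"
proof -
  assume d: "d > 0" "Im w \<ge> d"
  have "\<kappa> w = Im (F w - w) / Im w" using d by (simp add: \<kappa>_def diff_divide_distrib)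
  also have "\<dots> \<le> C d / Im w"
    using F_bound[OF d] abs_Im_le_cmod[of "F w - w"] d by (intro divide_right_mono) auto
  finally show ?thesis .
qed

text \<open>Above this height \<kappa> is at most 1/4, so that \<open>F - id\<close> contracts
  distances by the factor 1/4.\<close>

definition m0 :: real where "m0 = 1 + 4 * C 1"

lemma m0: "m0 \<ge> 1" "m0 \<ge> 4 * C 1" using C_nonneg[of 1] by (auto simp: m0_def)

lemma F_inj: 
  assumes "Im w \<ge> m0" "Im v \<ge> m0" "F w = F v" shows "w = v"
proof (rule ccontr)
  assume ne: "w \<noteq> v"
  have q: "sqrt (\<kappa> x) \<le> 1/2" if "Im x \<ge> m0" for x
  proof -
    have "C 1 / Im x \<le> 1/4" using that m0 by (simp add: divide_le_eq)
    then have "\<kappa> x \<le> 1/4" using \<kappa>_le[of 1 x] that m0(1) by linarith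
    then have "\<kappa> x \<le> (1/2)\<^sup>2" by (simp add: power2_eq_square)
    then show ?thesis by (rule real_le_lsqrt[rotated]) simp
  qed
  have p: "Im w > 0" "Im v > 0" using assms m0 by auto
  have "norm (w - v) \<le> norm (w - v) * (sqrt (\<kappa> w) * sqrt (\<kappa> v))"
    using F_pick[OF p] assms(3) by (simp add: norm_minus_commute)
  also have "\<dots> \<le> norm (w - v) * (1/2 * (1/2))"
    using q[OF assms(1)] q[OF assms(2)] \<kappa>_nonneg[OF p(2)] by (intro mult_left_mono mult_mono) auto
  finally show False using ne by simp
qed

lemma F_continuous: "S \<subseteq> {w. Im w > 0} \<Longrightarrow> continuous_on S F"
  using holomorphic_on_imp_continuous_on[OF F_holomorphic] continuous_on_subset by blast

text \<open>Solutions of \<open>F w = x\<close> are the fixed points of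
  \<open>x - (F w - w)\<close>, a map that takes the closed ball of radius \<open>C 1\<close> about
  \<open>x\<close> to itself; the margin in the hypothesis keeps that ball above
  \<open>m0\<close>.\<close>

lemma F_surj:
  assumes x: "Im x \<ge> m0 + C 1"
  obtains w where "Im w \<ge> m0" "F w = x" "norm (w - x) \<le> C 1"
proof -
  have Im: "Im w \<ge> m0" if "w \<in> cball x (C 1)" for w
    using that x abs_Im_le_cmod[of "x - w"] by (simp add: dist_norm)
  have 1: "continuous_on (cball x (C 1)) (\<lambda>w. x - (F w - w))"
    by (intro continuous_intros F_continuous) (use Im m0 in force)
  have 2: "(\<lambda>w. x - (F w - w)) \<in> cball x (C 1) \<rightarrow> cball x (C 1)"
    using F_bound[of 1] Im m0 by (force simp: dist_norm)
  have 3: "cball x (C 1) \<noteq> {}" using C_nonneg[of 1] by simp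
  obtain w where w: "w \<in> cball x (C 1)" "x - (F w - w) = w"
    using brouwer[OF compact_cball convex_cball 3 1 2] by blast
  have "F w = x" using w(2) by (simp add: algebra_simps)
  then show ?thesis using that[OF Im[OF w(1)]] w(1) by (simp add: dist_norm norm_minus_commute)
qed

end

locale free_power = finite_atoms +
  fixes T :: real
  assumes T: "1 \<le> T"
begin

definition H :: "complex \<Rightarrow> complex" where "H w = of_real T * w - of_real (T - 1) * F w"

lemma H_eq: "H w = w - of_real (T - 1) * (F w - w)" by (simp add: H_def algebra_simps)

text \<open>The imaginary part of \<open>H x\<close> is that of \<open>x\<close> times 1 - (T - 1)
  \<kappa> x. Hence \<open>H x\<close> is in the upper half-plane exactly when (T - 1) \<kappa> x <
  1, which is what makes (T - 1) (F - id) strictly contracting between two such points.\<close>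

lemma H_inj:
  assumes "Im w > 0" "Im v > 0" "Im (H w) > 0" "Im (H v) > 0" "H w = H v" shows "w = v"
proof (rule ccontr)
  assume ne: "w \<noteq> v"
  have q: "sqrt ((T - 1) * \<kappa> x) < 1" if "Im x > 0" "Im (H x) > 0" for x
  proof -
    have "Im (H x) = Im x * (1 - (T - 1) * \<kappa> x)"
      unfolding H_eq using that(1) by (simp add: \<kappa>_def field_simps)
    then have "1 - (T - 1) * \<kappa> x > 0" using that by (simp add: zero_less_mult_iff)
    then show ?thesis by simp
  qed
  have "w - v = of_real (T - 1) * ((F w - F v) - (w - v))"
    using assms(5) unfolding H_eq by (simp add: algebra_simps)
  then have "norm (w - v) = (T - 1) * norm ((F w - F v) - (w - v))"
    using T by (metis abs_of_nonneg diff_ge_0_iff_ge norm_mult norm_of_real)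
  also have "\<dots> \<le> (T - 1) * (norm (w - v) * (sqrt (\<kappa> w) * sqrt (\<kappa> v)))"
    using T by (intro mult_left_mono F_pick assms) auto
  also have "\<dots> = norm (w - v) * (sqrt ((T - 1) * \<kappa> w) * sqrt ((T - 1) * \<kappa> v))"
  proof -
    have "sqrt (T - 1) * sqrt (T - 1) = T - 1" using T by simp
    then show ?thesis by (simp add: real_sqrt_mult mult_ac)
  qed
  also have "\<dots> < norm (w - v) * 1"
  proof (intro mult_strict_left_mono)
    have "sqrt ((T - 1) * \<kappa> w) * sqrt ((T - 1) * \<kappa> v) \<le> sqrt ((T - 1) * \<kappa> w) * 1"
      using q[of v] assms T \<kappa>_nonneg[of w] by (intro mult_left_mono) auto
    then show "sqrt ((T - 1) * \<kappa> w) * sqrt ((T - 1) * \<kappa> v) < 1" using q[OF assms(1,3)] by linarith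
  qed (use ne in simp)
  finally show False by simp
qed

text \<open>Preimages of \<open>z\<close> are fixed points of \<open>z + (T - 1) (F w - w)\<close>.
  This map does not go below the height of \<open>z\<close>, because \<open>F\<close> does not
  decrease imaginary parts, and \<open>F - id\<close> is bounded there, so a half-plane cut by a
  ball is mapped to itself.\<close>

lemma H_surj:
  assumes z: "Im z > 0"
  obtains w where "Im w \<ge> Im z" "H w = z"
proof -
  define S where "S = {w. Im w \<ge> Im z} \<inter> cball 0 (norm z + (T - 1) * C (Im z))"
  have S: "compact S" "convex S" unfolding S_def
    using closed_halfspace_Im_ge[of "Im z"] convex_halfspace_Im_ge[of "Im z"]
    by (auto intro: closed_Int_compact convex_Int)
  have "z \<in> S" using C_nonneg[OF z] T by (simp add: S_def)
  have "continuous_on S (\<lambda>w. z + of_real (T - 1) * (F w - w))"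
    by (intro continuous_intros F_continuous) (use z in \<open>auto simp: S_def\<close>)
  moreover have "(\<lambda>w. z + of_real (T - 1) * (F w - w)) \<in> S \<rightarrow> S"
  proof (rule funcsetI)
    fix w assume "w \<in> S"
    then have w: "Im w \<ge> Im z" "Im w > 0" using z by (auto simp: S_def)
    have "Im (F w - w) = \<kappa> w * Im w" using w by (simp add: \<kappa>_def field_simps)
    then have "Im (F w - w) \<ge> 0" using \<kappa>_nonneg[OF w(2)] w by simp
    then have "Im (z + of_real (T - 1) * (F w - w)) \<ge> Im z" using T by simp
    moreover have "norm (of_real (T - 1) * (F w - w)) \<le> (T - 1) * C (Im z)"
      using F_bound[OF z w(1)] T unfolding norm_mult norm_of_real by (intro mult_mono) auto
    then have "norm (z + of_real (T - 1) * (F w - w)) \<le> norm z + (T - 1) * C (Im z)"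
      using norm_triangle_ineq order_trans add_left_mono by blast
    ultimately show "z + of_real (T - 1) * (F w - w) \<in> S" by (simp add: S_def)
  qed
  ultimately obtain w where w: "w \<in> S" "z + of_real (T - 1) * (F w - w) = w"
    using brouwer[OF S] \<open>z \<in> S\<close> by blast
  then have "H w = z" unfolding H_eq by (simp add: algebra_simps)
  then show ?thesis using that[of w] w by (auto simp: S_def)
qed

definition \<omega> :: "complex \<Rightarrow> complex" where "\<omega> z = (SOME w. Im w \<ge> Im z \<and> H w = z)"

lemma \<omega>: assumes "Im z > 0" shows "Im (\<omega> z) \<ge> Im z" "H (\<omega> z) = z" "Im (\<omega> z) > 0"
proof -
  have "Im (\<omega> z) \<ge> Im z \<and> H (\<omega> z) = z"
    unfolding \<omega>_def by (rule someI_ex) (use H_surj[OF assms] in blast)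
  then show "Im (\<omega> z) \<ge> Im z" "H (\<omega> z) = z" "Im (\<omega> z) > 0" using assms by auto
qed

lemma \<omega>_H: "Im w > 0 \<Longrightarrow> Im (H w) > 0 \<Longrightarrow> \<omega> (H w) = w"
  using H_inj[of "\<omega> (H w)" w] \<omega>[of "H w"] by auto

lemma H_holomorphic: "H holomorphic_on {w. Im w > 0}"
  unfolding H_def by (intro holomorphic_intros F_holomorphic)

text \<open>\<omega> is chosen pointwise, but it coincides with the holomorphic inverse of
  \<open>H\<close> restricted to the open set that \<open>H\<close> maps into the upper
  half-plane.\<close>

lemma \<omega>_holomorphic: "\<omega> holomorphic_on {z. Im z > 0}"
proof -
  define S where "S = {w. Im w > 0} \<inter> H -` {w. Im w > 0}"
  have op: "open S" unfolding S_def
    by (intro continuous_open_preimage holomorphic_on_imp_continuous_on[OF H_holomorphic])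
      (use open_halfspace_Im_gt[of 0] in simp_all)
  have hol: "H holomorphic_on S" by (rule holomorphic_on_subset[OF H_holomorphic]) (simp add: S_def)
  have inj: "inj_on H S" by (rule inj_onI) (use H_inj in \<open>auto simp: S_def\<close>)
  obtain g where g: "g holomorphic_on (H ` S)" "\<And>z. z \<in> S \<Longrightarrow> g (H z) = z"
    using holomorphic_has_inverse[OF hol op inj] by metis
  have "H ` S = {z. Im z > 0}"
  proof (intro equalityI subsetI)
    fix z assume "z \<in> {z. Im z > 0}"
    then have "\<omega> z \<in> S" "z = H (\<omega> z)" using \<omega>[of z] by (auto simp: S_def)
    then show "z \<in> H ` S" by blast
  qed (auto simp: S_def)
  moreover have "g z = \<omega> z" if "Im z > 0" for z
    using g(2)[of "\<omega> z"] \<omega>[OF that] that by (simp add: S_def)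
  ultimately show ?thesis using g(1) by (auto intro: holomorphic_transform[of g])
qed

text \<open>The defining relation of the free power in disguise: with x = F (\<omega> z), the point
  \<omega> z is the inverse of \<open>F\<close> at \<open>x\<close>, and \<open>z\<close> will be
  the inverse of the new reciprocal transform at \<open>x\<close>. Their displacements from
  \<open>x\<close> have ratio \<open>T\<close>.\<close>

lemma F_\<omega>: assumes z: "Im z > 0" shows "F (\<omega> z) - z = of_real T * (F (\<omega> z) - \<omega> z)"
proof -
  have "z = H (\<omega> z)" using \<omega>[OF z] by simp
  also have "F (\<omega> z) - H (\<omega> z) = of_real T * (F (\<omega> z) - \<omega> z)" by (simp add: H_def algebra_simps)
  finally show ?thesis by simp
qed

lemma F_\<omega>_bound: assumes d: "d > 0" "Im z \<ge> d" shows "norm (F (\<omega> z) - z) \<le> T * C d"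
proof -
  have z: "Im z > 0" using d by simp
  have "norm (F (\<omega> z) - \<omega> z) \<le> C d" by (rule F_bound[OF d(1)]) (use \<omega>[OF z] d in simp)
  then show ?thesis unfolding F_\<omega>[OF z] norm_mult using T by (simp add: mult_left_mono)
qed

end

section \<open>Free convolution powers of a finitely supported measure\<close>

context finite_atoms
begin

text \<open>An image of the uniform distribution on indices, so that repeated values of \<alpha> add
  up their masses.\<close>

definition \<mu> :: "real measure" where "\<mu> = distr (measure_pmf (pmf_of_set {..<k})) borel \<alpha>"

lemma lessThan_k: "{..<k} \<noteq> {}" using k by auto

lemma real_distribution_\<mu>: "real_distribution \<mu>"
  unfolding \<mu>_def real_distribution_def real_distribution_axioms_def
  by (auto intro!: prob_space.prob_space_distr measure_pmf.prob_space_axioms)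

lemma integral_\<mu>:
  fixes f :: "real \<Rightarrow> 'b::{banach,second_countable_topology}"
  assumes "f \<in> borel_measurable borel"
  shows "(\<integral>x. f x \<partial>\<mu>) = (\<Sum>i<k. f (\<alpha> i)) /\<^sub>R k"
proof -
  have "(\<integral>x. f x \<partial>\<mu>) = (\<integral>i. f (\<alpha> i) \<partial>measure_pmf (pmf_of_set {..<k}))"
    unfolding \<mu>_def by (rule integral_distr) (use assms in auto)
  also have "\<dots> = (\<Sum>i<k. pmf (pmf_of_set {..<k}) i *\<^sub>R f (\<alpha> i))"
    by (rule integral_measure_pmf) (use lessThan_k in auto)
  also have "\<dots> = (\<Sum>i<k. f (\<alpha> i) /\<^sub>R k)"
    using lessThan_k by (intro sum.cong) (auto simp: inverse_eq_divide)
  finally show ?thesis by (simp add: scaleR_sum_right)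
qed

lemma measure_\<mu>: "measure \<mu> {x} = real (card {i. i < k \<and> \<alpha> i = x}) / k"
proof -
  interpret real_distribution \<mu> by (rule real_distribution_\<mu>)
  have "measure \<mu> {x} = (\<integral>y. indicator {x} y \<partial>\<mu>)" by simp
  also have "\<dots> = (\<Sum>i<k. indicator {x} (\<alpha> i)) / k"
    by (subst integral_\<mu>) (auto simp: divide_inverse)
  also have "(\<Sum>i<k. indicator {x} (\<alpha> i) :: real) = real (card {i. i < k \<and> \<alpha> i = x})"
    by (simp add: indicator_def of_bool_def sum.If_cases Int_def conj_commute)
  finally show ?thesis .
qed

lemma cauchy_transform_\<mu>: "cauchy_transform \<mu> w = G w"
  unfolding cauchy_transform_def G_def
  by (subst integral_\<mu>) (auto simp: scaleR_conv_of_real divide_inverse)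

lemma recip_\<mu>: "recip_cauchy_transform \<mu> = F"
  by (rule ext) (simp add: recip_cauchy_transform_def cauchy_transform_\<mu> F_def)

end

context free_power
begin

lemma free_power_measure_exists:
  obtains \<nu> where "real_distribution \<nu>" "\<And>z. Im z > 0 \<Longrightarrow> cauchy_transform \<nu> z = G (\<omega> z)"
proof (rule nevanlinna[of "\<lambda>z. G (\<omega> z)"])
  show "(\<lambda>z. G (\<omega> z)) holomorphic_on upper_half_plane"
    using holomorphic_on_compose_gen[OF \<omega>_holomorphic G_holomorphic] \<omega>(3) by (auto simp: comp_def)
  show "Im (G (\<omega> z)) < 0" if "Im z > 0" for z by (rule Im_G_neg[OF \<omega>(3)[OF that]])
  show "\<exists>c. \<forall>z. d \<le> Im z \<longrightarrow> norm (1 / G (\<omega> z) - z) \<le> c" if "d > 0" for d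
    using F_\<omega>_bound[OF that] unfolding F_def by blast
qed (rule that)

section \<open>Existence and uniqueness of the free convolution power\<close>

text \<open>Passing from \<open>x\<close> to its preimages moves a point by a bounded amount.
  Doubling the aperture and leaving a margin of 2 e in height absorbs this.\<close>

lemma in_cone:
  assumes x: "x \<in> truncated_cone 1 (b + 2 * e)" and d: "norm (w - x) \<le> e" and b: "b \<ge> 2 * e"
  shows "w \<in> truncated_cone 2 b"
proof -
  have "\<bar>Re w - Re x\<bar> \<le> e" "\<bar>Im w - Im x\<bar> \<le> e"
    using d abs_Re_le_cmod[of "w - x"] abs_Im_le_cmod[of "w - x"] by auto
  moreover have "0 \<le> e" using d norm_ge_zero order_trans by blast
  ultimately show ?thesis using x b unfolding truncated_cone_def by auto
qed

text \<open>For \<open>x\<close> in the narrow cone, \<open>w\<close> with \<open>F w = x\<close>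
  and \<open>z = H w\<close> are the values of the two inverse functions, and \<open>z - x\<close>
  is \<open>T\<close> times \<open>w - x\<close>.\<close>

lemma voiculescu_exists:
  assumes \<nu>: "\<And>z. Im z > 0 \<Longrightarrow> cauchy_transform \<nu> z = G (\<omega> z)"
  shows "\<exists>\<eta>>0. \<exists>M>0. \<exists>\<phi>. is_voiculescu_transform \<mu> (truncated_cone \<eta> M) \<phi>
    \<and> is_voiculescu_transform \<nu> (truncated_cone \<eta> M) (\<lambda>z. complex_of_real T * \<phi> z)"
proof -
  have F\<nu>: "recip_cauchy_transform \<nu> z = F (\<omega> z)" if "Im z > 0" for z
    using \<nu>[OF that] by (simp add: recip_cauchy_transform_def F_def)
  have c0: "C 1 \<ge> 0" "T * C 1 \<ge> 0" "C 1 \<le> T * C 1" using C_nonneg[of 1] T mult_right_mono[of 1 T "C 1"] by auto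
  \<comment> \<open>Each summand 2 (T * C 1) pays for one displacement: \<open>w\<close> stays
    within \<open>C 1\<close> and \<open>z\<close> within \<open>T * C 1\<close> of
    \<open>x\<close>, so both land in cones of aperture 2, above \<open>m0\<close> and
    \<open>b\<close> respectively.\<close>
  define b where "b = m0 + 2 * (T * C 1)"
  define M where "M = b + 2 * (T * C 1)"
  define \<phi> where "\<phi> x = inv_into (truncated_cone 2 m0) F x - x" for x
  have inj: "inj_on F (truncated_cone 2 m0)"
    by (rule inj_onI) (auto simp: truncated_cone_def intro: F_inj)
  have inj\<nu>: "inj_on (recip_cauchy_transform \<nu>) (truncated_cone 2 b)"
  proof (rule inj_onI)
    fix z y assume zy: "z \<in> truncated_cone 2 b" "y \<in> truncated_cone 2 b"
      and eq: "recip_cauchy_transform \<nu> z = recip_cauchy_transform \<nu> y"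
    then have i: "Im z \<ge> m0" "Im y \<ge> m0" using c0 by (auto simp: truncated_cone_def b_def)
    then have p: "Im z > 0" "Im y > 0" using m0 by auto
    have "F (\<omega> z) = F (\<omega> y)" using eq F\<nu> p by simp
    then have "\<omega> z = \<omega> y" by (rule F_inj[rotated 2]) (use i \<omega>(1)[OF p(1)] \<omega>(1)[OF p(2)] in auto)
    then show "z = y" by (rule box_equals[OF arg_cong[of _ _ H] \<omega>(2)[OF p(1)] \<omega>(2)[OF p(2)]])
  qed
  have key: "\<exists>w z. w \<in> truncated_cone 2 m0 \<and> F w = x \<and> z \<in> truncated_cone 2 b \<and> recip_cauchy_transform \<nu> z = x
      \<and> z - x = of_real T * (w - x)" if x: "x \<in> truncated_cone 1 M" for x
  proof -
    have "Im x \<ge> m0 + C 1" using x c0 by (auto simp: truncated_cone_def M_def b_def)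
    then obtain w where w: "Im w \<ge> m0" "F w = x" "norm (w - x) \<le> C 1" by (rule F_surj)
    have "x \<in> truncated_cone 1 (m0 + 2 * C 1)" using x c0 by (auto simp: truncated_cone_def M_def b_def)
    then have wc: "w \<in> truncated_cone 2 m0" using w(3) m0 c0 by (intro in_cone[of x m0 "C 1"]) auto
    define z where "z = H w"
    have zx: "z - x = of_real T * (w - x)" by (simp add: z_def H_def w(2) algebra_simps)
    have "norm (z - x) \<le> T * C 1" unfolding zx norm_mult using w(3) T by (simp add: mult_left_mono)
    then have zc: "z \<in> truncated_cone 2 b"
      using x m0 c0 by (intro in_cone[of x b "T * C 1"]) (auto simp: M_def b_def)
    then have "Im z > 0" using m0 c0 by (auto simp: truncated_cone_def b_def)
    moreover have "Im w > 0" using w m0 by simp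
    ultimately have "\<omega> z = w" unfolding z_def by (intro \<omega>_H)
    then have "recip_cauchy_transform \<nu> z = x" using F\<nu>[OF \<open>Im z > 0\<close>] w by simp
    then show ?thesis using wc w zc zx by blast
  qed
  have "is_voiculescu_transform \<mu> (truncated_cone 1 M) \<phi>"
    unfolding is_voiculescu_transform_def recip_\<mu>
  proof (rule exI[of _ 2], rule conjI[OF zero_less_numeral], rule exI[of _ m0], intro conjI inj ballI subsetI)
    show "x \<in> F ` truncated_cone 2 m0" if "x \<in> truncated_cone 1 M" for x
      using key[OF that] by (auto intro: rev_image_eqI)
  qed (use m0 in \<open>auto simp: \<phi>_def\<close>)
  moreover have "is_voiculescu_transform \<nu> (truncated_cone 1 M) (\<lambda>z. complex_of_real T * \<phi> z)"
    unfolding is_voiculescu_transform_def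
  proof (rule exI[of _ 2], rule conjI[OF zero_less_numeral], rule exI[of _ b], intro conjI inj\<nu> ballI)
    show "truncated_cone 1 M \<subseteq> recip_cauchy_transform \<nu> ` truncated_cone 2 b"
    proof
      fix x assume "x \<in> truncated_cone 1 M"
      then obtain z where "z \<in> truncated_cone 2 b" "recip_cauchy_transform \<nu> z = x" using key by meson
      then show "x \<in> recip_cauchy_transform \<nu> ` truncated_cone 2 b" by (intro rev_image_eqI) auto
    qed
    show "b > 0" using m0 c0 by (simp add: b_def)
    fix x assume "x \<in> truncated_cone 1 M"
    then obtain w z where wz: "w \<in> truncated_cone 2 m0" "F w = x" "z \<in> truncated_cone 2 b"
      "recip_cauchy_transform \<nu> z = x" "z - x = of_real T * (w - x)" using key by blast
    have "inv_into (truncated_cone 2 m0) F x = w" using inv_into_f_f[OF inj wz(1)] wz(2) by simp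
    moreover have "inv_into (truncated_cone 2 b) (recip_cauchy_transform \<nu>) x = z"
      using inv_into_f_f[OF inj\<nu> wz(3)] wz(4) by simp
    ultimately show "complex_of_real T * \<phi> x = inv_into (truncated_cone 2 b) (recip_cauchy_transform \<nu>) x - x"
      using wz(5) by (simp add: \<phi>_def)
  qed
  moreover have "M > 0" using m0 c0 by (simp add: M_def b_def)
  ultimately show ?thesis by (intro exI[of _ 1] exI[of _ M]) auto
qed

text \<open>The cones witnessing the two Voiculescu transforms are unknown. On a nonempty open set
  of high points the inverse branches are nevertheless forced, because \<open>F\<close> is injective
  above \<open>m0\<close>. The Cauchy transforms agree there, hence everywhere by analytic
  continuation.\<close>

lemma voiculescu_unique:
  assumes \<nu>: "real_distribution \<nu>" "\<And>z. Im z > 0 \<Longrightarrow> cauchy_transform \<nu> z = G (\<omega> z)"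
    and \<rho>: "real_distribution \<rho>" and \<eta>: "\<eta> > 0"
    and v\<mu>: "is_voiculescu_transform \<mu> (truncated_cone \<eta> M) \<phi>"
    and v\<rho>: "is_voiculescu_transform \<rho> (truncated_cone \<eta> M) (\<lambda>z. complex_of_real T * \<phi> z)"
  shows "\<rho> = \<nu>"
proof (rule cauchy_transform_inj[OF \<rho> \<nu>(1)])
  obtain a b where ab: "a > 0" "b > 0" "truncated_cone \<eta> M \<subseteq> F ` truncated_cone a b"
    "\<And>z. z \<in> truncated_cone \<eta> M \<Longrightarrow> \<phi> z = inv_into (truncated_cone a b) F z - z"
    using v\<mu> unfolding is_voiculescu_transform_def recip_\<mu> by blast
  obtain a' b' where ab': "truncated_cone \<eta> M \<subseteq> recip_cauchy_transform \<rho> ` truncated_cone a' b'"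
    "\<And>z. z \<in> truncated_cone \<eta> M \<Longrightarrow> complex_of_real T * \<phi> z = inv_into (truncated_cone a' b') (recip_cauchy_transform \<rho>) z - z"
    using v\<rho> unfolding is_voiculescu_transform_def by blast
  \<comment> \<open>The inverse branch takes values above height \<open>b\<close>, where
    \<open>F\<close> moves points by at most \<open>C b\<close>. So images above height
    \<open>N\<close> have preimages at height at least \<open>m0\<close>.\<close>
  define N where "N = m0 + C b"
  define Z where "Z = {z. Im z > m0} \<inter> (\<lambda>z. F (\<omega> z)) -` ({x. Im x > max M N} \<inter> {x. \<bar>Re x\<bar> < \<eta> * Im x})"
  have Zeq: "cauchy_transform \<rho> z = cauchy_transform \<nu> z" if z: "z \<in> Z" for z
  proof -
    define x where "x = F (\<omega> z)"
    have x: "x \<in> truncated_cone \<eta> M" "Im x > N" and zi: "Im z > m0"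
      using z by (auto simp: Z_def x_def truncated_cone_def)
    have zp: "Im z > 0" using zi m0 by simp
    define w where "w = inv_into (truncated_cone a b) F x"
    have w: "w \<in> truncated_cone a b" "F w = x"
      using ab(3) x(1) inv_into_into[of x F "truncated_cone a b"] f_inv_into_f[of x F "truncated_cone a b"]
      unfolding w_def by blast+
    have "norm (F w - w) \<le> C b" using w(1) ab(2) by (intro F_bound) (auto simp: truncated_cone_def)
    then have "Im w \<ge> m0" using x(2) abs_Im_le_cmod[of "F w - w"] w(2) by (simp add: N_def)
    moreover have "Im (\<omega> z) \<ge> m0" using \<omega>(1)[OF zp] zi by simp
    ultimately have w\<omega>: "w = \<omega> z" by (rule F_inj) (use w(2) in \<open>simp add: x_def\<close>)
    have "inv_into (truncated_cone a' b') (recip_cauchy_transform \<rho>) x = x + of_real T * (w - x)"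
      using ab(4)[OF x(1)] ab'(2)[OF x(1)] by (simp add: w_def)
    also have "\<dots> = H w" using w(2) by (simp add: H_def algebra_simps)
    also have "\<dots> = z" using w\<omega> \<omega>(2)[OF zp] by simp
    finally have "recip_cauchy_transform \<rho> z = x"
      using ab'(1) x(1) f_inv_into_f[of x "recip_cauchy_transform \<rho>" "truncated_cone a' b'"] by auto
    also have "x = recip_cauchy_transform \<nu> z" using \<nu>(2)[OF zp] by (simp add: x_def F_def recip_cauchy_transform_def)
    finally show ?thesis by (simp add: recip_cauchy_transform_def)
  qed
  have hol: "(\<lambda>z. F (\<omega> z)) holomorphic_on upper_half_plane"
    using holomorphic_on_compose_gen[OF \<omega>_holomorphic F_holomorphic] \<omega>(3) by (auto simp: comp_def)
  have Zo: "open Z" unfolding Z_def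
  proof (rule continuous_open_preimage)
    show "continuous_on {z. Im z > m0} (\<lambda>z. F (\<omega> z))"
      by (rule continuous_on_subset[OF holomorphic_on_imp_continuous_on[OF hol]]) (use m0 in auto)
    have "open {x. \<bar>Re x\<bar> < \<eta> * Im x}" by (intro open_Collect_less continuous_intros)
    then show "open ({x. Im x > max M N} \<inter> {x. \<bar>Re x\<bar> < \<eta> * Im x})" by (intro open_Int open_Im_gt)
  qed (rule open_Im_gt)
  have ZU: "Z \<subseteq> upper_half_plane" using m0 by (auto simp: Z_def)
  have Zn: "Z \<noteq> {}"
  proof -
    define e where "e = T * C 1"
    have e0: "e \<ge> 0" using C_nonneg[of 1] T by (simp add: e_def)
    define c where "c = max (max M N) m0"
    \<comment> \<open>The composite of \<open>F\<close> and \<omega> moves a point by at most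
      \<open>e\<close>. This height leaves room for \<open>e\<close> vertically, and the term
      \<open>e / \<eta>\<close> keeps the displaced point inside the cone of aperture
      \<eta>.\<close>
    define y where "y = c + e / \<eta> + e + 1"
    have "e / \<eta> \<ge> 0" "c \<ge> m0" "c \<ge> max M N" using e0 \<eta> by (simp_all add: c_def)
    then have y1: "y \<ge> 1" "y > m0" "y - e > max M N" "y - e > e / \<eta>"
      using m0(1) e0 unfolding y_def by linarith+
    define x where "x = F (\<omega> (\<i> * of_real y))"
    have "norm (x - \<i> * of_real y) \<le> e" unfolding x_def e_def by (rule F_\<omega>_bound) (use y1 in auto)
    then have d: "\<bar>Re x\<bar> \<le> e" "\<bar>Im x - y\<bar> \<le> e"
      using abs_Re_le_cmod[of "x - \<i> * of_real y"] abs_Im_le_cmod[of "x - \<i> * of_real y"] by auto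
    then have "Im x > max M N" using y1 by linarith
    moreover have "e / \<eta> < Im x" using y1 d by linarith
    then have "e < \<eta> * Im x" using \<eta> by (simp add: pos_divide_less_eq mult.commute)
    then have "\<bar>Re x\<bar> < \<eta> * Im x" using d by linarith
    ultimately have "\<i> * of_real y \<in> Z" using y1 by (simp add: Z_def x_def)
    then show ?thesis by blast
  qed
  fix z :: complex assume z: "Im z > 0"
  have con: "connected upper_half_plane" by (rule convex_connected[OF convex_Im_gt])
  show "cauchy_transform \<rho> z = cauchy_transform \<nu> z"
    by (rule analytic_continuation_open[OF Zo open_Im_gt Zn con ZU
          real_distribution.holomorphic_cauchy_transform[OF \<rho>] real_distribution.holomorphic_cauchy_transform[OF \<nu>(1)] Zeq])
      (use z in auto)
qed

lemma free_convolution_power_cauchy: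
  shows "real_distribution (free_convolution_power \<mu> T)"
    and "Im z > 0 \<Longrightarrow> cauchy_transform (free_convolution_power \<mu> T) z = G (\<omega> z)"
proof -
  obtain \<nu> where \<nu>: "real_distribution \<nu>" "\<And>z. Im z > 0 \<Longrightarrow> cauchy_transform \<nu> z = G (\<omega> z)"
    using free_power_measure_exists by blast
  have "free_convolution_power \<mu> T = \<nu>"
    unfolding free_convolution_power_def
  proof (rule the_equality)
    show "prob_space \<nu> \<and> sets \<nu> = sets borel \<and> (\<exists>\<eta>>0. \<exists>M>0. \<exists>\<phi>. is_voiculescu_transform \<mu> (truncated_cone \<eta> M) \<phi>
        \<and> is_voiculescu_transform \<nu> (truncated_cone \<eta> M) (\<lambda>z. complex_of_real T * \<phi> z))"
      using \<nu>(1) voiculescu_exists[OF \<nu>(2)] by (auto simp: real_distribution_def real_distribution_axioms_def)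
    fix \<rho> assume "prob_space \<rho> \<and> sets \<rho> = sets borel \<and> (\<exists>\<eta>>0. \<exists>M>0. \<exists>\<phi>. is_voiculescu_transform \<mu> (truncated_cone \<eta> M) \<phi>
        \<and> is_voiculescu_transform \<rho> (truncated_cone \<eta> M) (\<lambda>z. complex_of_real T * \<phi> z))"
    then obtain \<eta> M \<phi> where "real_distribution \<rho>" "\<eta> > 0" "is_voiculescu_transform \<mu> (truncated_cone \<eta> M) \<phi>"
      "is_voiculescu_transform \<rho> (truncated_cone \<eta> M) (\<lambda>z. complex_of_real T * \<phi> z)"
      by (auto simp: real_distribution_def real_distribution_axioms_def)
    then show "\<rho> = \<nu>" by (intro voiculescu_unique[of \<nu> \<rho> \<eta> M \<phi>] \<nu>)
  qed
  then show "real_distribution (free_convolution_power \<mu> T)"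
    and "Im z > 0 \<Longrightarrow> cauchy_transform (free_convolution_power \<mu> T) z = G (\<omega> z)" using \<nu> by auto
qed

text \<open>An atom of mass \<open>m\<close> at \<open>\<xi>\<close> forces \<open>\<mu>\<close> to have an atom at \<open>\<xi> / T\<close> with
  \<open>T \<mu>{\<xi> / T} = m + T - 1\<close>: along \<open>z = \<xi> + i y\<close> one has \<open>i y G(\<omega>) \<rightarrow> m\<close>, hence \<open>F(\<omega>) \<rightarrow> 0\<close>
  and \<open>\<omega> \<rightarrow> \<xi> / T\<close>.\<close>

lemma free_convolution_power_no_atom:
  assumes small: "\<And>x. measure \<mu> {x} \<le> 1 - 1 / T"
  shows "\<not> is_atom (free_convolution_power \<mu> T) \<xi>"
proof
  assume atom: "is_atom (free_convolution_power \<mu> T) \<xi>"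
  interpret \<nu>: real_distribution "free_convolution_power \<mu> T" by (rule free_convolution_power_cauchy)
  define m where "m = measure (free_convolution_power \<mu> T) {\<xi>}"
  have m: "m > 0" using atom by (simp add: is_atom_def m_def \<nu>.emeasure_eq_measure)
  define Y where "Y n = 1 / real (Suc n)" for n
  have Y: "Y \<longlonglongrightarrow> 0" "\<And>n. Y n > 0" unfolding Y_def by (rule LIMSEQ_Suc[OF lim_1_over_n]) simp
  define z where "z n = of_real \<xi> + \<i> * of_real (Y n)" for n
  define w where "w n = \<omega> (z n)" for n
  have zp: "Im (z n) > 0" for n using Y(2) by (simp add: z_def)
  have wp: "Im (w n) > 0" and Hw: "H (w n) = z n" for n using \<omega>[OF zp] by (auto simp: w_def)
  have L1: "(\<lambda>n. \<i> * of_real (Y n) * G (w n)) \<longlonglongrightarrow> of_real m"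
    using \<nu>.cauchy_transform_atom[OF Y, of \<xi>] free_convolution_power_cauchy(2)[OF zp]
    by (simp add: z_def w_def m_def)
  have "(\<lambda>n. \<i> * of_real (Y n) / (\<i> * of_real (Y n) * G (w n))) \<longlonglongrightarrow> \<i> * of_real 0 / of_real m"
    by (intro tendsto_divide L1 tendsto_intros Y) (use m in auto)
  moreover have "\<i> * of_real (Y n) / (\<i> * of_real (Y n) * G (w n)) = F (w n)" for n
    using Y(2)[of n] by (simp add: F_def)
  ultimately have LF: "(\<lambda>n. F (w n)) \<longlonglongrightarrow> 0" by simp
  have Lz: "z \<longlonglongrightarrow> of_real \<xi> + \<i> * of_real 0" unfolding z_def by (intro tendsto_intros Y)
  define x0 where "x0 = \<xi> / T"
  have wz: "of_real T * w n = z n + of_real (T - 1) * F (w n)" for n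
    using Hw[of n] by (simp add: H_def algebra_simps)
  have "(\<lambda>n. (z n + of_real (T - 1) * F (w n)) / of_real T) \<longlonglongrightarrow> (of_real \<xi> + \<i> * of_real 0 + of_real (T - 1) * 0) / of_real T"
    by (intro tendsto_intros Lz LF) (use T in auto)
  then have Lw: "w \<longlonglongrightarrow> of_real x0"
    using T unfolding wz[symmetric] by (simp add: x0_def)
  have L2: "(\<lambda>n. (w n - of_real x0) * G (w n)) \<longlonglongrightarrow> of_real (measure \<mu> {x0})"
  proof -
    have t: "(\<lambda>n. (w n - of_real x0) * (1 / (w n - of_real (\<alpha> i)))) \<longlonglongrightarrow> (if \<alpha> i = x0 then 1 else 0)" for i
    proof (cases "\<alpha> i = x0")
      case True
      have "(w n - of_real x0) * (1 / (w n - of_real (\<alpha> i))) = 1" for n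
        using nonreal[OF wp[of n], of x0] True by simp
      then show ?thesis using True by simp
    next
      case False
      have "(\<lambda>n. (w n - of_real x0) * (1 / (w n - of_real (\<alpha> i)))) \<longlonglongrightarrow> (of_real x0 - of_real x0) * (1 / (of_real x0 - of_real (\<alpha> i)))"
        by (intro tendsto_intros Lw) (use False in auto)
      then show ?thesis using False by simp
    qed
    have "(\<lambda>n. (\<Sum>i<k. (w n - of_real x0) * (1 / (w n - of_real (\<alpha> i)))) / of_nat k) \<longlonglongrightarrow> (\<Sum>i<k. if \<alpha> i = x0 then 1 else 0) / of_nat k"
      by (intro tendsto_intros t) (use k in auto)
    moreover have "(\<Sum>i<k. if \<alpha> i = x0 then 1 else (0::complex)) = of_nat (card {i. i < k \<and> \<alpha> i = x0})"
      by (simp add: sum.If_cases Int_def conj_commute)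
    ultimately show ?thesis by (simp add: G_def measure_\<mu> sum_distrib_left)
  qed
  \<comment> \<open>The equation \<open>H (w n) = z n\<close>, solved for T (w - x0) and multiplied
    by \<open>G\<close>, turns the unknown term (T - 1) F into the constant T - 1; its limit is the
    relation between the two masses.\<close>
  have "of_real T * ((w n - of_real x0) * G (w n)) = \<i> * of_real (Y n) * G (w n) + of_real (T - 1)" for n
  proof -
    have "of_real T * (w n - of_real x0) = \<i> * of_real (Y n) + of_real (T - 1) * F (w n)"
      using wz[of n] T by (simp add: z_def x0_def algebra_simps)
    then have "of_real T * (w n - of_real x0) * G (w n) = (\<i> * of_real (Y n) + of_real (T - 1) * F (w n)) * G (w n)" by simp
    also have "\<dots> = \<i> * of_real (Y n) * G (w n) + of_real (T - 1) * (F (w n) * G (w n))" by (simp add: algebra_simps)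
    also have "F (w n) * G (w n) = 1" using G_nonzero[OF wp] by (simp add: F_def)
    finally show ?thesis by (simp add: mult.assoc)
  qed
  moreover have "(\<lambda>n. of_real T * ((w n - of_real x0) * G (w n))) \<longlonglongrightarrow> of_real T * of_real (measure \<mu> {x0})"
    by (intro tendsto_intros L2)
  moreover have "(\<lambda>n. \<i> * of_real (Y n) * G (w n) + of_real (T - 1)) \<longlonglongrightarrow> of_real m + of_real (T - 1)"
    by (intro tendsto_intros L1)
  ultimately have "complex_of_real T * of_real (measure \<mu> {x0}) = of_real m + of_real (T - 1)"
    using LIMSEQ_unique by auto
  then have "T * measure \<mu> {x0} = m + (T - 1)" by (metis of_real_add of_real_eq_iff of_real_mult)
  moreover have "T * measure \<mu> {x0} \<le> T * (1 - 1 / T)" using small T by (intro mult_left_mono) auto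
  moreover have "T * (1 - 1 / T) = T - 1" using T by (simp add: field_simps)
  ultimately show False using m by simp
qed

end

section \<open>Spectral distributions\<close>

text \<open>The exponential series is integrated term by term; bounded support dominates it by the
  exponential series at \<open>\<bar>t\<bar> * R\<close>. So moments determine the characteristic
  function, and with it a boundedly supported measure.\<close>

lemma char_eq_moment_series:
  assumes "real_distribution M" and R: "AE s in M. \<bar>s\<bar> \<le> R"
  shows "(\<lambda>n. (\<i> * of_real t) ^ n /\<^sub>R fact n * of_real (\<integral>s. s ^ n \<partial>M)) sums char M t"
proof -
  interpret real_distribution M by fact
  define f where "f n s = (\<i> * of_real (t * s)) ^ n /\<^sub>R fact n" for n and s :: real
  have b: "AE s in M. norm (f n s) \<le> (\<bar>t\<bar> * R) ^ n /\<^sub>R fact n" for n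
    using R
  proof eventually_elim
    case (elim s)
    then have le: "\<bar>t * s\<bar> \<le> \<bar>t\<bar> * R" by (simp add: abs_mult mult_left_mono)
    have "norm (f n s) = \<bar>t * s\<bar> ^ n /\<^sub>R fact n"
      by (simp add: f_def norm_power norm_mult abs_mult)
    also have "\<dots> \<le> (\<bar>t\<bar> * R) ^ n /\<^sub>R fact n"
      using le by (intro scaleR_left_mono power_mono) auto
    finally show ?case .
  qed
  have i: "integrable M (f n)" for n
    by (rule integrable_const_bound[OF b]) (simp add: f_def)
  have "(\<lambda>n. \<integral>s. f n s \<partial>M) sums (\<integral>s. (\<Sum>n. f n s) \<partial>M)"
  proof (rule sums_integral[OF i])
    show "AE s in M. summable (\<lambda>n. norm (f n s))"
      unfolding f_def by (intro AE_I2 summable_norm_exp)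
    show "summable (\<lambda>n. \<integral>s. norm (f n s) \<partial>M)"
    proof (rule summable_comparison_test'[OF summable_exp_generic[of "\<bar>t\<bar> * R"]])
      fix n
      have "(\<integral>s. norm (f n s) \<partial>M) \<le> (\<integral>s. (\<bar>t\<bar> * R) ^ n /\<^sub>R fact n \<partial>M)"
        by (rule integral_mono_AE[OF integrable_norm[OF i] _ b]) simp
      then show "norm (\<integral>s. norm (f n s) \<partial>M) \<le> (\<bar>t\<bar> * R) ^ n /\<^sub>R fact n"
        using prob_space by simp
    qed
  qed
  also have "(\<integral>s. (\<Sum>n. f n s) \<partial>M) = char M t"
    by (simp add: char_def f_def exp_def)
  also have "(\<lambda>n. \<integral>s. f n s \<partial>M) = (\<lambda>n. (\<i> * of_real t) ^ n /\<^sub>R fact n * of_real (\<integral>s. s ^ n \<partial>M))"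
  proof
    fix n
    have "f n s = (\<i> * of_real t) ^ n /\<^sub>R fact n * complex_of_real (s ^ n)" for s
      by (simp add: f_def power_mult_distrib)
    then show "(\<integral>s. f n s \<partial>M) = (\<i> * of_real t) ^ n /\<^sub>R fact n * of_real (\<integral>s. s ^ n \<partial>M)"
      by (simp only: integral_mult_right_zero integral_complex_of_real)
  qed
  finally show ?thesis .
qed

lemma bounded_distribution_moments_unique:
  assumes "real_distribution M" "AE s in M. \<bar>s\<bar> \<le> R" "real_distribution N" "AE s in N. \<bar>s\<bar> \<le> R'"
    and eq: "\<And>n. (\<integral>s. s ^ n \<partial>M) = (\<integral>s. s ^ n \<partial>N)"
  shows "M = N"
proof (rule Levy_uniqueness[OF assms(1,3)])
  show "char M = char N"
  proof
    fix t
    show "char M t = char N t"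
      using sums_unique2[OF char_eq_moment_series[OF assms(1,2)] char_eq_moment_series[OF assms(3,4), folded eq]] .
  qed
qed

lemma (in finite_atoms) spectral_distribution_eq_\<mu>:
  assumes "\<And>n. \<tau> (a ^ n) = complex_of_real ((\<Sum>i<k. \<alpha> i ^ n) / k)"
  shows "spectral_distribution \<tau> a = \<mu>"
  unfolding spectral_distribution_def
proof (rule the_equality)
  have mom: "(\<integral>s. s ^ n \<partial>\<mu>) = (\<Sum>i<k. \<alpha> i ^ n) / k" for n
    by (subst integral_\<mu>) (auto simp: divide_inverse)
  have bd: "AE s in \<mu>. \<bar>s\<bar> \<le> (\<Sum>i<k. \<bar>\<alpha> i\<bar>)"
    unfolding \<mu>_def by (subst AE_distr_iff)
      (use lessThan_k in \<open>auto simp: AE_measure_pmf_iff intro: member_le_sum\<close>)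
  show "prob_space \<mu> \<and> sets \<mu> = sets borel \<and> (\<exists>R. AE s in \<mu>. \<bar>s\<bar> \<le> R)
      \<and> (\<forall>n. \<tau> (a ^ n) = complex_of_real (\<integral>s. s ^ n \<partial>\<mu>))"
    using real_distribution_\<mu> bd assms mom
    by (auto simp: real_distribution_def real_distribution_axioms_def)
  fix \<rho> assume \<rho>: "prob_space \<rho> \<and> sets \<rho> = sets borel \<and> (\<exists>R. AE s in \<rho>. \<bar>s\<bar> \<le> R)
      \<and> (\<forall>n. \<tau> (a ^ n) = complex_of_real (\<integral>s. s ^ n \<partial>\<rho>))"
  then obtain R where R: "AE s in \<rho>. \<bar>s\<bar> \<le> R" by blast
  have rd: "real_distribution \<rho>" using \<rho> by (simp add: real_distribution_def real_distribution_axioms_def)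
  show "\<rho> = \<mu>"
  proof (rule bounded_distribution_moments_unique[OF rd R real_distribution_\<mu> bd])
    fix n
    have "complex_of_real (\<integral>s. s ^ n \<partial>\<rho>) = complex_of_real (\<integral>s. s ^ n \<partial>\<mu>)" using \<rho> assms mom by metis
    then show "(\<integral>s. s ^ n \<partial>\<rho>) = (\<integral>s. s ^ n \<partial>\<mu>)" by (simp only: of_real_eq_iff)
  qed
qed

section \<open>Moments of Hermitian elements of M_k\<close>

context tracial_vN_algebra
begin

lemma tau_sum: "(\<And>i. i \<in> I \<Longrightarrow> f i \<in> A) \<Longrightarrow> \<tau> (\<Sum>i\<in>I. f i) = (\<Sum>i\<in>I. \<tau> (f i))"
  and A_sum: "(\<And>i. i \<in> I \<Longrightarrow> f i \<in> A) \<Longrightarrow> (\<Sum>i\<in>I. f i) \<in> A"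
  by (induction I rule: infinite_finite_induct) (auto simp: tau_zero tau_add)

lemma Mk_subset: "is_Mk A \<tau> k M \<Longrightarrow> M \<subseteq> A"
  unfolding is_Mk_def by (auto intro!: A_sum)

lemma Mk_uminus:
  assumes "is_Mk A \<tau> k M" "a \<in> M" shows "- a \<in> M"
proof -
  obtain e where M: "M = {(\<Sum>i<k. c i *\<^sub>C e i) | c. True}" using assms(1) unfolding is_Mk_def by blast
  then obtain c where "a = (\<Sum>i<k. c i *\<^sub>C e i)" using assms(2) by auto
  then have "- a = (\<Sum>i<k. (- c i) *\<^sub>C e i)" by (simp add: scaleC_minus_left sum_negf)
  then show ?thesis unfolding M by (intro CollectI exI[of _ "\<lambda>i. - c i"]) auto
qed

text \<open>Multiplying the expansions of \<open>a\<close> and \<open>adj a\<close> by one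
  projection isolates a coefficient, and the nonzero trace of the projection forces it to be real.
  Powers act coefficientwise, so the moments are averages of powers.\<close>

lemma Mk_hermitian_moments:
  assumes M: "is_Mk A \<tau> k M" and a: "a \<in> M" "hermitian a"
  obtains \<alpha> :: "nat \<Rightarrow> real" where "\<And>n. \<tau> (a ^ n) = complex_of_real ((\<Sum>i<k. \<alpha> i ^ n) / k)"
proof -
  obtain e where e: "\<And>i. i < k \<Longrightarrow> e i \<in> A" "\<And>i. i < k \<Longrightarrow> is_projection (e i)" "\<And>i. i < k \<Longrightarrow> \<tau> (e i) = 1 / of_nat k"
    "\<And>i j. i < k \<Longrightarrow> j < k \<Longrightarrow> i \<noteq> j \<Longrightarrow> e i * e j = 0" "(\<Sum>i<k. e i) = 1"
    "M = {(\<Sum>i<k. c i *\<^sub>C e i) | c. True}"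
    using M unfolding is_Mk_def by blast
  obtain c where c: "a = (\<Sum>i<k. c i *\<^sub>C e i)" using a(1) e(6) by auto
  have ej: "e i * e j = (if i = j then e j else 0)" if "i < k" "j < k" for i j
    using e(2,4) that by (auto simp: is_projection_def)
  have mult: "(\<Sum>i<k. d i *\<^sub>C e i) * e j = d j *\<^sub>C e j" if j: "j < k" for d j
  proof -
    have "(\<Sum>i<k. d i *\<^sub>C e i) * e j = (\<Sum>i<k. if i = j then d j *\<^sub>C e j else 0)"
      unfolding sum_distrib_right scaleC_mult_left
      by (intro sum.cong) (auto simp: ej j scaleC_0_right)
    then show ?thesis using j by simp
  qed
  have real: "c j \<in> \<real>" if j: "j < k" for j
  proof -
    have "(\<Sum>i<k. cnj (c i) *\<^sub>C e i) = adj a"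
      unfolding c adj_sum adj_scaleC using e(2) by (intro sum.cong) (auto simp: is_projection_def hermitian_def)
    then have "(\<Sum>i<k. cnj (c i) *\<^sub>C e i) = (\<Sum>i<k. c i *\<^sub>C e i)" using a(2) c by (simp add: hermitian_def)
    then have "cnj (c j) *\<^sub>C e j = c j *\<^sub>C e j" using mult[OF j] by metis
    then have "cnj (c j) * \<tau> (e j) = c j * \<tau> (e j)" using tau_scaleC e(1)[OF j] by metis
    then have "cnj (c j) = c j" using e(3)[OF j] j by simp
    then show ?thesis by (simp add: Reals_cnj_iff)
  qed
  have pow: "a ^ n = (\<Sum>i<k. (c i ^ n) *\<^sub>C e i)" for n
  proof (induction n)
    case 0 then show ?case using e(5) by (simp add: scaleC_one_bop)
  next
    case (Suc n)
    have "a ^ Suc n = (\<Sum>j<k. (c j ^ n) *\<^sub>C (a * e j))" by (simp add: Suc sum_distrib_left scaleC_mult_right)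
    also have "\<dots> = (\<Sum>j<k. (c j ^ Suc n) *\<^sub>C e j)"
      by (intro sum.cong) (auto simp: c mult scaleC_scaleC mult.commute)
    finally show ?case .
  qed
  have "\<tau> (a ^ n) = complex_of_real ((\<Sum>i<k. Re (c i) ^ n) / k)" for n
  proof -
    have "\<tau> (a ^ n) = (\<Sum>i<k. c i ^ n * (1 / of_nat k))"
      unfolding pow by (subst tau_sum) (auto simp: tau_scaleC e)
    also have "\<dots> = (\<Sum>i<k. of_real (Re (c i) ^ n) * (1 / of_nat k))"
      using real by (intro sum.cong) (auto simp: of_real_Re)
    finally show ?thesis by (simp add: sum_divide_distrib)
  qed
  then show ?thesis by (rule that)
qed

end

theorem theorem1p1:
  fixes A :: "'h::complex_hilbert bop set"
    and \<tau> :: "'h bop \<Rightarrow> complex"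
    and k :: nat
    and M :: "'h bop set"
    and a p :: "'h bop"
    and Lm Lp t :: real
  assumes "II1_factor A"
    and "faithful_normal_tracial_state A \<tau>"
    and "k > 0"
    and "is_Mk A \<tau> k M"
    and "a \<in> M" and "hermitian a"
    and "Lm *\<^sub>R 1 \<preceq> a" and "a \<preceq> Lp *\<^sub>R 1"
    and "0 < t" and "t \<le> 1"
    and "p \<in> A" and "is_projection p" and "\<tau> p = complex_of_real t"
    and "free_from \<tau> p M"
    and "\<forall>\<xi>. is_atom (spectral_distribution \<tau> a) \<xi> \<longrightarrow>
           measure (spectral_distribution \<tau> a) {\<xi>} \<le> 1 - 1 / real k"
  shows "(t \<le> 1 / real k \<longrightarrow>
            (\<forall>\<xi>. \<not> is_atom (free_convolution_power (spectral_distribution \<tau> a) (1 / t)) \<xi>) \<and>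
            t_norm p a \<le> max
              \<bar>t * Lp + 2 * std_dev \<tau> a * sqrt (t * (1 - t)) + (1 - t) * mean \<tau> a\<bar>
              \<bar>t * Lm - 2 * std_dev \<tau> a * sqrt (t * (1 - t)) + (1 - t) * mean \<tau> a\<bar>) \<and>
         (1 / real k < t \<longrightarrow>
            t_norm p a \<le> Max {Lp, Lm,
              \<bar>t * Lp + 2 * std_dev \<tau> a * sqrt (t * (1 - t)) + (1 - t) * mean \<tau> a\<bar>,
              \<bar>t * Lm - 2 * std_dev \<tau> a * sqrt (t * (1 - t)) + (1 - t) * mean \<tau> a\<bar>})"
proof -
  interpret tr: tracial_vN_algebra A \<tau>
    using assms(1,2) by unfold_locales (auto simp: II1_factor_def is_factor_def)
  interpret fp: free_projection A \<tau> p M t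
    using assms tr.Mk_subset[OF assms(4)] by unfold_locales auto
  note bound = fp.t_norm_le[OF assms(5,6) tr.Mk_uminus[OF assms(4,5)] assms(7,8)]
  obtain \<alpha> :: "nat \<Rightarrow> real" where \<alpha>: "\<And>n. \<tau> (a ^ n) = complex_of_real ((\<Sum>i<k. \<alpha> i ^ n) / k)"
    using tr.Mk_hermitian_moments[OF assms(4,5,6)] by blast
  interpret pw: free_power k \<alpha> "1 / t"
    using assms(3,9,10) by unfold_locales auto
  interpret sd: real_distribution pw.\<mu> by (rule pw.real_distribution_\<mu>)
  have sd_eq: "spectral_distribution \<tau> a = pw.\<mu>" by (rule pw.spectral_distribution_eq_\<mu>[OF \<alpha>])
  have "\<not> is_atom (free_convolution_power (spectral_distribution \<tau> a) (1 / t)) \<xi>" if t: "t \<le> 1 / real k" for \<xi>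
    unfolding sd_eq
  proof (rule pw.free_convolution_power_no_atom)
    fix x
    show "measure pw.\<mu> {x} \<le> 1 - 1 / (1 / t)"
    \<comment> \<open>The assumption speaks of atoms only. At other points the mass is 0, which is
      at most 1 - t because \<open>t \<le> 1\<close>; at atoms, 1 - 1/k is at most 1 - t because t
      is at most 1/k.\<close>
    proof (cases "measure pw.\<mu> {x} = 0")
      case False
      then have "is_atom pw.\<mu> x"
        unfolding is_atom_def sd.emeasure_eq_measure by (simp add: zero_less_measure_iff)
      then have "measure pw.\<mu> {x} \<le> 1 - 1 / real k" using assms(15) unfolding sd_eq by blast
      then show ?thesis using t by simp
    qed (use assms(10) in simp)
  qed
  moreover have "max x y \<le> Max {Lp, Lm, x, y}" for x y by auto
  ultimately show ?thesis using bound order_trans by blast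
qed

end
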